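(* Consider steady self-similar entropy solutions $U$, without stagnation points, of the two-dimensional full Euler equations for a polytropic gas with exponent $\gamma>1$ (with values in $\mathcal P_K$ for some $K>1$). For $\gamma=1.4$, the maximum possible number of sectors of such a flow is two. There are other values of $\gamma>1$ for which flows with three sectors exist, but there is no value of $\gamma>1$ for which there is a flow with more than three sectors.
   Context: Notation: $\rho$ density, $\vec u=(u,v)$ velocity, $p$ pressure, $e$ specific internal energy, $S$ specific entropy, $E=\rho\left(\frac{u^2+v^2}{2}+e\right)$, $U=(\rho,\rho u,\rho v,E)^T$. Polytropic gas: $e=\frac{p}{(\gamma-1)\rho}$, sound speed $c=\sqrt{\gamma p/\rho}$, $S=c_v\ln(p\rho^{-\gamma})+\text{const}$, $c_v>0$. Phase space: $\mathcal P_K$ is the set of $U$ with $K^{-1}\le\rho\le K$, $K^{-1}\le e\le K$, $|U|\le K$. Fluxes: $f^x(U)=(\rho u,\rho u^2+p,\rho uv,u(E+p))^T$, $f^y(U)=(\rho v,\rho uv,\rho v^2+p,v(E+p))^T$, $\psi^x=\rho uS$, $\psi^y=\rho vS$. A steady self-similar entropy solution is a $2\pi$-periodic function $\theta\mapsto U(\theta)\in\mathcal P_K$ in $L^\infty$ ($\theta$ is the polar angle), in a version such that for all $\theta_1<\theta_2$ $$(\sin\theta f^x(U)-\cos\theta f^y(U))\big|_{\theta_1}^{\theta_2}=\int_{\theta_1}^{\theta_2}\cos\eta f^x(U(\eta))+\sin\eta f^y(U(\eta))\,d\eta,$$ $$(\sin\theta\psi^x(U)-\cos\theta\psi^y(U))\big|_{\theta_1}^{\theta_2}\le\int_{\theta_1}^{\theta_2}\cos\eta\psi^x(U(\eta))+\sin\eta\psi^y(U(\eta))\,d\eta.$$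 No stagnation points means $\vec u(\theta)\ne0$ for every $\theta$; then $U$ has one-sided limits at every discontinuity and is normalised to be right-continuous. Sectors: let $N(\theta)=u(\theta)\sin\theta-v(\theta)\cos\theta$. The set $\{\theta\in[0,2\pi[:N(\theta)=0\}$ is finite; write it as $\theta_1<\dots<\theta_m$ and $\theta_{m+1}=\theta_1$ (mod $2\pi$, i.e. $\theta_1+2\pi$). The sectors are the intervals $I_i=[\theta_i,\theta_{i+1}]$, $i=1,\dots,m$. *)

theory Defs
  imports "HOL-Analysis.Analysis"
begin

text \<open>A state is the vector \<open>(\<rho>, \<rho> u, \<rho> v, E)\<close> of conserved quantities. The other quantities are
  functions of the state; the specific internal energy is obtained by solving
  \<open>E = \<rho> ((u\<^sup>2 + v\<^sup>2) / 2 + e)\<close> for \<open>e\<close>.\<close>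

type_synonym state = "real ^ 4"

definition density :: "state \<Rightarrow> real"
  where "density w = w $ 1"

definition vel_x :: "state \<Rightarrow> real"
  where "vel_x w = w $ 2 / w $ 1"

definition vel_y :: "state \<Rightarrow> real"
  where "vel_y w = w $ 3 / w $ 1"

definition total_energy :: "state \<Rightarrow> real"
  where "total_energy w = w $ 4"

definition internal_energy :: "state \<Rightarrow> real"
  where "internal_energy w = total_energy w / density w - ((vel_x w)\<^sup>2 + (vel_y w)\<^sup>2) / 2"

text \<open>Polytropic gas: \<open>e = p / ((\<gamma> - 1) \<rho>)\<close>, solved for \<open>p\<close>.\<close>

definition pressure :: "real \<Rightarrow> state \<Rightarrow> real"
  where "pressure \<gamma> w = (\<gamma> - 1) * density w * internal_energy w"

definition entropy :: "real \<Rightarrow> real \<Rightarrow> real \<Rightarrow> state \<Rightarrow> real"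
  where "entropy \<gamma> cv s0 w = cv * ln (pressure \<gamma> w * density w powr (- \<gamma>)) + s0"

definition phase_space :: "real \<Rightarrow> state set"
  where "phase_space K =
    {w. inverse K \<le> density w \<and> density w \<le> K \<and>
        inverse K \<le> internal_energy w \<and> internal_energy w \<le> K \<and> norm w \<le> K}"

definition flux_x :: "real \<Rightarrow> state \<Rightarrow> state"
  where "flux_x \<gamma> w = vector
    [density w * vel_x w,
     density w * (vel_x w)\<^sup>2 + pressure \<gamma> w,
     density w * vel_x w * vel_y w,
     vel_x w * (total_energy w + pressure \<gamma> w)]"

definition flux_y :: "real \<Rightarrow> state \<Rightarrow> state"
  where "flux_y \<gamma> w = vector
    [density w * vel_y w,
     density w * vel_x w * vel_y w,
     density w * (vel_y w)\<^sup>2 + pressure \<gamma> w,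
     vel_y w * (total_energy w + pressure \<gamma> w)]"

definition entropy_flux_x :: "real \<Rightarrow> real \<Rightarrow> real \<Rightarrow> state \<Rightarrow> real"
  where "entropy_flux_x \<gamma> cv s0 w = density w * vel_x w * entropy \<gamma> cv s0 w"

definition entropy_flux_y :: "real \<Rightarrow> real \<Rightarrow> real \<Rightarrow> state \<Rightarrow> real"
  where "entropy_flux_y \<gamma> cv s0 w = density w * vel_y w * entropy \<gamma> cv s0 w"

text \<open>All integrands below are bounded and measurable, so the Henstock-Kurzweil integral
  agrees with the Lebesgue integral.\<close>

definition entropy_solution :: "real \<Rightarrow> real \<Rightarrow> real \<Rightarrow> real \<Rightarrow> (real \<Rightarrow> state) \<Rightarrow> bool"
  where "entropy_solution \<gamma> cv s0 K U \<longleftrightarrow>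
    U \<in> borel_measurable lebesgue \<and>
    (\<forall>\<theta>. U (\<theta> + 2 * pi) = U \<theta>) \<and>
    (\<forall>\<theta>. U \<theta> \<in> phase_space K) \<and>
    (\<forall>\<theta>1 \<theta>2. \<theta>1 < \<theta>2 \<longrightarrow>
      (sin \<theta>2 *\<^sub>R flux_x \<gamma> (U \<theta>2) - cos \<theta>2 *\<^sub>R flux_y \<gamma> (U \<theta>2))
      - (sin \<theta>1 *\<^sub>R flux_x \<gamma> (U \<theta>1) - cos \<theta>1 *\<^sub>R flux_y \<gamma> (U \<theta>1))
      = integral {\<theta>1..\<theta>2}
          (\<lambda>\<eta>. cos \<eta> *\<^sub>R flux_x \<gamma> (U \<eta>) + sin \<eta> *\<^sub>R flux_y \<gamma> (U \<eta>))) \<and>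
    (\<forall>\<theta>1 \<theta>2. \<theta>1 < \<theta>2 \<longrightarrow>
      (sin \<theta>2 * entropy_flux_x \<gamma> cv s0 (U \<theta>2) - cos \<theta>2 * entropy_flux_y \<gamma> cv s0 (U \<theta>2))
      - (sin \<theta>1 * entropy_flux_x \<gamma> cv s0 (U \<theta>1) - cos \<theta>1 * entropy_flux_y \<gamma> cv s0 (U \<theta>1))
      \<le> integral {\<theta>1..\<theta>2}
          (\<lambda>\<eta>. cos \<eta> * entropy_flux_x \<gamma> cv s0 (U \<eta>) + sin \<eta> * entropy_flux_y \<gamma> cv s0 (U \<eta>)))"

definition no_stagnation_points :: "(real \<Rightarrow> state) \<Rightarrow> bool"
  where "no_stagnation_points U \<longleftrightarrow> (\<forall>\<theta>. (vel_x (U \<theta>), vel_y (U \<theta>)) \<noteq> (0, 0))"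

text \<open>Right-continuity only selects a representative. That one-sided limits exist is a
  consequence of the other conditions and is therefore not required.\<close>

definition nonstagnant_flow :: "real \<Rightarrow> real \<Rightarrow> real \<Rightarrow> (real \<Rightarrow> state) \<Rightarrow> bool"
  where "nonstagnant_flow \<gamma> cv s0 U \<longleftrightarrow>
    (\<exists>K>1. entropy_solution \<gamma> cv s0 K U) \<and>
    no_stagnation_points U \<and>
    (\<forall>\<theta>. continuous (at_right \<theta>) U)"

definition normal_vel :: "(real \<Rightarrow> state) \<Rightarrow> real \<Rightarrow> real"
  where "normal_vel U \<theta> = vel_x (U \<theta>) * sin \<theta> - vel_y (U \<theta>) * cos \<theta>"

definition sector_angles :: "(real \<Rightarrow> state) \<Rightarrow> real set"
  where "sector_angles U = {\<theta> \<in> {0..<2 * pi}. normal_vel U \<theta> = 0}"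

text \<open>For \<open>sector_angles U = {\<theta>\<^sub>1 < \<dots> < \<theta>\<^sub>m}\<close> this is the list of the intervals
  \<open>[\<theta>\<^sub>i, \<theta>\<^sub>i\<^sub>+\<^sub>1]\<close> for \<open>i = 1, \<dots>, m\<close>, where \<open>\<theta>\<^sub>m\<^sub>+\<^sub>1 = \<theta>\<^sub>1 + 2 \<pi>\<close>.\<close>

definition sectors :: "(real \<Rightarrow> state) \<Rightarrow> real set list"
  where "sectors U =
    (let ts = sorted_list_of_set (sector_angles U)
     in map2 (\<lambda>a b. {a..b}) ts (tl ts @ [hd ts + 2 * pi]))"

text \<open>The finiteness condition is needed because \<open>sorted_list_of_set\<close> maps infinite sets to
  the empty list.\<close>

definition has_num_sectors :: "(real \<Rightarrow> state) \<Rightarrow> nat \<Rightarrow> bool"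
  where "has_num_sectors U m \<longleftrightarrow> finite (sector_angles U) \<and> length (sectors U) = m"

end

theory Submission
  imports Defs
begin

text \<open>Why a sector is large. Let \<open>L\<close> be the radial velocity and \<open>n\<close> the speed normal to the ray at
  the polar angle \<open>t\<close>, measured in the direction in which the fluid crosses the rays. Inside a sector the
  conservation laws give \<open>L' = n\<close>, so the fluid first approaches the origin (\<open>L < 0\<close>) and then
  leaves it (\<open>L > 0\<close>). Where the speed \<open>q = sqrt (L\<^sup>2 + n\<^sup>2)\<close> is constant,
  \<open>L = q sin (t - t\<^sub>0)\<close>, and if \<open>q\<close> is at most the speed \<open>Q\<close> at the bounding ray, then each
  of the two halves takes at least a right angle (\<open>arcsin_increase_le\<close>), because \<open>L = - Q\<close> and
  \<open>L = Q\<close> at the two ends.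

  For given fluxes of mass, momentum and energy, \<open>n\<close> solves a quadratic equation; write \<open>B\<close> for
  the mean of its roots and \<open>W = n - B\<close>. Where \<open>W \<noteq> 0\<close> the velocity is locally constant or jumps from
  the larger root to the smaller one, the only jump that does not destroy entropy
  (\<open>no_expansion_shock\<close>). Where \<open>W = 0\<close> the flow is a simple wave. Approaching the origin, both
  shocks and waves slow the fluid down (\<open>q2_antimono_incoming\<close>), so this half of the sector takes at
  least a right angle. Leaving the origin, \<open>W\<close> decreases: either there is no shock, the speed
  increases towards the end, and this half takes a right angle as well; or there is a single shock between
  two constant states, and the right angle is diminished by the deflection at the shock
  (\<open>outgoing_angle\<close>). Positivity of the pressure bounds this deflection by \<open>arcsin (1 / \<gamma>)\<close>
  (\<open>shock_deflection_le\<close>).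

  So zeros of the normal velocity are at least \<open>\<pi> - arcsin (1 / \<gamma>)\<close> apart (\<open>zeros_spaced\<close>). This is
  more than \<open>\<pi> / 2\<close> for every \<open>\<gamma> > 1\<close> and more than \<open>2 \<pi> / 3\<close> for \<open>\<gamma> = 7 / 5\<close>, which leaves room
  for at most three and two sectors. Two sectors occur in a parallel flow. Three sectors occur in a
  piecewise constant flow with one shock of maximal deflection in each sector
  (\<open>three_sector_flow\<close>): the three deflections have to add up to \<open>\<pi>\<close> and the pressures have to agree
  at the three contact discontinuities, which is possible for an interval of values of \<open>\<gamma>\<close>.\<close>

section \<open>Primitives of bounded functions\<close>

text \<open>The conservation laws say that certain Lipschitz functions are primitives of bounded
  measurable functions. Products and smooth functions of such primitives are again of this kind,
  with the integrands given by the usual differentiation rules. Working with integrands instead of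
  derivatives avoids every discussion of the points where the flow jumps.\<close>

definition primitive_on :: "real \<Rightarrow> real \<Rightarrow> (real \<Rightarrow> real) \<Rightarrow> (real \<Rightarrow> real) \<Rightarrow> bool"
  where "primitive_on a b F f \<longleftrightarrow>
    (\<exists>C. \<forall>x\<in>{a..b}. \<bar>f x\<bar> \<le> C) \<and>
    (\<forall>x y. a \<le> x \<longrightarrow> x \<le> y \<longrightarrow> y \<le> b \<longrightarrow> (f has_integral F y - F x) {x..y})"

lemma primitive_onD:
  "primitive_on a b F f \<Longrightarrow> a \<le> x \<Longrightarrow> x \<le> y \<Longrightarrow> y \<le> b \<Longrightarrow> (f has_integral F y - F x) {x..y}"
  unfolding primitive_on_def by blast

lemma primitive_on_bound:
  assumes "primitive_on a b F f"
  obtains C where "C \<ge> 0" "\<And>x. a \<le> x \<Longrightarrow> x \<le> b \<Longrightarrow> \<bar>f x\<bar> \<le> C"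
proof -
  obtain C where "\<And>x. x \<in> {a..b} \<Longrightarrow> \<bar>f x\<bar> \<le> C"
    using assms unfolding primitive_on_def by blast
  then show thesis
    by (intro that[of "max C 0"]) (auto simp: le_max_iff_disj)
qed

lemma primitive_on_subset:
  "primitive_on a b F f \<Longrightarrow> a \<le> c \<Longrightarrow> d \<le> b \<Longrightarrow> primitive_on c d F f"
  unfolding primitive_on_def by (meson atLeastAtMost_iff order_trans)

lemma primitive_on_cong:
  assumes "primitive_on a b F f" "\<And>x. a \<le> x \<Longrightarrow> x \<le> b \<Longrightarrow> F x = G x"
    "\<And>x. a \<le> x \<Longrightarrow> x \<le> b \<Longrightarrow> f x = g x"
  shows "primitive_on a b G g"
  unfolding primitive_on_def
proof (intro conjI allI impI)
  show "\<exists>C. \<forall>x\<in>{a..b}. \<bar>g x\<bar> \<le> C"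
    using assms unfolding primitive_on_def by (metis atLeastAtMost_iff)
  fix x y assume *: "a \<le> x" "x \<le> y" "y \<le> b"
  have "(f has_integral G y - G x) {x..y}"
    using primitive_onD[OF assms(1) *] assms(2)[of x] assms(2)[of y] * by simp
  then show "(g has_integral G y - G x) {x..y}"
    by (rule has_integral_eq[rotated]) (use * assms(3) in auto)
qed

lemma primitive_on_lipschitz:
  assumes "primitive_on a b F f"
  obtains C where "C \<ge> 0" "\<And>x y. a \<le> x \<Longrightarrow> x \<le> y \<Longrightarrow> y \<le> b \<Longrightarrow> \<bar>F y - F x\<bar> \<le> C * (y - x)"
proof -
  obtain C where C: "C \<ge> 0" "\<And>x. a \<le> x \<Longrightarrow> x \<le> b \<Longrightarrow> \<bar>f x\<bar> \<le> C"
    using primitive_on_bound[OF assms] by metis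
  show thesis
  proof (rule that[OF C(1)])
    fix x y assume *: "a \<le> x" "x \<le> y" "y \<le> b"
    show "\<bar>F y - F x\<bar> \<le> C * (y - x)"
      using has_integral_bound_real[OF C(1) finite.emptyI primitive_onD[OF assms *]] C(2) * by auto
  qed
qed

lemma primitive_on_continuous:
  assumes "primitive_on a b F f"
  shows "continuous_on {a..b} F"
proof -
  obtain C where C: "C \<ge> 0" "\<And>x y. a \<le> x \<Longrightarrow> x \<le> y \<Longrightarrow> y \<le> b \<Longrightarrow> \<bar>F y - F x\<bar> \<le> C * (y - x)"
    using primitive_on_lipschitz[OF assms] by metis
  have "C-lipschitz_on {a..b} F"
  proof (rule lipschitz_onI[OF _ C(1)])
    fix x y assume "x \<in> {a..b}" "y \<in> {a..b}"
    then show "dist (F x) (F y) \<le> C * dist x y"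
      using C(2)[of x y] C(2)[of y x] by (cases "x \<le> y") (auto simp: dist_real_def abs_minus_commute)
  qed
  then show ?thesis by (rule lipschitz_on_continuous_on)
qed

lemma primitive_on_mono:
  assumes "primitive_on a b F f" "a \<le> x" "x \<le> y" "y \<le> b"
    "\<And>t. x \<le> t \<Longrightarrow> t \<le> y \<Longrightarrow> 0 \<le> f t"
  shows "F x \<le> F y"
  using has_integral_nonneg[OF primitive_onD[OF assms(1-4)]] assms(5) by auto

lemma primitive_on_antimono:
  assumes "primitive_on a b F f" "a \<le> x" "x \<le> y" "y \<le> b"
    "\<And>t. x \<le> t \<Longrightarrow> t \<le> y \<Longrightarrow> f t \<le> 0"
  shows "F y \<le> F x"
  using has_integral_nonneg[OF has_integral_neg[OF primitive_onD[OF assms(1-4)]]] assms(5) by auto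

lemma primitive_on_zero:
  assumes "primitive_on a b F f" "a \<le> x" "x \<le> b" "a \<le> y" "y \<le> b"
    "\<And>t. a \<le> t \<Longrightarrow> t \<le> b \<Longrightarrow> f t = 0"
  shows "F x = F y"
proof (cases "x \<le> y")
  case True
  then show ?thesis
    using primitive_on_mono[OF assms(1), of x y] primitive_on_antimono[OF assms(1), of x y] assms by force
next
  case False
  then show ?thesis
    using primitive_on_mono[OF assms(1), of y x] primitive_on_antimono[OF assms(1), of y x] assms by force
qed

lemma primitive_on_add:
  assumes "primitive_on a b F f" "primitive_on a b G g"
  shows "primitive_on a b (\<lambda>x. F x + G x) (\<lambda>x. f x + g x)"
  unfolding primitive_on_def
proof (intro conjI allI impI)
  obtain C D where CD: "\<And>x. a \<le> x \<Longrightarrow> x \<le> b \<Longrightarrow> \<bar>f x\<bar> \<le> C" "\<And>x. a \<le> x \<Longrightarrow> x \<le> b \<Longrightarrow> \<bar>g x\<bar> \<le> D"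
    using primitive_on_bound[OF assms(1)] primitive_on_bound[OF assms(2)] by metis
  have "\<bar>f x + g x\<bar> \<le> C + D" if "x \<in> {a..b}" for x
    using CD[of x] that abs_triangle_ineq[of "f x" "g x"] by auto
  then show "\<exists>C. \<forall>x\<in>{a..b}. \<bar>f x + g x\<bar> \<le> C" by blast
  fix x y assume *: "a \<le> x" "x \<le> y" "y \<le> b"
  have "((\<lambda>x. f x + g x) has_integral (F y - F x) + (G y - G x)) {x..y}"
    by (intro has_integral_add primitive_onD[OF assms(1)] primitive_onD[OF assms(2)] *)
  then show "((\<lambda>x. f x + g x) has_integral F y + G y - (F x + G x)) {x..y}"
    by (simp add: algebra_simps)
qed

lemma primitive_on_cmult:
  assumes "primitive_on a b F f"
  shows "primitive_on a b (\<lambda>x. c * F x) (\<lambda>x. c * f x)"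
  unfolding primitive_on_def
proof (intro conjI allI impI)
  obtain C where C: "C \<ge> 0" "\<And>x. a \<le> x \<Longrightarrow> x \<le> b \<Longrightarrow> \<bar>f x\<bar> \<le> C"
    using primitive_on_bound[OF assms] by metis
  have "\<bar>c * f x\<bar> \<le> \<bar>c\<bar> * C" if "x \<in> {a..b}" for x
    using C(2)[of x] that by (auto simp: abs_mult intro: mult_left_mono)
  then show "\<exists>C. \<forall>x\<in>{a..b}. \<bar>c * f x\<bar> \<le> C" by blast
  fix x y assume *: "a \<le> x" "x \<le> y" "y \<le> b"
  show "((\<lambda>x. c * f x) has_integral c * F y - c * F x) {x..y}"
    using has_integral_mult_right[OF primitive_onD[OF assms *], of c] by (simp add: algebra_simps)
qed

lemma primitive_on_diff:
  assumes "primitive_on a b F f" "primitive_on a b G g"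
  shows "primitive_on a b (\<lambda>x. F x - G x) (\<lambda>x. f x - g x)"
  using primitive_on_add[OF assms(1) primitive_on_cmult[OF assms(2), of "-1"]] by simp

lemma primitive_on_add_const:
  "primitive_on a b F f \<Longrightarrow> primitive_on a b (\<lambda>x. F x + c) f"
  unfolding primitive_on_def by simp

lemma continuous_mult_integrable:
  fixes f g :: "real \<Rightarrow> real"
  assumes "continuous_on {x..y} g" "f integrable_on {x..y}" "\<And>t. t \<in> {x..y} \<Longrightarrow> \<bar>f t\<bar> \<le> C"
  shows "(\<lambda>t. g t * f t) integrable_on {x..y}"
proof -
  have "f absolutely_integrable_on {x..y}"
    by (rule absolutely_integrable_integrable_bound[where g = "\<lambda>_. C"]) (use assms in auto)
  moreover have "bounded (g ` {x..y})"
    using assms(1) compact_imp_bounded compact_continuous_image by blast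
  moreover have "g \<in> borel_measurable (lebesgue_on {x..y})"
    using assms(1) by (intro continuous_imp_measurable_on_sets_lebesgue) auto
  ultimately have "(\<lambda>t. g t * f t) absolutely_integrable_on {x..y}"
    by (intro absolutely_integrable_bounded_measurable_product_real) auto
  then show ?thesis by (rule set_lebesgue_integral_eq_integral(1))
qed

text \<open>On a short interval \<open>[u, v]\<close> the mean value theorem gives
  \<open>h (F v) - h (F u) = h' (F \<xi>) * (F v - F u)\<close>, which differs from the integral of
  \<open>h' (F t) * f t\<close> by at most the oscillation of \<open>h' \<circ> F\<close> times a multiple of \<open>v - u\<close>.
  Errors of this size add up to nothing.\<close>

lemma primitive_on_chain:
  assumes F: "primitive_on a b F f"
    and h: "\<And>t. a \<le> t \<Longrightarrow> t \<le> b \<Longrightarrow> (h has_real_derivative h' (F t)) (at (F t))"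
    and cont: "continuous_on {a..b} (\<lambda>t. h' (F t))"
  shows "primitive_on a b (\<lambda>t. h (F t)) (\<lambda>t. h' (F t) * f t)"
proof -
  obtain C where C: "C \<ge> 0" "\<And>x. a \<le> x \<Longrightarrow> x \<le> b \<Longrightarrow> \<bar>f x\<bar> \<le> C"
    using primitive_on_bound[OF F] by metis
  have "bounded ((\<lambda>t. h' (F t)) ` {a..b})"
    using cont compact_imp_bounded compact_continuous_image by blast
  then obtain B where B: "\<And>t. t \<in> {a..b} \<Longrightarrow> \<bar>h' (F t)\<bar> \<le> B"
    unfolding bounded_iff by (metis imageI real_norm_def)
  have bnd: "\<bar>h' (F t) * f t\<bar> \<le> \<bar>B\<bar> * C" if "t \<in> {a..b}" for t
    unfolding abs_mult using B[OF that] C(2)[of t] that by (intro mult_mono) auto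
  define g where "g t = h' (F t) * f t" for t
  have int: "g integrable_on {x..y}" if "a \<le> x" "x \<le> y" "y \<le> b" for x y
    unfolding g_def
  proof (rule continuous_mult_integrable)
    show "continuous_on {x..y} (\<lambda>t. h' (F t))"
      using cont by (rule continuous_on_subset) (use that in auto)
    show "f integrable_on {x..y}" using primitive_onD[OF F that] by blast
    show "\<And>t. t \<in> {x..y} \<Longrightarrow> \<bar>f t\<bar> \<le> C" using C that by auto
  qed
  have Fc: "continuous_on {a..b} F" by (rule primitive_on_continuous[OF F])
  have small: "\<bar>h (F y) - h (F x) - integral {x..y} g\<bar> \<le> \<epsilon> * (y - x)"
    if xy: "a \<le> x" "x \<le> y" "y \<le> b" and e: "\<epsilon> > 0" for x y \<epsilon>
  proof -
    define \<eta> where "\<eta> = \<epsilon> / (C + 1)"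
    have \<eta>: "\<eta> > 0" "\<eta> * C \<le> \<epsilon>" using C(1) e unfolding \<eta>_def by (auto simp: field_simps)
    have "uniformly_continuous_on {a..b} (\<lambda>t. h' (F t))"
      using cont by (rule compact_uniformly_continuous) simp
    then obtain \<delta> where \<delta>: "\<delta> > 0"
      "\<And>s t. s \<in> {a..b} \<Longrightarrow> t \<in> {a..b} \<Longrightarrow> \<bar>s - t\<bar> < \<delta> \<Longrightarrow> \<bar>h' (F s) - h' (F t)\<bar> < \<eta>"
      unfolding uniformly_continuous_on_def dist_real_def using \<eta>(1) by metis
    have loc: "\<bar>h (F v) - h (F u) - integral {u..v} g\<bar> \<le> \<epsilon> * (v - u)"
      if uv: "a \<le> u" "u \<le> v" "v \<le> b" "v - u < \<delta>" for u v
    proof -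
      have "\<exists>\<xi>. u \<le> \<xi> \<and> \<xi> \<le> v \<and> h (F v) - h (F u) = h' (F \<xi>) * (F v - F u)"
      proof -
        have hit: "\<exists>t. u \<le> t \<and> t \<le> v \<and> F t = z" if "min (F u) (F v) \<le> z" "z \<le> max (F u) (F v)" for z
          using IVT'[of F u z v] IVT2'[of F v z u] that uv continuous_on_subset[OF Fc, of "{u..v}"]
          by (fastforce simp: min_def max_def split: if_splits)
        have der: "\<exists>l. DERIV h z :> l" if z: "min (F u) (F v) \<le> z" "z \<le> max (F u) (F v)" for z
        proof -
          obtain t where "u \<le> t" "t \<le> v" "F t = z" using hit[OF z] by blast
          then show ?thesis using h[of t] uv by auto
        qed
        consider "F u < F v" | "F u > F v" | "F u = F v" by linarith
        then show ?thesis
        proof cases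
          case 1
          have "\<exists>l z. F u < z \<and> z < F v \<and> DERIV h z :> l \<and> h (F v) - h (F u) = (F v - F u) * l"
          proof (rule MVT[OF 1])
            show "continuous_on {F u..F v} h"
              using der 1 by (intro continuous_at_imp_continuous_on ballI) (auto dest!: DERIV_isCont)
            show "\<And>x. \<lbrakk>F u < x; x < F v\<rbrakk> \<Longrightarrow> h differentiable at x"
              using der 1 by (auto simp: real_differentiable_def)
          qed
          then obtain l z where z: "F u < z" "z < F v" "DERIV h z :> l" "h (F v) - h (F u) = (F v - F u) * l"
            by blast
          obtain t where t: "u \<le> t" "t \<le> v" "F t = z" using hit[of z] z by auto
          have "l = h' (F t)" using DERIV_unique[OF z(3)] h[of t] t uv by auto
          then show ?thesis using t z(4) by (auto simp: mult.commute)
        next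
          case 2
          have "\<exists>l z. F v < z \<and> z < F u \<and> DERIV h z :> l \<and> h (F u) - h (F v) = (F u - F v) * l"
          proof (rule MVT[OF 2])
            show "continuous_on {F v..F u} h"
              using der 2 by (intro continuous_at_imp_continuous_on ballI) (auto dest!: DERIV_isCont)
            show "\<And>x. \<lbrakk>F v < x; x < F u\<rbrakk> \<Longrightarrow> h differentiable at x"
              using der 2 by (auto simp: real_differentiable_def)
          qed
          then obtain l z where z: "F v < z" "z < F u" "DERIV h z :> l" "h (F u) - h (F v) = (F u - F v) * l"
            by blast
          obtain t where t: "u \<le> t" "t \<le> v" "F t = z" using hit[of z] z by auto
          have "l = h' (F t)" using DERIV_unique[OF z(3)] h[of t] t uv by auto
          then show ?thesis using t z(4) by (auto simp: algebra_simps intro!: exI[of _ t])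
        next
          case 3
          then show ?thesis using uv by auto
        qed
      qed
      then obtain \<xi> where \<xi>: "u \<le> \<xi>" "\<xi> \<le> v" "h (F v) - h (F u) = h' (F \<xi>) * (F v - F u)"
        by blast
      have "((\<lambda>t. h' (F \<xi>) * f t - g t) has_integral h' (F \<xi>) * (F v - F u) - integral {u..v} g) {u..v}"
        by (intro has_integral_diff has_integral_mult_right primitive_onD[OF F] integrable_integral int)
          (use uv in auto)
      then have "norm (h' (F \<xi>) * (F v - F u) - integral {u..v} g) \<le> \<epsilon> * Henstock_Kurzweil_Integration.content {u..v}"
      proof (rule has_integral_bound_real[rotated 2])
        fix t assume "t \<in> {u..v} - {}"
        then have t: "t \<in> {a..b}" "\<xi> \<in> {a..b}" "\<bar>\<xi> - t\<bar> < \<delta>" using \<xi> uv by auto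
        have "h' (F \<xi>) * f t - g t = (h' (F \<xi>) - h' (F t)) * f t"
          unfolding g_def by (simp add: algebra_simps)
        also have "\<bar>\<dots>\<bar> \<le> \<eta> * C"
          unfolding abs_mult using \<delta>(2)[OF t(2,1,3)] C(2)[of t] t \<eta> by (intro mult_mono) auto
        finally show "norm (h' (F \<xi>) * f t - g t) \<le> \<epsilon>" using \<eta> by simp
      qed (use e in auto)
      then show ?thesis using \<xi>(3) uv by simp
    qed
    have "x \<le> x \<longrightarrow> x \<le> y \<longrightarrow> y \<le> y \<longrightarrow> \<bar>h (F y) - h (F x) - integral {x..y} g\<bar> \<le> \<epsilon> * (y - x)"
      using xy(2)
    proof (induction rule: Bolzano[where P = "\<lambda>u v. x \<le> u \<longrightarrow> u \<le> v \<longrightarrow> v \<le> y \<longrightarrow>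
          \<bar>h (F v) - h (F u) - integral {u..v} g\<bar> \<le> \<epsilon> * (v - u)"])
      case (trans u v w)
      show ?case
      proof (intro impI)
        assume *: "x \<le> u" "u \<le> w" "w \<le> y"
        have "integral {u..v} g + integral {v..w} g = integral {u..w} g"
          by (rule Henstock_Kurzweil_Integration.integral_combine) (use trans * xy int in auto)
        moreover have "\<bar>h (F v) - h (F u) - integral {u..v} g\<bar> \<le> \<epsilon> * (v - u)"
          "\<bar>h (F w) - h (F v) - integral {v..w} g\<bar> \<le> \<epsilon> * (w - v)"
          using trans * by auto
        ultimately show "\<bar>h (F w) - h (F u) - integral {u..w} g\<bar> \<le> \<epsilon> * (w - u)"
          unfolding right_diff_distrib by linarith
      qed
    next
      case (local z)
      then show ?case using \<delta>(1) loc xy by (intro exI[of _ \<delta>]) auto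
    qed
    then show ?thesis using xy by simp
  qed
  show ?thesis
    unfolding primitive_on_def
  proof (intro conjI allI impI)
    show "\<exists>C. \<forall>x\<in>{a..b}. \<bar>h' (F x) * f x\<bar> \<le> C" using bnd by blast
    fix x y assume xy: "a \<le> x" "x \<le> y" "y \<le> b"
    have "\<bar>h (F y) - h (F x) - integral {x..y} g\<bar> \<le> 0"
    proof (rule field_le_epsilon)
      fix e :: real assume "e > 0"
      then have "e / (y - x + 1) > 0" using xy by simp
      from small[OF xy this]
      have "\<bar>h (F y) - h (F x) - integral {x..y} g\<bar> \<le> e / (y - x + 1) * (y - x)" .
      also have "\<dots> \<le> e" using \<open>e > 0\<close> xy by (simp add: field_simps)
      finally show "\<bar>h (F y) - h (F x) - integral {x..y} g\<bar> \<le> 0 + e" by simp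
    qed
    then have "h (F y) - h (F x) = integral {x..y} g" by simp
    then show "((\<lambda>t. h' (F t) * f t) has_integral h (F y) - h (F x)) {x..y}"
      using int[OF xy] unfolding g_def by (simp add: integrable_integral)
  qed
qed

lemma primitive_on_smooth:
  assumes "\<And>t. (F has_real_derivative f t) (at t)" "continuous_on {a..b} f"
  shows "primitive_on a b F f"
  unfolding primitive_on_def
proof (intro conjI allI impI)
  have "bounded (f ` {a..b})"
    using assms(2) compact_imp_bounded compact_continuous_image by blast
  then show "\<exists>C. \<forall>x\<in>{a..b}. \<bar>f x\<bar> \<le> C" by (auto simp: bounded_iff)
  fix x y assume "a \<le> x" "x \<le> y" "y \<le> b"
  then show "(f has_integral F y - F x) {x..y}"
    by (intro fundamental_theorem_of_calculus)
      (auto intro!: has_field_derivative_at_within assms(1)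
        simp flip: has_real_derivative_iff_has_vector_derivative)
qed

lemma primitive_on_square:
  assumes "primitive_on a b F f"
  shows "primitive_on a b (\<lambda>t. (F t)\<^sup>2) (\<lambda>t. 2 * F t * f t)"
  by (rule primitive_on_chain[OF assms, of "\<lambda>z. z\<^sup>2" "\<lambda>z. 2 * z"])
    (auto intro!: derivative_eq_intros continuous_intros primitive_on_continuous[OF assms])

lemma primitive_on_mult:
  assumes "primitive_on a b F f" "primitive_on a b G g"
  shows "primitive_on a b (\<lambda>t. F t * G t) (\<lambda>t. F t * g t + f t * G t)"
  by (rule primitive_on_cong[OF primitive_on_cmult[where c = "1 / 4",
        OF primitive_on_diff[OF primitive_on_square[OF primitive_on_add[OF assms]]
          primitive_on_square[OF primitive_on_diff[OF assms]]]]])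
    (auto simp: algebra_simps power2_eq_square)

lemma primitive_on_inverse:
  assumes "primitive_on a b F f" "\<And>t. a \<le> t \<Longrightarrow> t \<le> b \<Longrightarrow> F t \<noteq> 0"
  shows "primitive_on a b (\<lambda>t. 1 / F t) (\<lambda>t. - (1 / (F t)\<^sup>2) * f t)"
  by (rule primitive_on_chain[OF assms(1), of "\<lambda>z. 1 / z" "\<lambda>z. - (1 / z\<^sup>2)"])
    (use assms(2) in \<open>auto intro!: derivative_eq_intros continuous_intros
       primitive_on_continuous[OF assms(1)] simp: power2_eq_square\<close>)

lemma primitive_on_sqrt:
  assumes "primitive_on a b F f" "\<And>t. a \<le> t \<Longrightarrow> t \<le> b \<Longrightarrow> F t > 0"
  shows "primitive_on a b (\<lambda>t. sqrt (F t)) (\<lambda>t. f t / (2 * sqrt (F t)))"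
proof (rule primitive_on_cong[OF primitive_on_chain[OF assms(1), of sqrt "\<lambda>z. inverse (sqrt z) / 2"]])
  show "(sqrt has_real_derivative inverse (sqrt (F t)) / 2) (at (F t))" if "a \<le> t" "t \<le> b" for t
    by (rule DERIV_real_sqrt) (rule assms(2)[OF that])
  have "sqrt (F t) \<noteq> 0" if "t \<in> {a..b}" for t
    using assms(2)[of t] that by auto
  then show "continuous_on {a..b} (\<lambda>t. inverse (sqrt (F t)) / 2)"
    by (intro continuous_intros primitive_on_continuous[OF assms(1)]) auto
qed (simp_all add: field_simps)

text \<open>In terms of the angle \<open>\<phi>\<close> with \<open>L = Q sin \<phi>\<close>, the bound \<open>L' = n \<le> sqrt (Q\<^sup>2 - L\<^sup>2)\<close> reads
  \<open>\<phi>' \<le> 1\<close>. As \<open>arcsin\<close> is not differentiable at \<open>\<plusminus> 1\<close>, the ends are reached by continuity.\<close>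

lemma arcsin_increase_le:
  assumes L: "primitive_on x y L n" and "x < y" and "Q > 0"
    and n: "\<And>t. x < t \<Longrightarrow> t < y \<Longrightarrow> n t > 0"
    and Q: "\<And>t. x < t \<Longrightarrow> t < y \<Longrightarrow> (L t)\<^sup>2 + (n t)\<^sup>2 \<le> Q\<^sup>2"
  shows "arcsin (L y / Q) - arcsin (L x / Q) \<le> y - x"
proof -
  have Lc: "continuous_on {x..y} L" by (rule primitive_on_continuous[OF L])
  have strict: "\<bar>L t\<bar> < Q" if "x < t" "t < y" for t
  proof -
    have "(n t)\<^sup>2 > 0" using n[OF that] by simp
    then have "(L t)\<^sup>2 < Q\<^sup>2" using Q[OF that] by linarith
    then show ?thesis using \<open>Q > 0\<close> by (metis abs_of_pos power2_abs power2_less_imp_less less_imp_le)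
  qed
  have inner: "arcsin (L v / Q) - arcsin (L u / Q) \<le> v - u" if uv: "x < u" "u < v" "v < y" for u v
  proof -
    have P: "primitive_on u v L n" using primitive_on_subset[OF L] uv by auto
    have st: "-1 < L t / Q" "L t / Q < 1" if "u \<le> t" "t \<le> v" for t
      using strict[of t] that uv \<open>Q > 0\<close> by (auto simp: field_simps abs_if split: if_splits)
    have ne: "(L t / Q)\<^sup>2 < 1" if "u \<le> t" "t \<le> v" for t
      using st[OF that] by (simp add: abs_square_less_1 abs_less_iff)
    have R: "primitive_on u v (\<lambda>t. arcsin (L t / Q))
        (\<lambda>t. inverse (sqrt (1 - (L t / Q)\<^sup>2)) * (1 / Q * n t))"
    proof (rule primitive_on_chain[of u v "\<lambda>t. L t / Q" _ arcsin "\<lambda>z. inverse (sqrt (1 - z\<^sup>2))"])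
      show "primitive_on u v (\<lambda>t. L t / Q) (\<lambda>t. 1 / Q * n t)"
        using primitive_on_cmult[OF P, of "1 / Q"] by simp
      show "(arcsin has_real_derivative inverse (sqrt (1 - (L t / Q)\<^sup>2))) (at (L t / Q))"
        if "u \<le> t" "t \<le> v" for t
        by (rule DERIV_arcsin) (use st[OF that] in auto)
      have "sqrt (1 - (L t / Q)\<^sup>2) \<noteq> 0" if "t \<in> {u..v}" for t
        using ne[of t] that by simp
      then show "continuous_on {u..v} (\<lambda>t. inverse (sqrt (1 - (L t / Q)\<^sup>2)))"
        by (intro continuous_intros continuous_on_subset[OF Lc]) (use uv \<open>Q > 0\<close> in auto)
    qed
    have "((\<lambda>t. 1 :: real) has_integral (v - u)) {u..v}"
      using has_integral_const_real[of "1::real" u v] uv by simp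
    moreover have "inverse (sqrt (1 - (L t / Q)\<^sup>2)) * (1 / Q * n t) \<le> 1" if "t \<in> {u..v}" for t
    proof -
      have t: "x < t" "t < y" "u \<le> t" "t \<le> v" using that uv by auto
      have "(n t / Q)\<^sup>2 \<le> 1 - (L t / Q)\<^sup>2"
        using Q[OF t(1,2)] \<open>Q > 0\<close> by (simp add: power_divide field_simps)
      then have "n t / Q \<le> sqrt (1 - (L t / Q)\<^sup>2)" by (rule real_le_rsqrt)
      moreover have "sqrt (1 - (L t / Q)\<^sup>2) > 0" using ne[OF t(3,4)] by simp
      ultimately have "inverse (sqrt (1 - (L t / Q)\<^sup>2)) * (n t / Q)
          \<le> inverse (sqrt (1 - (L t / Q)\<^sup>2)) * sqrt (1 - (L t / Q)\<^sup>2)"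
        by (intro mult_left_mono) auto
      also have "\<dots> = 1" using \<open>sqrt (1 - (L t / Q)\<^sup>2) > 0\<close> by (intro left_inverse) linarith
      finally show ?thesis by simp
    qed
    ultimately show ?thesis
      using has_integral_le[OF primitive_onD[OF R order_refl _ order_refl]] uv by auto
  qed
  have Lx: "\<bar>L t\<bar> \<le> Q" if "t \<in> {x..y}" for t
  proof -
    have "t \<in> closure {x<..<y}" using that \<open>x < y\<close> by (simp add: closure_greaterThanLessThan)
    moreover have "continuous_on (closure {x<..<y}) (\<lambda>t. \<bar>L t\<bar>)"
      using Lc \<open>x < y\<close> by (auto intro: continuous_intros simp: closure_greaterThanLessThan)
    ultimately show ?thesis
      using continuous_le_on_closure[of "{x<..<y}" "\<lambda>t. \<bar>L t\<bar>" t Q] strict by (force simp: less_imp_le)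
  qed
  define g where "g t = arcsin (L t / Q) - t" for t
  have gc: "continuous_on {x..y} g"
    unfolding g_def using Lx \<open>Q > 0\<close>
    by (intro continuous_intros Lc) (fastforce simp: field_simps abs_le_iff)+
  define m where "m = (x + y) / 2"
  have m: "x < m" "m < y" using \<open>x < y\<close> unfolding m_def by auto
  have "g m \<le> g x"
  proof -
    have "continuous_on (closure {x<..<m}) g"
      using m by (auto simp: closure_greaterThanLessThan intro: continuous_on_subset[OF gc])
    moreover have "x \<in> closure {x<..<m}" using m by (simp add: closure_greaterThanLessThan)
    ultimately show ?thesis
      by (rule continuous_ge_on_closure) (use inner[of _ m] m in \<open>force simp: g_def\<close>)
  qed
  moreover have "g y \<le> g m"
  proof -
    have "continuous_on (closure {m<..<y}) g"
      using m by (auto simp: closure_greaterThanLessThan intro: continuous_on_subset[OF gc])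
    moreover have "y \<in> closure {m<..<y}" using m by (simp add: closure_greaterThanLessThan)
    ultimately show ?thesis
      by (rule continuous_le_on_closure) (use inner[of m] m in \<open>force simp: g_def\<close>)
  qed
  ultimately show ?thesis unfolding g_def by simp
qed

section \<open>The flow between two zeros of the normal velocity\<close>

text \<open>This evaluates \<open>arcsin (L / Q)\<close> at the bounding rays, where \<open>L\<close> need not be continuous.\<close>

lemma arcsin_limit_pi_half:
  assumes ev: "\<forall>\<^sub>F x in F. \<bar>f x\<bar> \<le> 1 \<and> arcsin (f x) \<le> r" and lim: "(f \<longlongrightarrow> 1) F" and "F \<noteq> bot"
  shows "pi / 2 \<le> r"
proof (rule ccontr)
  assume "\<not> pi / 2 \<le> r"
  then have r: "r < pi / 2" by simp
  obtain x where "\<bar>f x\<bar> \<le> 1" "arcsin (f x) \<le> r"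
    using eventually_happens'[OF \<open>F \<noteq> bot\<close> ev] by blast
  then have r': "- (pi / 2) \<le> r" using arcsin_lbound[of "f x"] by (auto simp: abs_le_iff)
  have "\<forall>\<^sub>F x in F. f x \<le> sin r"
    using ev
  proof eventually_elim
    case (elim x)
    then have "f x = sin (arcsin (f x))" by (auto simp: abs_le_iff)
    also have "\<dots> \<le> sin r"
      using elim arcsin_lbound[of "f x"] r by (intro sin_monotone_2pi_le) (auto simp: abs_le_iff)
    finally show ?case .
  qed
  then have "1 \<le> sin r" using tendsto_upperbound[OF lim _ \<open>F \<noteq> bot\<close>] by blast
  moreover have "sin r < sin (pi / 2)" using r r' by (intro sin_monotone_2pi) auto
  ultimately show False by simp
qed

text \<open>Consider the deflection \<open>\<delta>\<close> by a shock whose normal velocity falls from \<open>B + V\<close> to \<open>B - V\<close> at the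
  tangential velocity \<open>l\<close>: its sine \<open>2 l V / (q\<^sub>- q\<^sub>+)\<close> is largest for \<open>l\<^sup>2 + V\<^sup>2 = B\<^sup>2\<close>,
  where it equals \<open>V / B\<close>. The hypothesis \<open>g * V \<le> B\<close> says that the pressure before the
  shock is not negative.\<close>

lemma shock_deflection_le:
  fixes l B V g :: real
  assumes "0 \<le> l" "0 < V" "V < B" "1 < g" "g * V \<le> B"
    and Q1: "Q1 = sqrt (l\<^sup>2 + (B + V)\<^sup>2)" and Q2: "Q2 = sqrt (l\<^sup>2 + (B - V)\<^sup>2)"
  shows "arcsin (l / Q2) - arcsin (l / Q1) \<le> arcsin (1 / g)"
proof -
  have pos: "l\<^sup>2 + (B + V)\<^sup>2 > 0" "l\<^sup>2 + (B - V)\<^sup>2 > 0"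
    using assms by (auto intro!: add_nonneg_pos)
  then have Qpos: "Q1 > 0" "Q2 > 0" unfolding Q1 Q2 by auto
  have Qsq: "Q1\<^sup>2 = l\<^sup>2 + (B + V)\<^sup>2" "Q2\<^sup>2 = l\<^sup>2 + (B - V)\<^sup>2"
    unfolding Q1 Q2 using pos by auto
  have le: "l \<le> Q1" "l \<le> Q2"
    by (auto intro!: power2_le_imp_le[of l] simp: Qsq less_imp_le Qpos)
  have rng: "0 \<le> l / Q1" "l / Q1 \<le> 1" "0 \<le> l / Q2" "l / Q2 \<le> 1"
    using le Qpos assms(1) by auto
  define \<alpha> \<beta> where "\<alpha> = arcsin (l / Q1)" and "\<beta> = arcsin (l / Q2)"
  have ang: "0 \<le> \<alpha>" "\<alpha> \<le> pi / 2" "0 \<le> \<beta>" "\<beta> \<le> pi / 2"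
    unfolding \<alpha>_def \<beta>_def using rng arcsin_le_arcsin[of 0 "l / Q1"] arcsin_le_arcsin[of 0 "l / Q2"]
    using arcsin_ubound[of "l / Q1"] arcsin_ubound[of "l / Q2"] by auto
  have sn: "sin \<alpha> = l / Q1" "sin \<beta> = l / Q2" unfolding \<alpha>_def \<beta>_def using rng by auto
  have "cos \<alpha> = sqrt (1 - (l / Q1)\<^sup>2)" "cos \<beta> = sqrt (1 - (l / Q2)\<^sup>2)"
    unfolding \<alpha>_def \<beta>_def using rng by (auto intro!: cos_arcsin)
  moreover have complement: "1 - p / (p + q) = q / (p + q)" if "p + q > 0" for p q :: real
    using that by (simp add: field_simps)
  have "1 - (l / Q1)\<^sup>2 = ((B + V) / Q1)\<^sup>2" "1 - (l / Q2)\<^sup>2 = ((B - V) / Q2)\<^sup>2"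
    unfolding power_divide Qsq using complement[OF pos(1)] complement[OF pos(2)] by blast+
  ultimately have cs: "cos \<alpha> = (B + V) / Q1" "cos \<beta> = (B - V) / Q2"
    using assms Qpos by auto
  have "sin (\<beta> - \<alpha>) = 2 * l * V / (Q1 * Q2)"
    using Qpos by (simp add: sin_diff sn cs field_simps)
  also have "\<dots> \<le> V / B"
  proof -
    have "(2 * l * B)\<^sup>2 \<le> (Q1 * Q2)\<^sup>2"
    proof -
      have "(Q1 * Q2)\<^sup>2 - (2 * l * B)\<^sup>2 = (l\<^sup>2 + V\<^sup>2 - B\<^sup>2)\<^sup>2"
        unfolding power_mult_distrib Qsq by (simp add: power2_eq_square algebra_simps)
      then show ?thesis using zero_le_power2[of "l\<^sup>2 + V\<^sup>2 - B\<^sup>2"] by linarith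
    qed
    then have "2 * l * B \<le> Q1 * Q2" by (rule power2_le_imp_le) (use Qpos in simp)
    then have "2 * l * V * B \<le> V * (Q1 * Q2)" using \<open>0 < V\<close> by simp
    then show ?thesis using Qpos assms by (simp add: field_simps)
  qed
  also have "\<dots> \<le> 1 / g" using assms by (simp add: field_simps)
  finally have *: "sin (\<beta> - \<alpha>) \<le> 1 / g" .
  have "\<beta> - \<alpha> = arcsin (sin (\<beta> - \<alpha>))" using ang by (intro arcsin_sin[symmetric]) auto
  also have "\<dots> \<le> arcsin (1 / g)"
    by (rule arcsin_le_arcsin) (use * assms in \<open>auto intro: sin_ge_minus_one\<close>)
  finally show ?thesis unfolding \<alpha>_def \<beta>_def .
qed

text \<open>\<open>L\<close> is the radial velocity, \<open>n > 0\<close> the speed normal to the ray, \<open>M\<close> the mass flux through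
  the ray, \<open>P\<close> the flux of normal momentum and \<open>H\<close> the total enthalpy; the angle is measured in
  the direction in which the fluid crosses the rays. For given \<open>L\<close>, \<open>M\<close>, \<open>P\<close>
  Bernoulli's law is a quadratic equation for \<open>n\<close>. Its roots lie symmetrically about \<open>B\<close>; the
  larger one is supersonic, the smaller one subsonic. The flow may jump from the larger root to
  the smaller one, but the second law of thermodynamics forbids the opposite jump.\<close>

locale fluid_sector =
  fixes \<gamma> H a b :: real and L n M P B :: "real \<Rightarrow> real"
  defines "B \<equiv> \<lambda>t. \<gamma> / (\<gamma> + 1) * (P t / M t)"
  assumes \<gamma>: "\<gamma> > 1" and ab: "a < b"
    and n_pos: "\<And>t. a < t \<Longrightarrow> t < b \<Longrightarrow> n t > 0"
    and M_pos: "\<And>t. a < t \<Longrightarrow> t < b \<Longrightarrow> M t > 0"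
    and L_prim: "\<And>x y. a < x \<Longrightarrow> y < b \<Longrightarrow> primitive_on x y L n"
    and M_prim: "\<And>x y. a < x \<Longrightarrow> y < b \<Longrightarrow> primitive_on x y M (\<lambda>t. - (M t * L t / n t))"
    and P_prim: "\<And>x y. a < x \<Longrightarrow> y < b \<Longrightarrow> primitive_on x y P (\<lambda>t. - (2 * M t * L t))"
    and bernoulli: "\<And>t. a < t \<Longrightarrow> t < b \<Longrightarrow>
      (n t)\<^sup>2 - 2 * B t * n t + (\<gamma> - 1) / (\<gamma> + 1) * (2 * H - (L t)\<^sup>2) = 0"
    and pressure_pos: "\<And>t. a < t \<Longrightarrow> t < b \<Longrightarrow> M t * n t < P t"
    and entropy_jump: "\<And>t. a < t \<Longrightarrow> t < b \<Longrightarrow> n t \<noteq> B t \<Longrightarrow>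
      \<exists>\<epsilon>>0. \<forall>x y. a < x \<longrightarrow> t - \<epsilon> < x \<longrightarrow> x < y \<longrightarrow> y < t + \<epsilon> \<longrightarrow> y < b \<longrightarrow> n x < B x \<longrightarrow> n y \<le> B y"
    and n_at_a: "(n \<longlongrightarrow> 0) (at_right a)" and sub_at_a: "\<forall>\<^sub>F t in at_right a. n t < B t"
    and n_at_b: "(n \<longlongrightarrow> 0) (at_left b)" and sub_at_b: "\<forall>\<^sub>F t in at_left b. n t < B t"
begin

text \<open>\<open>D\<close> is a quarter of the discriminant of the quadratic equation, so that \<open>D = W\<^sup>2\<close>. Unlike \<open>n\<close> and
  \<open>W\<close> it is continuous, and so is \<open>G\<close>, which is the squared speed where \<open>W = 0\<close>.\<close>

definition k :: real where "k = (\<gamma> - 1) / (\<gamma> + 1)"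
definition W :: "real \<Rightarrow> real" where "W t = n t - B t"
definition D :: "real \<Rightarrow> real" where "D t = (B t)\<^sup>2 - k * (2 * H - (L t)\<^sup>2)"
definition G :: "real \<Rightarrow> real" where "G t = (L t)\<^sup>2 + (B t)\<^sup>2"

text \<open>The squared speed, and its continuous extensions from the supersonic and from the subsonic branch.\<close>

definition q2 :: "real \<Rightarrow> real" where "q2 t = (L t)\<^sup>2 + (n t)\<^sup>2"
definition qp :: "real \<Rightarrow> real" where "qp t = (L t)\<^sup>2 + (B t + sqrt (D t))\<^sup>2"
definition qm :: "real \<Rightarrow> real" where "qm t = (L t)\<^sup>2 + (B t - sqrt (D t))\<^sup>2"

lemma k_bounds: "0 < k" "k < 1" and k_\<gamma>: "1 + k = 2 * \<gamma> / (\<gamma> + 1)"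
  unfolding k_def using \<gamma> by (auto simp: field_simps)

lemma D_eq: "a < t \<Longrightarrow> t < b \<Longrightarrow> D t = (W t)\<^sup>2"
  using bernoulli[of t] unfolding D_def W_def k_def by (simp add: power2_eq_square algebra_simps)

lemma sqrt_D: "a < t \<Longrightarrow> t < b \<Longrightarrow> sqrt (D t) = \<bar>W t\<bar>"
  by (simp add: D_eq)

lemma n_lt: assumes "a < t" "t < b" shows "\<gamma> * n t < (\<gamma> + 1) * B t"
proof -
  have "n t < P t / M t" using pressure_pos[OF assms] M_pos[OF assms] by (simp add: field_simps)
  then have "\<gamma> * n t < \<gamma> * (P t / M t)" using \<gamma> by (intro mult_strict_left_mono) auto
  also have "\<dots> = (\<gamma> + 1) * B t"
  proof -
    have "(\<gamma> + 1) * (\<gamma> / (\<gamma> + 1) * z) = \<gamma> * z" for z using \<gamma> by simp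
    then show ?thesis unfolding B_def by (rule sym)
  qed
  finally show ?thesis .
qed

lemma B_pos: assumes "a < t" "t < b" shows "B t > 0"
proof -
  have "0 < \<gamma> * n t" using n_pos[OF assms] \<gamma> by simp
  then have "0 < (\<gamma> + 1) * B t" using n_lt[OF assms] by linarith
  then show ?thesis using \<gamma> by (simp add: zero_less_mult_iff)
qed

text \<open>This fixes the sign of the derivative of \<open>D\<close>.\<close>

lemma kn_lt: assumes "a < t" "t < b" shows "k * n t < B t"
proof -
  have "k * n t * (\<gamma> * (\<gamma> + 1)) = (\<gamma> - 1) * (\<gamma> * n t)" unfolding k_def using \<gamma> by (simp add: field_simps)
  also have "\<dots> < (\<gamma> - 1) * ((\<gamma> + 1) * B t)" using n_lt[OF assms] \<gamma> by simp
  also have "\<dots> \<le> \<gamma> * ((\<gamma> + 1) * B t)" using B_pos[OF assms] \<gamma> by (intro mult_right_mono) auto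
  finally have "(k * n t) * (\<gamma> * (\<gamma> + 1)) < B t * (\<gamma> * (\<gamma> + 1))" by (simp add: algebra_simps)
  then show ?thesis using \<gamma> by simp
qed

lemma W_lt: assumes "a < t" "t < b" shows "\<gamma> * W t < B t"
  using n_lt[OF assms] unfolding W_def by (simp add: algebra_simps)

lemma B_prim:
  assumes "a < x" "y < b"
  shows "primitive_on x y B (\<lambda>t. - (1 + k) * L t + B t * L t / n t)"
proof (rule primitive_on_cong[OF primitive_on_cmult[OF primitive_on_mult[OF P_prim[OF assms]
        primitive_on_inverse[OF M_prim[OF assms]]]]])
  show "M t \<noteq> 0" if "x \<le> t" "t \<le> y" for t using M_pos[of t] that assms by force
next
  show "\<gamma> / (\<gamma> + 1) * (P t * (1 / M t)) = B t" for t unfolding B_def by simp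
next
  fix t assume "x \<le> t" "t \<le> y"
  then have Mn: "M t > 0" "n t > 0" using M_pos[of t] n_pos[of t] assms by auto
  have ratio_identity: "c * (P t * (- (1 / (M t)\<^sup>2) * - (M t * L t / n t)) + - (2 * M t * L t) * (1 / M t))
      = - (2 * c) * L t + c * (P t / M t) * L t / n t" for c
    using Mn by (simp add: field_simps power2_eq_square)
  show "\<gamma> / (\<gamma> + 1) * (P t * (- (1 / (M t)\<^sup>2) * - (M t * L t / n t)) + - (2 * M t * L t) * (1 / M t))
      = - (1 + k) * L t + B t * L t / n t"
    unfolding k_\<gamma> B_def times_divide_eq_right[symmetric, of 2]
    by (rule ratio_identity)
qed

lemma D_prim:
  assumes "a < x" "y < b"
  shows "primitive_on x y D (\<lambda>t. - (2 * L t * W t * (B t - k * n t) / n t))"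
proof (rule primitive_on_cong[OF primitive_on_add_const[where c = "- 2 * k * H",
        OF primitive_on_add[OF primitive_on_square[OF B_prim[OF assms]]
          primitive_on_cmult[OF primitive_on_square[OF L_prim[OF assms]], of k]]]])
  show "(B t)\<^sup>2 + k * (L t)\<^sup>2 + - 2 * k * H = D t" for t
    unfolding D_def by (simp add: algebra_simps)
  fix t assume "x \<le> t" "t \<le> y"
  then have "n t > 0" using n_pos[of t] assms by auto
  then show "2 * B t * (- (1 + k) * L t + B t * L t / n t) + k * (2 * L t * n t)
      = - (2 * L t * W t * (B t - k * n t) / n t)"
    unfolding W_def by (simp add: field_simps power2_eq_square)
qed

lemma G_prim:
  assumes "a < x" "y < b"
  shows "primitive_on x y G (\<lambda>t. 2 * L t * ((1 - k) * B t * n t + (W t)\<^sup>2) / n t)"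
proof (rule primitive_on_cong[OF primitive_on_add[OF primitive_on_square[OF L_prim[OF assms]]
        primitive_on_square[OF B_prim[OF assms]]]])
  show "(L t)\<^sup>2 + (B t)\<^sup>2 = G t" for t unfolding G_def by simp
  fix t assume "x \<le> t" "t \<le> y"
  then have "n t > 0" using n_pos[of t] assms by auto
  then show "2 * L t * n t + 2 * B t * (- (1 + k) * L t + B t * L t / n t)
      = 2 * L t * ((1 - k) * B t * n t + (W t)\<^sup>2) / n t"
    unfolding W_def by (simp add: field_simps power2_eq_square)
qed

lemma L_mono: assumes "a < x" "x \<le> y" "y < b" shows "L x \<le> L y"
  by (rule primitive_on_mono[OF L_prim[OF assms(1,3)]]) (use assms n_pos in \<open>auto intro: less_imp_le\<close>)

lemma G_mono: assumes "a < x" "x \<le> y" "y < b" "0 \<le> L x" shows "G x \<le> G y"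
proof (rule primitive_on_mono[OF G_prim[OF assms(1,3)]])
  fix t assume t: "x \<le> t" "t \<le> y"
  then show "0 \<le> 2 * L t * ((1 - k) * B t * n t + (W t)\<^sup>2) / n t"
    using L_mono[of x t] assms n_pos[of t] B_pos[of t] k_bounds by simp
qed (use assms in auto)

lemma G_antimono: assumes "a < x" "x \<le> y" "y < b" "L y \<le> 0" shows "G y \<le> G x"
proof (rule primitive_on_antimono[OF G_prim[OF assms(1,3)]])
  fix t assume t: "x \<le> t" "t \<le> y"
  then show "2 * L t * ((1 - k) * B t * n t + (W t)\<^sup>2) / n t \<le> 0"
    using L_mono[of t y] assms n_pos[of t] B_pos[of t] k_bounds
    by (simp add: divide_nonpos_pos mult_nonpos_nonneg)
qed (use assms in auto)

lemma continuous:
  assumes "a < x" "y < b"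
  shows "continuous_on {x..y} L" "continuous_on {x..y} B" "continuous_on {x..y} D"
    "continuous_on {x..y} qp" "continuous_on {x..y} qm"
proof -
  show *: "continuous_on {x..y} L" "continuous_on {x..y} B" "continuous_on {x..y} D"
    by (intro primitive_on_continuous[OF L_prim] primitive_on_continuous[OF B_prim]
        primitive_on_continuous[OF D_prim] assms)+
  show "continuous_on {x..y} qp" "continuous_on {x..y} qm"
    unfolding qp_def[abs_def] qm_def[abs_def] by (intro continuous_intros *)+
qed

lemma q2_bounds: assumes "a < t" "t < b" shows "qm t \<le> q2 t" "q2 t \<le> qp t"
proof -
  have n: "n t = B t + W t" unfolding W_def by simp
  show "q2 t \<le> qp t"
    unfolding q2_def qp_def sqrt_D[OF assms] using n n_pos[OF assms]
    by (intro add_left_mono power_mono) auto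
  have "\<bar>B t - \<bar>W t\<bar>\<bar> \<le> \<bar>n t\<bar>" using n n_pos[OF assms] B_pos[OF assms] by linarith
  then show "qm t \<le> q2 t"
    unfolding q2_def qm_def sqrt_D[OF assms] by (simp add: abs_le_square_iff)
qed

lemma q2_branch:
  assumes "a < t" "t < b"
  shows "W t \<ge> 0 \<Longrightarrow> q2 t = qp t" "W t \<le> 0 \<Longrightarrow> q2 t = qm t" "W t = 0 \<Longrightarrow> q2 t = G t"
    "W t = 0 \<Longrightarrow> qp t = G t" "W t = 0 \<Longrightarrow> qm t = G t"
  unfolding q2_def qp_def qm_def G_def sqrt_D[OF assms] by (auto simp: W_def)

text \<open>Away from \<open>W = 0\<close> the equations say that the velocity is constant.\<close>

lemma n_prim:
  assumes "a < x" "y < b" and W: "(\<forall>t\<in>{x..y}. W t > 0) \<or> (\<forall>t\<in>{x..y}. W t < 0)"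
  shows "primitive_on x y n (\<lambda>t. - L t)"
proof -
  obtain \<sigma> :: real where \<sigma>: "\<sigma> = 1 \<or> \<sigma> = -1" "\<And>t. x \<le> t \<Longrightarrow> t \<le> y \<Longrightarrow> \<bar>W t\<bar> = \<sigma> * W t \<and> W t \<noteq> 0"
  proof (cases "\<forall>t\<in>{x..y}. W t > 0")
    case True then show thesis by (intro that[of 1]) force+
  next
    case False then show thesis using W by (intro that[of "-1"]) force+
  qed
  show ?thesis
  proof (rule primitive_on_cong[OF primitive_on_add[OF B_prim[OF assms(1,2)]
          primitive_on_cmult[OF primitive_on_sqrt[OF D_prim[OF assms(1,2)]], of \<sigma>]]])
    fix t assume t: "x \<le> t" "t \<le> y"
    then have t': "a < t" "t < b" using assms by auto
    show "D t > 0" using \<sigma>(2)[OF t] by (simp add: D_eq[OF t'])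
    show "B t + \<sigma> * sqrt (D t) = n t"
      using \<sigma>(1) \<sigma>(2)[OF t] unfolding sqrt_D[OF t'] W_def by auto
    show "- (1 + k) * L t + B t * L t / n t +
        \<sigma> * (- (2 * L t * W t * (B t - k * n t) / n t) / (2 * sqrt (D t))) = - L t"
      using \<sigma>(1) \<sigma>(2)[OF t] n_pos[OF t'] unfolding sqrt_D[OF t'] by (auto simp: field_simps)
  qed
qed

lemma q2_const:
  assumes "a < x" "x \<le> y" "y < b" and W: "(\<forall>t\<in>{x..y}. W t > 0) \<or> (\<forall>t\<in>{x..y}. W t < 0)"
  shows "q2 x = q2 y"
proof -
  have "primitive_on x y q2 (\<lambda>t. 0)"
    by (rule primitive_on_cong[OF primitive_on_add[OF primitive_on_square[OF L_prim]
            primitive_on_square[OF n_prim]]]) (use assms in \<open>auto simp: q2_def\<close>)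
  then show ?thesis by (rule primitive_on_zero) (use assms in auto)
qed

text \<open>The entropy condition is local; connectedness of intervals makes it global on intervals
  without zeros of \<open>W\<close>.\<close>

lemma subsonic_persists:
  assumes "a < x" "x \<le> y" "y < b" and nz: "\<And>t. x \<le> t \<Longrightarrow> t \<le> y \<Longrightarrow> W t \<noteq> 0" and "W x < 0"
  shows "W y < 0"
proof -
  have "x \<le> x \<longrightarrow> x \<le> y \<longrightarrow> y \<le> y \<longrightarrow> W x < 0 \<longrightarrow> W y < 0"
    using assms(2)
  proof (induction rule: Bolzano[where P = "\<lambda>u v. x \<le> u \<longrightarrow> u \<le> v \<longrightarrow> v \<le> y \<longrightarrow> W u < 0 \<longrightarrow> W v < 0"])
    case (trans u v w)
    then show ?case by (meson order_trans)
  next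
    case (local z)
    then have z: "a < z" "z < b" "n z \<noteq> B z" using assms nz[of z] unfolding W_def by auto
    obtain \<epsilon> where \<epsilon>: "\<epsilon> > 0" "\<And>u v. a < u \<Longrightarrow> z - \<epsilon> < u \<Longrightarrow> u < v \<Longrightarrow> v < z + \<epsilon> \<Longrightarrow> v < b \<Longrightarrow> n u < B u \<Longrightarrow> n v \<le> B v"
      using entropy_jump[OF z] by blast
    have "W v < 0" if uv: "u \<le> z" "z \<le> v" "v - u < \<epsilon>" "x \<le> u" "v \<le> y" "W u < 0" for u v
    proof (cases "u = v")
      case True then show ?thesis using that by simp
    next
      case False
      then have "W v \<le> 0" using \<epsilon>(2)[of u v] uv assms unfolding W_def by force
      then show ?thesis using nz[of v] uv by force
    qed
    then show ?case using \<epsilon>(1) by (intro exI[of _ \<epsilon>]) auto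
  qed
  then show ?thesis using assms by simp
qed

text \<open>By the previous lemma the supersonic part precedes the subsonic one; their common end \<open>s\<close> is the
  shock. The last conclusion, that the pressure before the shock is not negative, is obtained from the
  left, since \<open>n\<close> may already have its subsonic value at \<open>s\<close>.\<close>

lemma single_shock:
  assumes "a < x" "x < y" "y < b" and nz: "\<And>t. x \<le> t \<Longrightarrow> t \<le> y \<Longrightarrow> W t \<noteq> 0" and "W x > 0" "W y < 0"
  obtains s where "x \<le> s" "s \<le> y"
    "\<And>t. x \<le> t \<Longrightarrow> t < s \<Longrightarrow> q2 t = qp s" "q2 x = qp s"
    "\<And>t. s < t \<Longrightarrow> t \<le> y \<Longrightarrow> q2 t = qm s" "q2 y = qm s"
    "\<gamma> * sqrt (D s) \<le> B s"
proof -
  define S where "S = {t \<in> {x..y}. W t > 0}"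
  define s where "s = Sup S"
  have S: "x \<in> S" "bdd_above S" "S \<subseteq> {x..y}" using assms unfolding S_def by auto
  have s: "x \<le> s" "s \<le> y"
    unfolding s_def using S by (force intro: cSup_upper intro!: cSup_least)+
  have before: "W t > 0" if "x \<le> t" "t < s" for t
  proof (rule ccontr)
    assume "\<not> W t > 0"
    then have "W t < 0" using nz[of t] that s by force
    obtain r where "r \<in> S" "t < r" using \<open>t < s\<close> S less_cSupE[of t S] unfolding s_def by blast
    then show False using subsonic_persists[of t r] \<open>W t < 0\<close> nz that assms unfolding S_def by fastforce
  qed
  have after: "W t < 0" if "s < t" "t \<le> y" for t
  proof -
    have "t \<notin> S" using that cSup_upper[OF _ S(2), of t] unfolding s_def by force
    then show ?thesis using nz[of t] that s unfolding S_def by force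
  qed
  have cq: "continuous_on {u..v} qp" "continuous_on {u..v} qm" if "x \<le> u" "v \<le> y" for u v
    using continuous(4,5)[of u v] that assms by auto
  have P: "q2 t = qp s" if t: "x \<le> t" "t < s" for t
  proof -
    have "continuous_on (closure {t<..<s}) qp" "s \<in> closure {t<..<s}"
      using cq[of t s] t s by (auto simp: closure_greaterThanLessThan)
    moreover have "qp r = q2 t" if "r \<in> {t<..<s}" for r
    proof -
      have "q2 t = q2 r" by (rule q2_const) (use that t s assms before in auto)
      also have "\<dots> = qp r" by (rule q2_branch) (use that t s assms before[of r] in auto)
      finally show ?thesis by simp
    qed
    ultimately show ?thesis using continuous_constant_on_closure[of "{t<..<s}" qp "q2 t" s] by simp
  qed
  have M: "q2 t = qm s" if t: "s < t" "t \<le> y" for t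
  proof -
    have "continuous_on (closure {s<..<t}) qm" "s \<in> closure {s<..<t}"
      using cq[of s t] t s by (auto simp: closure_greaterThanLessThan)
    moreover have "qm r = q2 t" if "r \<in> {s<..<t}" for r
    proof -
      have "q2 r = q2 t" by (rule q2_const) (use that t s assms after in auto)
      moreover have "q2 r = qm r" by (rule q2_branch) (use that t s assms after[of r] in auto)
      ultimately show ?thesis by simp
    qed
    ultimately show ?thesis using continuous_constant_on_closure[of "{s<..<t}" qm "q2 t" s] by simp
  qed
  have "q2 x = qp s"
    using P[of x] q2_branch(1)[of x] s assms by (cases "x = s") auto
  moreover have "q2 y = qm s"
    using M[of y] q2_branch(2)[of y] s assms by (cases "y = s") auto
  moreover have "\<gamma> * sqrt (D s) - B s \<le> 0"
  proof (cases "x = s")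
    case True
    then show ?thesis using sqrt_D[of s] W_lt[of s] assms by auto
  next
    case False
    show ?thesis
    proof (rule continuous_le_on_closure[where f = "(\<lambda>t. \<gamma> * sqrt (D t) - B t)" and x = s])
      show "continuous_on (closure {x<..<s}) (\<lambda>t. \<gamma> * sqrt (D t) - B t)" "s \<in> closure {x<..<s}"
        using continuous(2,3)[of x s] False s assms
        by (auto simp: closure_greaterThanLessThan intro!: continuous_intros)
      show "\<gamma> * sqrt (D t) - B t \<le> 0" if "t \<in> {x<..<s}" for t
        using before[of t] sqrt_D[of t] W_lt[of t] that s assms by auto
    qed
  qed
  ultimately show thesis using that[OF s P _ M] by simp
qed

lemma qm_le_qp: assumes "a < t" "t < b" shows "qm t \<le> qp t"
  using q2_bounds[OF assms] by simp

lemma q2_antimono_nonzero: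
  assumes "a < x" "x \<le> y" "y < b" and nz: "\<And>t. x \<le> t \<Longrightarrow> t \<le> y \<Longrightarrow> W t \<noteq> 0"
  shows "q2 y \<le> q2 x"
proof -
  consider "W x < 0" | "W x > 0" "W y < 0" | "W x > 0" "W y > 0"
    using nz[of x] nz[of y] assms by force
  then show ?thesis
  proof cases
    case 1
    then have "\<forall>t\<in>{x..y}. W t < 0" using subsonic_persists[of x] assms by auto
    then show ?thesis using q2_const[OF assms(1-3)] by simp
  next
    case 2
    then have "x < y" using assms(2) by (cases "x = y") auto
    then obtain s where "x \<le> s" "s \<le> y" "q2 x = qp s" "q2 y = qm s"
      using single_shock[of x y] 2 assms by metis
    then show ?thesis using qm_le_qp[of s] assms by simp
  next
    case 3
    have "W t > 0" if "t \<in> {x..y}" for t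
      using subsonic_persists[of t y] nz[of t] nz that 3 assms by force
    then show ?thesis using q2_const[OF assms(1-3)] by simp
  qed
qed

text \<open>The zeros of \<open>W\<close> form a closed set, being the zeros of \<open>D\<close>.\<close>

lemma zeros_Sup_Inf:
  assumes "a < x" "y < b" "x \<le> z" "z \<le> y" "W z = 0"
  obtains i s where "x \<le> i" "i \<le> s" "s \<le> y" "W i = 0" "W s = 0"
    "\<And>t. x \<le> t \<Longrightarrow> t < i \<Longrightarrow> W t \<noteq> 0" "\<And>t. s < t \<Longrightarrow> t \<le> y \<Longrightarrow> W t \<noteq> 0"
proof -
  define Z where "Z = {t \<in> {x..y}. D t = 0}"
  have Z: "t \<in> Z \<longleftrightarrow> x \<le> t \<and> t \<le> y \<and> W t = 0" for t
    unfolding Z_def using D_eq[of t] assms by auto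
  have "compact Z"
  proof -
    have "closed Z" unfolding Z_def
      by (intro continuous_closed_preimage_constant continuous(3)) (use assms in auto)
    then show ?thesis unfolding compact_eq_bounded_closed
      using bounded_subset[OF bounded_closed_interval, of Z x y] Z_def by blast
  qed
  moreover have "Z \<noteq> {}" using Z assms by blast
  ultimately obtain i s where i: "i \<in> Z" "\<forall>t\<in>Z. i \<le> t" and s: "s \<in> Z" "\<forall>t\<in>Z. t \<le> s"
    using compact_attains_inf[of Z] compact_attains_sup[of Z] by blast
  show thesis
  proof (rule that[of i s])
    show "x \<le> i" "W i = 0" "s \<le> y" "W s = 0" "i \<le> s" using i s Z by auto
    show "W t \<noteq> 0" if "x \<le> t" "t < i" for t using i(2) Z that \<open>s \<le> y\<close> \<open>i \<le> s\<close> by force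
    show "W t \<noteq> 0" if "s < t" "t \<le> y" for t using s(2) Z that \<open>x \<le> i\<close> \<open>i \<le> s\<close> by force
  qed
qed

text \<open>While the fluid approaches the origin, shocks and compression waves slow it down. Zeros of \<open>W\<close> and
  shocks could alternate infinitely often, but at the zeros the squared speed is \<open>G\<close>, which decreases on the whole
  interval; so only the first and the last zero matter.\<close>

lemma q2_antimono_incoming:
  assumes "a < x" "x \<le> y" "y < b" and "L y \<le> 0"
  shows "q2 y \<le> q2 x"
proof (cases "\<exists>z. x \<le> z \<and> z \<le> y \<and> W z = 0")
  case False
  then show ?thesis using q2_antimono_nonzero assms by blast
next
  case True
  then obtain z where z: "x \<le> z" "z \<le> y" "W z = 0" by blast
  obtain i s where zs: "x \<le> i" "i \<le> s" "s \<le> y" "W i = 0" "W s = 0"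
    "\<And>t. x \<le> t \<Longrightarrow> t < i \<Longrightarrow> W t \<noteq> 0" "\<And>t. s < t \<Longrightarrow> t \<le> y \<Longrightarrow> W t \<noteq> 0"
    using zeros_Sup_Inf[OF assms(1,3) z] by blast
  have "q2 y \<le> G s"
  proof (cases "s = y")
    case True then show ?thesis using q2_branch(3)[of s] zs assms by simp
  next
    case False
    have "q2 y \<le> qp s"
    proof (rule continuous_ge_on_closure[where f = "qp" and x = s])
      show "continuous_on (closure {s<..<y}) qp" "s \<in> closure {s<..<y}"
        using continuous(4)[of s y] False zs assms by (auto simp: closure_greaterThanLessThan)
      show "q2 y \<le> qp u" if "u \<in> {s<..<y}" for u
        using q2_antimono_nonzero[of u y] q2_bounds(2)[of u] that zs assms by force
    qed
    then show ?thesis using q2_branch(4)[of s] zs assms by simp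
  qed
  also have "G s \<le> G i"
    using zs assms L_mono[of s y] by (intro G_antimono) auto
  also have "G i \<le> q2 x"
  proof (cases "i = x")
    case True then show ?thesis using q2_branch(3)[of i] zs assms by simp
  next
    case False
    have "qm i \<le> q2 x"
    proof (rule continuous_le_on_closure[where f = "qm" and x = i])
      show "continuous_on (closure {x<..<i}) qm" "i \<in> closure {x<..<i}"
        using continuous(5)[of x i] False zs assms by (auto simp: closure_greaterThanLessThan)
      show "qm u \<le> q2 x" if "u \<in> {x<..<i}" for u
        using q2_antimono_nonzero[of x u] q2_bounds(1)[of u] that zs assms by force
    qed
    then show ?thesis using q2_branch(5)[of i] zs assms by simp
  qed
  finally show ?thesis .
qed

text \<open>While the fluid moves away from the origin \<open>W\<close> decreases, as
  \<open>D = W\<^sup>2\<close> has the derivative \<open>- 2 * L * W * (B - k * n) / n\<close>: the flow is first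
  supersonic, then sonic, then subsonic.\<close>

lemma outgoing_subsonic_persists:
  assumes "a < x" "x \<le> y" "y < b" "0 \<le> L x" "W x < 0"
  shows "W y < 0"
proof (rule ccontr)
  assume "\<not> W y < 0"
  then have "\<exists>z. x \<le> z \<and> z \<le> y \<and> W z = 0"
    using subsonic_persists[OF assms(1-3) _ assms(5)] by auto
  then obtain z where z: "x \<le> z" "z \<le> y" "W z = 0" by blast
  obtain i s where zs: "x \<le> i" "i \<le> s" "s \<le> y" "W i = 0" "W s = 0"
    "\<And>t. x \<le> t \<Longrightarrow> t < i \<Longrightarrow> W t \<noteq> 0" "\<And>t. s < t \<Longrightarrow> t \<le> y \<Longrightarrow> W t \<noteq> 0"
    using zeros_Sup_Inf[OF assms(1,3) z] by blast
  note i = zs(1,4,6)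
  have "i \<le> y" using zs(2,3) by (rule order_trans)
  have "D x \<le> D i"
  proof (rule primitive_on_mono[OF D_prim[of x i]])
    fix t assume t: "x \<le> t" "t \<le> i"
    have "W t \<le> 0"
    proof (cases "t = i")
      case False
      have "W t < 0"
      proof (rule subsonic_persists[OF assms(1) t(1) _ _ assms(5)])
        show "t < b" using t \<open>i \<le> y\<close> assms(3) by simp
        show "W r \<noteq> 0" if "x \<le> r" "r \<le> t" for r by (rule i(3)) (use that t False in simp_all)
      qed
      then show ?thesis by simp
    qed (use i in simp)
    moreover have "0 \<le> L t" "n t > 0" "0 \<le> B t - k * n t"
      using L_mono[of x t] kn_lt[of t] n_pos[of t] t \<open>i \<le> y\<close> assms by simp_all
    ultimately have "2 * L t * W t * (B t - k * n t) / n t \<le> 0"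
      by (intro divide_nonpos_pos mult_nonpos_nonneg mult_nonneg_nonpos) simp_all
    then show "0 \<le> - (2 * L t * W t * (B t - k * n t) / n t)" by simp
  qed (use i \<open>i \<le> y\<close> assms in auto)
  moreover have "D i = 0" using D_eq[of i] i(1,2) \<open>i \<le> y\<close> assms(1,3) by simp
  moreover have "D x > 0" using D_eq[of x] assms by simp
  ultimately show False by simp
qed

lemma outgoing_supersonic_before:
  assumes "a < x" "x \<le> y" "y < b" "0 \<le> L x" "W y > 0"
  shows "W x > 0"
proof (rule ccontr)
  assume "\<not> W x > 0"
  moreover have "\<not> W x < 0" using outgoing_subsonic_persists[of x y] assms by auto
  ultimately have "W x = 0" by simp
  obtain i s where zs: "x \<le> i" "i \<le> s" "s \<le> y" "W i = 0" "W s = 0"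
    "\<And>t. x \<le> t \<Longrightarrow> t < i \<Longrightarrow> W t \<noteq> 0" "\<And>t. s < t \<Longrightarrow> t \<le> y \<Longrightarrow> W t \<noteq> 0"
    using zeros_Sup_Inf[OF assms(1,3) order_refl assms(2) \<open>W x = 0\<close>] by blast
  note s = zs(3,5,7)
  have "x \<le> s" using zs(1,2) by (rule order_trans)
  have "D y \<le> D s"
  proof (rule primitive_on_antimono[OF D_prim[of s y]])
    fix t assume t: "s \<le> t" "t \<le> y"
    have "0 \<le> L t" using L_mono[of x t] s \<open>x \<le> s\<close> t assms by simp
    have "W t \<ge> 0"
      using outgoing_subsonic_persists[of t y] \<open>0 \<le> L t\<close> s \<open>x \<le> s\<close> t assms by fastforce
    moreover have "n t > 0" "0 \<le> B t - k * n t"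
      using kn_lt[of t] n_pos[of t] t \<open>x \<le> s\<close> assms by simp_all
    ultimately have "0 \<le> 2 * L t * W t * (B t - k * n t) / n t"
      using \<open>0 \<le> L t\<close> by (intro divide_nonneg_pos mult_nonneg_nonneg) simp_all
    then show "- (2 * L t * W t * (B t - k * n t) / n t) \<le> 0" by simp
  qed (use s \<open>x \<le> s\<close> assms in auto)
  then show False using D_eq[of y] D_eq[of s] s \<open>x \<le> s\<close> assms by auto
qed

text \<open>Near the bounding rays the flow is subsonic, hence its velocity is constant. As the normal velocity
  tends to zero, this velocity is directed along the ray, and \<open>n' = - L\<close> with \<open>n > 0\<close> decides that it
  points to the origin at the first ray and away from it at the last.\<close>

lemma velocity_constant_near_a:
  obtains c Q where "a < c" "c < b" "Q > 0" "\<And>t. a < t \<Longrightarrow> t \<le> c \<Longrightarrow> W t < 0 \<and> L t < 0 \<and> q2 t = Q\<^sup>2"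
    "((\<lambda>t. L t / Q) \<longlongrightarrow> - 1) (at_right a)"
proof -
  obtain c0 where c0: "a < c0" "\<And>t. a < t \<Longrightarrow> t < c0 \<Longrightarrow> n t < B t"
    using sub_at_a unfolding eventually_at_right[OF ab] by blast
  obtain c1 where c1: "a < c1" "c1 < c0" "c1 < b" using c0(1) ab dense[of a "min c0 b"] by auto
  have W: "W t < 0" if "a < t" "t \<le> c1" for t using c0(2)[of t] that c1 unfolding W_def by simp
  have np: "primitive_on x c1 n (\<lambda>t. - L t)" if "a < x" for x
    by (rule n_prim) (use W that c1 in auto)
  have "\<exists>t. a < t \<and> t \<le> c1 \<and> L t < 0"
  proof (rule ccontr)
    assume "\<not> ?thesis"
    then have L: "L t \<ge> 0" if "a < t" "t \<le> c1" for t using that by force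
    have "n c1 \<le> n x" if "a < x" "x \<le> c1" for x
      by (rule primitive_on_antimono[OF np[OF that(1)]]) (use that L in auto)
    then have "\<forall>\<^sub>F x in at_right a. n c1 \<le> n x"
      using c1 eventually_at_right[OF c1(1)] by force
    then have "n c1 \<le> 0" by (intro tendsto_lowerbound[OF n_at_a]) auto
    then show False using n_pos[of c1] c1 by simp
  qed
  then obtain c where c: "a < c" "c \<le> c1" "L c < 0" by blast
  have L: "L t < 0" if "a < t" "t \<le> c" for t using L_mono[of t c] that c c1 by simp
  define Q where "Q = sqrt (q2 c)"
  have "q2 c > 0" using L[of c] c unfolding q2_def by (simp add: sum_power2_gt_zero_iff)
  then have Q: "Q > 0" "Q\<^sup>2 = q2 c" unfolding Q_def by auto
  have q: "q2 t = Q\<^sup>2" if "a < t" "t \<le> c" for t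
    unfolding Q by (rule q2_const) (use W that c c1 in auto)
  have "\<forall>\<^sub>F t in at_right a. L t / Q = - sqrt (1 - (n t / Q)\<^sup>2)"
    unfolding eventually_at_right[OF ab]
  proof (intro exI[of _ c] conjI allI impI)
    fix t assume t: "a < t" "t < c"
    have "(L t / Q)\<^sup>2 + (n t / Q)\<^sup>2 = q2 t / Q\<^sup>2"
      unfolding q2_def by (simp add: power_divide add_divide_distrib)
    also have "\<dots> = 1" using q[of t] t Q(1) by simp
    finally have "1 - (n t / Q)\<^sup>2 = (L t / Q)\<^sup>2" by simp
    then show "L t / Q = - sqrt (1 - (n t / Q)\<^sup>2)" using L[of t] t Q by simp
  qed (use c in auto)
  moreover have "((\<lambda>t. - sqrt (1 - (n t / Q)\<^sup>2)) \<longlongrightarrow> - sqrt (1 - (0 / Q)\<^sup>2)) (at_right a)"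
    by (intro tendsto_intros n_at_a) (use Q in auto)
  then have "((\<lambda>t. - sqrt (1 - (n t / Q)\<^sup>2)) \<longlongrightarrow> - 1) (at_right a)" by simp
  ultimately have lim: "((\<lambda>t. L t / Q) \<longlongrightarrow> - 1) (at_right a)"
    using tendsto_cong[of "\<lambda>t. L t / Q" "\<lambda>t. - sqrt (1 - (n t / Q)\<^sup>2)" "at_right a"] by blast
  show thesis
  proof (rule that[OF c(1) _ Q(1) _ lim])
    show "c < b" using c(2) c1(3) by simp
    show "W t < 0 \<and> L t < 0 \<and> q2 t = Q\<^sup>2" if "a < t" "t \<le> c" for t
      using W[of t] L[of t] q[of t] that c(2) by simp
  qed
qed

lemma velocity_constant_near_b:
  obtains c Q where "a < c" "c < b" "Q > 0" "\<And>t. c \<le> t \<Longrightarrow> t < b \<Longrightarrow> W t < 0 \<and> L t > 0 \<and> q2 t = Q\<^sup>2"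
    "((\<lambda>t. L t / Q) \<longlongrightarrow> 1) (at_left b)"
proof -
  obtain c0 where c0: "c0 < b" "\<And>t. c0 < t \<Longrightarrow> t < b \<Longrightarrow> n t < B t"
    using sub_at_b unfolding eventually_at_left[OF ab] by blast
  obtain c1 where c1: "c0 < c1" "a < c1" "c1 < b" using c0(1) ab dense[of "max a c0" b] by auto
  have W: "W t < 0" if "c1 \<le> t" "t < b" for t using c0(2)[of t] that c1 unfolding W_def by simp
  have np: "primitive_on c1 x n (\<lambda>t. - L t)" if "x < b" for x
    by (rule n_prim) (use W that c1 in auto)
  have "\<exists>t. c1 \<le> t \<and> t < b \<and> L t > 0"
  proof (rule ccontr)
    assume "\<not> ?thesis"
    then have L: "L t \<le> 0" if "c1 \<le> t" "t < b" for t using that by force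
    have "n c1 \<le> n x" if "c1 \<le> x" "x < b" for x
      by (rule primitive_on_mono[OF np[OF that(2)]]) (use that L in auto)
    then have "\<forall>\<^sub>F x in at_left b. n c1 \<le> n x"
      using c1 eventually_at_left[OF c1(3)] by force
    then have "n c1 \<le> 0" by (intro tendsto_lowerbound[OF n_at_b]) auto
    then show False using n_pos[of c1] c1 by simp
  qed
  then obtain c where c: "c1 \<le> c" "c < b" "L c > 0" by blast
  have L: "L t > 0" if "c \<le> t" "t < b" for t using L_mono[of c t] that c c1 by simp
  define Q where "Q = sqrt (q2 c)"
  have "q2 c > 0" using L[of c] c unfolding q2_def by (simp add: sum_power2_gt_zero_iff)
  then have Q: "Q > 0" "Q\<^sup>2 = q2 c" unfolding Q_def by auto
  have q: "q2 t = Q\<^sup>2" if "c \<le> t" "t < b" for t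
    unfolding Q by (rule q2_const[symmetric]) (use W that c c1 in auto)
  have "\<forall>\<^sub>F t in at_left b. L t / Q = sqrt (1 - (n t / Q)\<^sup>2)"
    unfolding eventually_at_left[OF ab]
  proof (intro exI[of _ c] conjI allI impI)
    fix t assume t: "c < t" "t < b"
    have "(L t / Q)\<^sup>2 + (n t / Q)\<^sup>2 = q2 t / Q\<^sup>2"
      unfolding q2_def by (simp add: power_divide add_divide_distrib)
    also have "\<dots> = 1" using q[of t] t Q(1) by simp
    finally have "1 - (n t / Q)\<^sup>2 = (L t / Q)\<^sup>2" by simp
    then show "L t / Q = sqrt (1 - (n t / Q)\<^sup>2)" using L[of t] t Q by simp
  qed (use c in auto)
  moreover have "((\<lambda>t. sqrt (1 - (n t / Q)\<^sup>2)) \<longlongrightarrow> sqrt (1 - (0 / Q)\<^sup>2)) (at_left b)"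
    by (intro tendsto_intros n_at_b) (use Q in auto)
  then have "((\<lambda>t. sqrt (1 - (n t / Q)\<^sup>2)) \<longlongrightarrow> 1) (at_left b)" by simp
  ultimately have lim: "((\<lambda>t. L t / Q) \<longlongrightarrow> 1) (at_left b)"
    using tendsto_cong[of "\<lambda>t. L t / Q" "\<lambda>t. sqrt (1 - (n t / Q)\<^sup>2)" "at_left b"] by blast
  show thesis
  proof (rule that[OF _ c(2) Q(1) _ lim])
    show "a < c" using c(1) c1(2) by simp
    show "W t < 0 \<and> L t > 0 \<and> q2 t = Q\<^sup>2" if "c \<le> t" "t < b" for t
      using W[of t] L[of t] q[of t] that c(1) by simp
  qed
qed

lemma incoming_angle:
  assumes "a < c" "c < b" "L c = 0"
  shows "pi / 2 \<le> c - a"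
proof -
  obtain d Q where d: "a < d" "d < b" "Q > 0" "\<And>t. a < t \<Longrightarrow> t \<le> d \<Longrightarrow> W t < 0 \<and> L t < 0 \<and> q2 t = Q\<^sup>2"
    and lim: "((\<lambda>t. L t / Q) \<longlongrightarrow> - 1) (at_right a)"
    using velocity_constant_near_a by blast
  have "d < c" using d(4)[of c] assms by force
  show ?thesis
  proof (rule arcsin_limit_pi_half)
    show "((\<lambda>t. - (L t / Q)) \<longlongrightarrow> 1) (at_right a)" using tendsto_minus[OF lim] by simp
    show "\<forall>\<^sub>F t in at_right a. \<bar>- (L t / Q)\<bar> \<le> 1 \<and> arcsin (- (L t / Q)) \<le> c - a"
      unfolding eventually_at_right[OF ab]
    proof (rule exI[of _ d], rule conjI[rotated], intro allI impI)
      fix t assume t: "a < t" "t < d"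
      have "(L t)\<^sup>2 \<le> Q\<^sup>2" using d(4)[of t] t unfolding q2_def by (metis less_imp_le le_add_same_cancel1 zero_le_power2)
      then have le: "\<bar>L t / Q\<bar> \<le> 1" using d(3) by (simp add: abs_le_square_iff[symmetric] field_simps)
      have "arcsin (L c / Q) - arcsin (L t / Q) \<le> c - t"
      proof (rule arcsin_increase_le[OF L_prim])
        fix r assume r: "t < r" "r < c"
        have "q2 r \<le> q2 t"
          by (rule q2_antimono_incoming) (use r t assms L_mono[of r c] in auto)
        then show "(L r)\<^sup>2 + (n r)\<^sup>2 \<le> Q\<^sup>2" using d(4)[of t] t unfolding q2_def by simp
      qed (use t assms d n_pos \<open>d < c\<close> in auto)
      then have "arcsin (- (L t / Q)) \<le> c - t"
        using assms(3) le arcsin_minus[of "L t / Q"] by (simp add: abs_le_iff del: abs_divide)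
      then show "\<bar>- (L t / Q)\<bar> \<le> 1 \<and> arcsin (- (L t / Q)) \<le> c - a" using le t by simp
    qed (use d in auto)
  qed simp
qed

text \<open>If \<open>W\<close> vanishes on the way, the outgoing fluid is accelerated by a rarefaction wave, along which the
  squared speed is \<open>G\<close>, and its speed is constant before and after the wave.\<close>

lemma q2_le_outgoing:
  assumes "a < x" "x \<le> y" "y < b" "0 \<le> L x" "W y < 0"
    and z: "x \<le> z" "z \<le> y" "W z = 0"
  shows "q2 x \<le> q2 y"
proof -
  obtain i s where zs: "x \<le> i" "i \<le> s" "s \<le> y" "W i = 0" "W s = 0"
    "\<And>t. x \<le> t \<Longrightarrow> t < i \<Longrightarrow> W t \<noteq> 0" "\<And>t. s < t \<Longrightarrow> t \<le> y \<Longrightarrow> W t \<noteq> 0"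
    using zeros_Sup_Inf[OF assms(1,3) z] by blast
  have nonneg: "0 \<le> L t" if "x \<le> t" "t < b" for t using L_mono[of x t] that assms by simp
  have "q2 x \<le> G i"
  proof (cases "i = x")
    case True then show ?thesis using q2_branch(3)[of i] zs assms by simp
  next
    case False
    have W: "W t > 0" if "x \<le> t" "t < i" for t
      using outgoing_subsonic_persists[of t i] nonneg[of t] zs(1-6) that assms by force
    have "q2 x \<le> qp i"
    proof (rule continuous_ge_on_closure[where f = "qp" and x = i])
      show "continuous_on (closure {x<..<i}) qp" "i \<in> closure {x<..<i}"
        using continuous(4)[of x i] False zs assms by (auto simp: closure_greaterThanLessThan)
      show "q2 x \<le> qp u" if "u \<in> {x<..<i}" for u
        using q2_const[of x u] q2_bounds(2)[of u] W that zs assms by auto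
    qed
    then show ?thesis using q2_branch(4)[of i] zs assms by simp
  qed
  also have "G i \<le> G s" by (rule G_mono) (use zs assms nonneg in auto)
  also have "G s \<le> q2 y"
  proof -
    have "s < y" using zs assms by (cases "s = y") auto
    have W: "W t < 0" if "s < t" "t \<le> y" for t
      using outgoing_supersonic_before[of s t] nonneg[of s] zs(7)[of t] zs that assms by force
    have "qm s \<le> q2 y"
    proof (rule continuous_le_on_closure[where f = "qm" and x = s])
      show "continuous_on (closure {s<..<y}) qm" "s \<in> closure {s<..<y}"
        using continuous(5)[of s y] \<open>s < y\<close> zs assms by (auto simp: closure_greaterThanLessThan)
      show "qm u \<le> q2 y" if "u \<in> {s<..<y}" for u
        using q2_const[of u y] q2_bounds(1)[of u] W that zs assms by auto
    qed
    then show ?thesis using q2_branch(5)[of s] zs assms by simp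
  qed
  finally show ?thesis .
qed

lemma angle_to_b:
  assumes x: "a < x" "x < b" and d: "x < d" "d < b" and Q: "Q > 0"
    and lim: "((\<lambda>t. L t / Q) \<longlongrightarrow> 1) (at_left b)"
    and L: "0 \<le> L x"
    and q: "\<And>t. x < t \<Longrightarrow> t < b \<Longrightarrow> q2 t \<le> Q\<^sup>2"
  shows "pi / 2 \<le> b - x + arcsin (L x / Q)"
proof (rule arcsin_limit_pi_half[OF _ lim])
  show "\<forall>\<^sub>F t in at_left b. \<bar>L t / Q\<bar> \<le> 1 \<and> arcsin (L t / Q) \<le> b - x + arcsin (L x / Q)"
    unfolding eventually_at_left[OF ab]
  proof (rule exI[of _ d], rule conjI[rotated], intro allI impI)
    fix t assume t: "d < t" "t < b"
    have "(L t)\<^sup>2 \<le> Q\<^sup>2" using q[of t] t d unfolding q2_def by (smt (verit) zero_le_power2)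
    then have "\<bar>L t / Q\<bar> \<le> 1" using Q by (simp add: abs_le_square_iff[symmetric] field_simps)
    moreover have "arcsin (L t / Q) - arcsin (L x / Q) \<le> t - x"
      by (rule arcsin_increase_le[OF L_prim]) (use q t d x Q n_pos in \<open>auto simp: q2_def\<close>)
    ultimately show "\<bar>L t / Q\<bar> \<le> 1 \<and> arcsin (L t / Q) \<le> b - x + arcsin (L x / Q)" using t by simp
  qed (use d in auto)
qed simp

text \<open>A shock occurs only if \<open>W\<close> passes from positive to negative values without a zero. Then the
  velocity is constant on either side of the shock; it turns by \<open>arcsin (L / Q1)\<close> relative to the rays
  before the shock and by \<open>\<pi> / 2 - arcsin (L / Q)\<close> behind it.\<close>

lemma outgoing_angle:
  assumes c: "a < c" "c < b" "L c = 0"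
  shows "pi / 2 - arcsin (1 / \<gamma>) \<le> b - c"
proof -
  obtain d Q where d: "a < d" "d < b" "Q > 0" "\<And>t. d \<le> t \<Longrightarrow> t < b \<Longrightarrow> W t < 0 \<and> L t > 0 \<and> q2 t = Q\<^sup>2"
    and lim: "((\<lambda>t. L t / Q) \<longlongrightarrow> 1) (at_left b)"
    using velocity_constant_near_b by blast
  have "c < d" using d(4)[of c] c by force
  have nonneg: "0 \<le> L t" if "c \<le> t" "t < b" for t using L_mono[of c t] that c by simp
  have ag: "arcsin (1 / \<gamma>) \<ge> 0" using arcsin_le_arcsin[of 0 "1 / \<gamma>"] \<gamma> by simp
  show ?thesis
  proof (cases "W c > 0 \<and> (\<forall>t. c \<le> t \<longrightarrow> t \<le> d \<longrightarrow> W t \<noteq> 0)")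
    case False
    have "q2 t \<le> Q\<^sup>2" if t: "c < t" "t < b" for t
    proof (cases "t \<ge> d")
      case True
      then show ?thesis using d(4)[of t] t by simp
    next
      case F2: False
      have "q2 t \<le> q2 d"
      proof (cases "\<exists>z. t \<le> z \<and> z \<le> d \<and> W z = 0")
        case True
        then show ?thesis using q2_le_outgoing[of t d] d(4)[of d] t F2 nonneg[of t] c d(2) by auto
      next
        case F3: False
        have "W t < 0"
        proof (rule ccontr)
          assume "\<not> W t < 0"
          moreover have "W t \<noteq> 0" using F3 F2 by auto
          ultimately have "W t > 0" by simp
          have pre: "W r > 0" if "c \<le> r" "r \<le> t" for r
            using outgoing_supersonic_before[of r t] \<open>W t > 0\<close> nonneg[of r] that t c by auto
          have "W r \<noteq> 0" if "c \<le> r" "r \<le> d" for r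
            using pre[of r] F3 that by (cases "r \<le> t") force+
          then show False using False pre[of c] t by auto
        qed
        then have "\<forall>r\<in>{t..d}. W r < 0"
          using outgoing_subsonic_persists[of t] nonneg[of t] t c d(2) by auto
        then show ?thesis using q2_const[of t d] t c F2 d(2) by simp
      qed
      then show ?thesis using d(4)[of d] d(2) by simp
    qed
    then have "pi / 2 \<le> b - c + arcsin (L c / Q)"
      by (intro angle_to_b[of c d]) (use c d \<open>c < d\<close> lim in auto)
    then show ?thesis using c(3) ag by simp
  next
    case True
    then obtain s where s: "c \<le> s" "s \<le> d"
      "\<And>t. c \<le> t \<Longrightarrow> t < s \<Longrightarrow> q2 t = qp s" "q2 c = qp s"
      "\<And>t. s < t \<Longrightarrow> t \<le> d \<Longrightarrow> q2 t = qm s" "q2 d = qm s" "\<gamma> * sqrt (D s) \<le> B s"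
      using single_shock[OF c(1) \<open>c < d\<close> d(2), OF True[THEN conjunct2, rule_format] True[THEN conjunct1]]
        d(4)[OF order_refl d(2)] by blast
    have s': "a < s" "s < b" using s c d by auto
    have "D s > 0"
      using True D_eq[of s] s s' by simp
    have defl: "arcsin (L s / sqrt ((L s)\<^sup>2 + (B s - sqrt (D s))\<^sup>2))
        - arcsin (L s / sqrt ((L s)\<^sup>2 + (B s + sqrt (D s))\<^sup>2)) \<le> arcsin (1 / \<gamma>)"
    proof (rule shock_deflection_le[OF _ _ _ \<gamma>, where V = "sqrt (D s)" and B = "B s"])
      show "sqrt (D s) < B s"
      proof -
        have "sqrt (D s) < \<gamma> * sqrt (D s)" using \<gamma> \<open>D s > 0\<close> by simp
        then show ?thesis using s(7) by linarith
      qed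
    qed (use s s' \<open>D s > 0\<close> nonneg in auto)
    have "qm s = Q\<^sup>2" using s(6) d(4)[of d] d(2) by simp
    then have Q': "sqrt ((L s)\<^sup>2 + (B s - sqrt (D s))\<^sup>2) = Q" using d(3) unfolding qm_def by simp
    define Q1 where "Q1 = sqrt ((L s)\<^sup>2 + (B s + sqrt (D s))\<^sup>2)"
    have "(L s)\<^sup>2 + (B s + sqrt (D s))\<^sup>2 > 0"
      using B_pos[OF s'] \<open>D s > 0\<close> by (intro add_nonneg_pos zero_less_power add_pos_nonneg) auto
    then have Q1: "Q1 > 0" "Q1\<^sup>2 = qp s" unfolding Q1_def qp_def by auto
    have "arcsin (L s / Q1) \<le> s - c"
    proof (cases "s = c")
      case True then show ?thesis using c(3) by simp
    next
      case False
      have "arcsin (L s / Q1) - arcsin (L c / Q1) \<le> s - c"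
      proof (rule arcsin_increase_le[OF L_prim])
        fix t assume t: "c < t" "t < s"
        then show "(L t)\<^sup>2 + (n t)\<^sup>2 \<le> Q1\<^sup>2" using s(3)[of t] Q1(2) unfolding q2_def by simp
        show "n t > 0" using n_pos[of t] t s' c by simp
      qed (use c s' s(1) False Q1 in auto)
      then show ?thesis using c(3) by simp
    qed
    moreover have "pi / 2 \<le> b - s + arcsin (L s / Q)"
    proof (rule angle_to_b[OF s', of "(d + b) / 2"])
      show "q2 t \<le> Q\<^sup>2" if "s < t" "t < b" for t
        using s(5)[of t] d(4)[of t] \<open>qm s = Q\<^sup>2\<close> that by (cases "t \<le> d") auto
    qed (use s(2) d lim nonneg[of s] s(1) s' in auto)
    ultimately show ?thesis using defl unfolding Q' Q1_def[symmetric] by linarith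
  qed
qed

text \<open>Only the outgoing part of the flow can turn through less than a right angle, and only by
  the deflection at its single shock.\<close>

theorem sector_angle: "pi - arcsin (1 / \<gamma>) \<le> b - a"
proof -
  obtain c1 Q1 where c1: "a < c1" "c1 < b" "Q1 > 0"
      "\<And>t. a < t \<Longrightarrow> t \<le> c1 \<Longrightarrow> W t < 0 \<and> L t < 0 \<and> q2 t = Q1\<^sup>2"
      "((\<lambda>t. L t / Q1) \<longlongrightarrow> - 1) (at_right a)"
    using velocity_constant_near_a by blast
  obtain c2 Q2 where c2: "a < c2" "c2 < b" "Q2 > 0"
      "\<And>t. c2 \<le> t \<Longrightarrow> t < b \<Longrightarrow> W t < 0 \<and> L t > 0 \<and> q2 t = Q2\<^sup>2"
      "((\<lambda>t. L t / Q2) \<longlongrightarrow> 1) (at_left b)"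
    using velocity_constant_near_b by blast
  have L: "L c1 < 0" "L c2 > 0" using c1(4)[of c1] c2(4)[of c2] c1(1) c2(2) by auto
  then have "c1 \<le> c2" using c1(4)[of c2] c2(1) by force
  obtain c where c: "c1 \<le> c" "c \<le> c2" "L c = 0"
    using IVT'[of L c1 0 c2] L \<open>c1 \<le> c2\<close> continuous(1)[OF c1(1) c2(2)] by auto
  have "a < c" "c < b" using c c1 c2 by auto
  then show ?thesis using incoming_angle[of c] outgoing_angle[of c] c(3) by auto
qed

end

section \<open>From the conservation laws to the equations along rays\<close>

definition bounded_measurable :: "(real \<Rightarrow> real) \<Rightarrow> bool"
  where "bounded_measurable f \<longleftrightarrow> f \<in> borel_measurable lebesgue \<and> (\<exists>C. \<forall>t. \<bar>f t\<bar> \<le> C)"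

lemma bounded_measurable_add:
  assumes "bounded_measurable f" "bounded_measurable g"
  shows "bounded_measurable (\<lambda>t. f t + g t)"
proof -
  obtain C D where "\<And>t. \<bar>f t\<bar> \<le> C" "\<And>t. \<bar>g t\<bar> \<le> D"
    using assms unfolding bounded_measurable_def by blast
  then have "\<bar>f t + g t\<bar> \<le> C + D" for t
    using abs_triangle_ineq[of "f t" "g t"] add_mono order_trans by blast
  then show ?thesis using assms unfolding bounded_measurable_def by auto
qed

lemma bounded_measurable_mult:
  assumes "bounded_measurable f" "bounded_measurable g"
  shows "bounded_measurable (\<lambda>t. f t * g t)"
proof -
  obtain C D where CD: "\<And>t. \<bar>f t\<bar> \<le> C" "\<And>t. \<bar>g t\<bar> \<le> D"
    using assms unfolding bounded_measurable_def by blast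
  have "\<bar>f t * g t\<bar> \<le> C * D" for t
    unfolding abs_mult using CD[of t] by (intro mult_mono) auto
  then show ?thesis using assms unfolding bounded_measurable_def by auto
qed

lemma bounded_measurable_const: "bounded_measurable (\<lambda>t. c)"
  unfolding bounded_measurable_def by auto

lemma bounded_measurable_minus:
  "bounded_measurable f \<Longrightarrow> bounded_measurable (\<lambda>t. - f t)"
  using bounded_measurable_mult[OF bounded_measurable_const[of "-1"]] by simp

lemma bounded_measurable_diff:
  "bounded_measurable f \<Longrightarrow> bounded_measurable g \<Longrightarrow> bounded_measurable (\<lambda>t. f t - g t)"
  using bounded_measurable_add[OF _ bounded_measurable_minus, of f g] by simp

lemma bounded_measurable_trig: "bounded_measurable sin" "bounded_measurable cos"
proof -
  have "(sin :: real \<Rightarrow> real) \<in> borel_measurable lborel" "(cos :: real \<Rightarrow> real) \<in> borel_measurable lborel"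
    using borel_measurable_continuous_onI[OF continuous_on_sin[OF continuous_on_id]]
      borel_measurable_continuous_onI[OF continuous_on_cos[OF continuous_on_id]]
    by simp_all
  then show "bounded_measurable sin" "bounded_measurable cos"
    unfolding bounded_measurable_def
    by (auto intro!: measurable_completion exI[of _ 1] abs_sin_le_one abs_cos_le_one simp del: measurable_lborel1)
qed

lemmas bounded_measurable_intros =
  bounded_measurable_add bounded_measurable_mult bounded_measurable_const
  bounded_measurable_minus bounded_measurable_diff bounded_measurable_trig

lemma bounded_measurable_integrable:
  assumes "bounded_measurable f"
  shows "f integrable_on {x..y}"
proof -
  obtain C where C: "\<And>t. \<bar>f t\<bar> \<le> C" using assms unfolding bounded_measurable_def by blast
  show ?thesis
  proof (rule measurable_bounded_by_integrable_imp_integrable[where g = "\<lambda>_. C"])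
    show "f \<in> borel_measurable (lebesgue_on {x..y})"
      using assms unfolding bounded_measurable_def by (auto intro: measurable_restrict_space1)
  qed (use C in auto)
qed

lemma vector_4_nth:
  "(vector [x, y, z, w] :: 'a :: zero ^ 4) $ 1 = x"
  "(vector [x, y, z, w] :: 'a :: zero ^ 4) $ 2 = y"
  "(vector [x, y, z, w] :: 'a :: zero ^ 4) $ 3 = z"
  "(vector [x, y, z, w] :: 'a :: zero ^ 4) $ 4 = w"
  unfolding vector_def by simp_all

lemma flux_components [simp]:
  "flux_x \<gamma> w $ 1 = density w * vel_x w"
  "flux_x \<gamma> w $ 2 = density w * (vel_x w)\<^sup>2 + pressure \<gamma> w"
  "flux_x \<gamma> w $ 3 = density w * vel_x w * vel_y w"
  "flux_x \<gamma> w $ 4 = vel_x w * (total_energy w + pressure \<gamma> w)"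
  "flux_y \<gamma> w $ 1 = density w * vel_y w"
  "flux_y \<gamma> w $ 2 = density w * vel_x w * vel_y w"
  "flux_y \<gamma> w $ 3 = density w * (vel_y w)\<^sup>2 + pressure \<gamma> w"
  "flux_y \<gamma> w $ 4 = vel_y w * (total_energy w + pressure \<gamma> w)"
  unfolding flux_x_def flux_y_def vector_4_nth by (rule refl)+

text \<open>Of the two states with the same mass, momentum and energy flux, the subsonic one has the
  larger entropy \<open>ln p - \<gamma> ln \<rho>\<close>.\<close>

lemma entropy_increases_across_shock:
  fixes B V g :: real
  assumes "1 < g" "0 < V" "g * V < B"
  shows "ln (B / g - V) + g * ln (B + V) < ln (B / g + V) + g * ln (B - V)"
proof -
  have recip: "1 / c + 1 / d = (c + d) / (c * d)" if "c > 0" "d > 0" for c d :: real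
    using that by (simp add: field_simps)
  define h where "h z = ln (B / g - z) + g * ln (B + z) - ln (B / g + z) - g * ln (B - z)" for z
  have pos: "B / g - z > 0" "B / g + z > 0" "B + z > 0" "B - z > 0" if "0 \<le> z" "z \<le> V" for z
  proof -
    have "g * z \<le> g * V" using that(2) assms(1) by (intro mult_left_mono) auto
    then have gz: "g * z < B" using assms by linarith
    moreover have "z \<le> g * z" using mult_right_mono[of 1 g z] that(1) assms(1) by simp
    ultimately have "z < B" by linarith
    have "z < B / g" using gz assms by (simp add: field_simps)
    with \<open>z < B\<close> that show "B / g - z > 0" "B / g + z > 0" "B + z > 0" "B - z > 0"
      by linarith+
  qed
  have "h V < h 0"
  proof (rule DERIV_neg_imp_decreasing_open[OF \<open>0 < V\<close>])
    fix z assume z: "0 < z" "z < V"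
    have p: "B / g - z > 0" "B / g + z > 0" "B + z > 0" "B - z > 0" using pos[of z] z by auto
    have "(h has_real_derivative
        - 1 / (B / g - z) + g * (1 / (B + z)) - 1 / (B / g + z) - g * (- 1 / (B - z))) (at z)"
      unfolding h_def using p by (auto intro!: derivative_eq_intros simp: divide_inverse)
    moreover have "- 1 / (B / g - z) + g * (1 / (B + z)) - 1 / (B / g + z) - g * (- 1 / (B - z)) < 0"
    proof -
      have "g * (1 / (B + z)) - g * (- 1 / (B - z)) = 2 * g * B / (B\<^sup>2 - z\<^sup>2)"
      proof -
        have "g * (1 / (B + z)) - g * (- 1 / (B - z)) = g * (1 / (B + z) + 1 / (B - z))"
          by (simp add: algebra_simps)
        also have "\<dots> = g * ((2 * B) / ((B + z) * (B - z)))"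
          unfolding recip[OF p(3,4)] by simp
        also have "(B + z) * (B - z) = B\<^sup>2 - z\<^sup>2" by (simp add: power2_eq_square algebra_simps)
        finally show ?thesis by simp
      qed
      also have "\<dots> < 2 * g * B / (B\<^sup>2 - (g * z)\<^sup>2)"
      proof (rule divide_strict_left_mono)
        have "z\<^sup>2 < (g * z)\<^sup>2" using z assms by (intro power_strict_mono) auto
        then show "B\<^sup>2 - (g * z)\<^sup>2 < B\<^sup>2 - z\<^sup>2" by simp
        have "g * z < B" using p(1) assms by (simp add: field_simps)
        moreover have "0 < g * z" using z assms by simp
        ultimately have "(g * z)\<^sup>2 < B\<^sup>2" by (intro power_strict_mono) auto
        then show "0 < (B\<^sup>2 - z\<^sup>2) * (B\<^sup>2 - (g * z)\<^sup>2)" using \<open>z\<^sup>2 < (g * z)\<^sup>2\<close> by simp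
        show "0 < 2 * g * B" using \<open>g * z < B\<close> \<open>0 < g * z\<close> assms by simp
      qed
      also have "\<dots> = 1 / (B / g - z) + 1 / (B / g + z)"
      proof -
        have 1: "(B / g - z) * (B / g + z) = (B\<^sup>2 - (g * z)\<^sup>2) / g\<^sup>2"
          using assms by (simp add: field_simps power2_eq_square)
        have "1 / (B / g - z) + 1 / (B / g + z) = (2 * B / g) / ((B / g - z) * (B / g + z))"
          unfolding recip[OF p(1,2)] by simp
        also have "\<dots> = 2 * g * B / (B\<^sup>2 - (g * z)\<^sup>2)"
          unfolding 1 using assms(1) by (simp add: power2_eq_square field_simps)
        finally show ?thesis by simp
      qed
      finally show ?thesis unfolding minus_divide_left[symmetric] by linarith
    qed
    ultimately show "\<exists>y. (h has_real_derivative y) (at z) \<and> y < 0" by blast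
  next
    have "\<forall>z\<in>{0..V}. B / g - z \<noteq> 0 \<and> B / g + z \<noteq> 0 \<and> B + z \<noteq> 0 \<and> B - z \<noteq> 0"
    proof
      fix z assume "z \<in> {0..V}"
      then show "B / g - z \<noteq> 0 \<and> B / g + z \<noteq> 0 \<and> B + z \<noteq> 0 \<and> B - z \<noteq> 0"
        using pos[of z] by simp
    qed
    then show "continuous_on {0..V} h"
      unfolding h_def by (intro continuous_intros) auto
  qed
  then show ?thesis unfolding h_def by simp
qed

text \<open>The conservation laws bound the entropy production between two rays by a multiple of the
  angle between them, whereas a jump from the subsonic to the supersonic state would destroy a
  fixed amount of entropy.\<close>

lemma no_expansion_shock:
  fixes \<gamma> C a b t p0 :: real and n M P B D :: "real \<Rightarrow> real"
  defines "B \<equiv> \<lambda>t. \<gamma> / (\<gamma> + 1) * (P t / M t)"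
  assumes \<gamma>: "\<gamma> > 1" and t: "a < t" "t < b" and "n t \<noteq> B t" and "p0 > 0"
    and cont: "isCont M t" "isCont P t" "isCont D t"
    and pos: "\<And>s. a < s \<Longrightarrow> s < b \<Longrightarrow> M s > 0 \<and> n s > 0 \<and> p0 \<le> P s - M s * n s"
    and D: "\<And>s. a < s \<Longrightarrow> s < b \<Longrightarrow> D s = (n s - B s)\<^sup>2"
    and ent: "\<And>x y. a < x \<Longrightarrow> x < y \<Longrightarrow> y < b \<Longrightarrow>
      M x * (ln (P x - M x * n x) - \<gamma> * ln (M x / n x)) - M y * (ln (P y - M y * n y) - \<gamma> * ln (M y / n y))
      \<le> C * (y - x)"
  shows "\<exists>\<epsilon>>0. \<forall>x y. a < x \<longrightarrow> t - \<epsilon> < x \<longrightarrow> x < y \<longrightarrow> y < t + \<epsilon> \<longrightarrow> y < b \<longrightarrow> n x < B x \<longrightarrow> n y \<le> B y"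
proof -
  define V where "V s = sqrt (D s)" for s
  have V: "V s = \<bar>n s - B s\<bar>" if "a < s" "s < b" for s unfolding V_def D[OF that] by simp
  have p: "P s - M s * n s = M s * (B s / \<gamma> - (n s - B s))" if "a < s" "s < b" for s
  proof -
    have "M s * (B s / \<gamma> + B s) = M s * (P s / M s) * (\<gamma> / (\<gamma> + 1) * (1 / \<gamma> + 1))"
    proof -
      have "r * (c * q / d + c * q) = r * q * (c * (1 / d + 1))" for r c q d :: real
        by (simp add: algebra_simps)
      then show ?thesis unfolding B_def by blast
    qed
    also have "M s * (P s / M s) = P s" using pos[OF that] by simp
    also have "\<gamma> / (\<gamma> + 1) * (1 / \<gamma> + 1) = 1"
    proof -
      have "1 / \<gamma> + 1 = (\<gamma> + 1) / \<gamma>" using \<gamma> by (simp add: add_divide_distrib)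
      then show ?thesis using \<gamma> by simp
    qed
    finally show ?thesis by (simp add: algebra_simps)
  qed
  have cB: "isCont B t"
    unfolding B_def using pos[OF t] by (intro continuous_intros cont) auto
  have cV: "isCont V t" unfolding V_def by (intro continuous_intros cont)
  have near: "\<exists>\<epsilon>>0. \<forall>s. \<bar>s - t\<bar> < \<epsilon> \<longrightarrow> f s < c" if "isCont f t" "f t < c" for f :: "real \<Rightarrow> real" and c
  proof -
    have "(f \<longlongrightarrow> f t) (at t)" using that(1) by (simp add: isCont_def)
    then have "\<forall>\<^sub>F s in at t. f s < c" using that(2) by (rule order_tendstoD(2))
    then obtain d where "d > 0" "\<And>s. s \<noteq> t \<Longrightarrow> \<bar>s - t\<bar> < d \<Longrightarrow> f s < c"
      unfolding eventually_at dist_real_def by auto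
    then show ?thesis using that(2) by (metis)
  qed
  show ?thesis
  proof (cases "M t * (B t / \<gamma> - V t) < p0")
    case True
    have "isCont (\<lambda>s. M s * (B s / \<gamma> - V s)) t"
      using \<gamma> by (intro continuous_intros cont cB cV) auto
    from near[OF this True] obtain \<epsilon> where \<epsilon>: "\<epsilon> > 0"
      "\<And>s. \<bar>s - t\<bar> < \<epsilon> \<Longrightarrow> M s * (B s / \<gamma> - V s) < p0" by blast
    have "n y \<le> B y" if "a < y" "y < b" "\<bar>y - t\<bar> < \<epsilon>" for y
    proof (rule ccontr)
      assume "\<not> n y \<le> B y"
      then show False using \<epsilon>(2)[OF that(3)] p[OF that(1,2)] V[OF that(1,2)] pos[OF that(1,2)] by simp
    qed
    then show ?thesis using \<epsilon>(1) by (intro exI[of _ \<epsilon>]) auto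
  next
    case False
    have Mt: "M t > 0" using pos[OF t] by simp
    have "M t * (B t / \<gamma> - V t) > 0" using False \<open>p0 > 0\<close> by linarith
    then have VB: "\<gamma> * V t < B t" using Mt \<gamma> by (simp add: zero_less_mult_iff field_simps)
    have V0: "V t > 0" using V[OF t] \<open>n t \<noteq> B t\<close> by simp
    have "V t < \<gamma> * V t" using \<gamma> V0 by simp
    with VB have VB': "V t < B t" by linarith
    have posB: "B t / \<gamma> - V t > 0" "B t / \<gamma> + V t > 0" "B t + V t > 0" "B t - V t > 0"
      using VB VB' V0 \<gamma> by (auto simp: field_simps add_pos_pos)
    define Sm where "Sm s = M s * (ln (M s * (B s / \<gamma> + V s)) - \<gamma> * ln (M s / (B s - V s)))" for s
    define Sp where "Sp s = M s * (ln (M s * (B s / \<gamma> - V s)) - \<gamma> * ln (M s / (B s + V s)))" for s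
    have gap: "Sp t < Sm t"
    proof -
      have "Sm t - Sp t = M t * ((ln (B t / \<gamma> + V t) + \<gamma> * ln (B t - V t))
          - (ln (B t / \<gamma> - V t) + \<gamma> * ln (B t + V t)))"
      proof -
        have "ln (M t * (B t / \<gamma> + V t)) = ln (M t) + ln (B t / \<gamma> + V t)"
          "ln (M t * (B t / \<gamma> - V t)) = ln (M t) + ln (B t / \<gamma> - V t)"
          "ln (M t / (B t - V t)) = ln (M t) - ln (B t - V t)"
          "ln (M t / (B t + V t)) = ln (M t) - ln (B t + V t)"
          using posB Mt by (simp_all add: ln_mult ln_div)
        then show ?thesis unfolding Sm_def Sp_def by (simp add: right_diff_distrib distrib_left)
      qed
      also have "\<dots> > 0"
        using entropy_increases_across_shock[OF \<gamma> V0 VB] Mt by simp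
      finally show ?thesis by simp
    qed
    have cS: "isCont Sm t" "isCont Sp t"
      unfolding Sm_def Sp_def using posB Mt \<gamma>
      by (auto intro!: continuous_intros cont cB cV)
    define d where "d = (Sm t - Sp t) / 3"
    have d: "d > 0" using gap unfolding d_def by simp
    obtain e1 where e1: "e1 > 0" "\<And>s. \<bar>s - t\<bar> < e1 \<Longrightarrow> Sp s < Sp t + d"
      using near[OF cS(2), of "Sp t + d"] d by auto
    obtain e2 where e2: "e2 > 0" "\<And>s. \<bar>s - t\<bar> < e2 \<Longrightarrow> - Sm s < - Sm t + d"
      using near[of "\<lambda>s. - Sm s" "- Sm t + d"] d continuous_minus[OF cS(1)] by auto
    define e3 where "e3 = d / (2 * (\<bar>C\<bar> + 1))"
    have e3: "e3 > 0" "\<bar>C\<bar> * (2 * e3) \<le> d" using d unfolding e3_def by (auto simp: field_simps)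
    define \<epsilon> where "\<epsilon> = min e1 (min e2 e3)"
    have \<epsilon>: "\<epsilon> > 0" "\<epsilon> \<le> e1" "\<epsilon> \<le> e2" "\<epsilon> \<le> e3" unfolding \<epsilon>_def using e1 e2 e3 by auto
    have "n y \<le> B y" if xy: "a < x" "t - \<epsilon> < x" "x < y" "y < t + \<epsilon>" "y < b" "n x < B x" for x y
    proof (rule ccontr)
      assume "\<not> n y \<le> B y"
      then have ny: "n y = B y + V y" "n y - B y = V y" using V[of y] xy by auto
      have nx: "n x = B x - V x" "n x - B x = - V x" using V[of x] xy by auto
      have "Sm x - Sp y \<le> C * (y - x)"
        using ent[of x y] p[of x] p[of y] xy unfolding nx(2) ny(2) Sm_def Sp_def nx(1)[symmetric] ny(1)[symmetric]
        by simp
      also have "\<dots> \<le> \<bar>C\<bar> * (2 * e3)"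
        using xy \<epsilon> by (intro mult_mono) auto
      finally have "Sm x - Sp y \<le> d" using e3 by simp
      moreover have "Sp y < Sp t + d" "- Sm x < - Sm t + d"
        using e1(2)[of y] e2(2)[of x] xy \<epsilon> by auto
      ultimately show False unfolding d_def by (simp add: field_simps)
    qed
    then show ?thesis using \<epsilon>(1) by (intro exI[of _ \<epsilon>]) blast
  qed
qed

locale nonstagnant_solution =
  fixes \<gamma> cv s0 K :: real and U :: "real \<Rightarrow> state"
  assumes \<gamma>: "\<gamma> > 1" and cv: "cv > 0" and K: "K > 1"
    and sol: "entropy_solution \<gamma> cv s0 K U" and nonstagnant: "no_stagnation_points U"
begin

definition \<rho> where "\<rho> t = density (U t)"
definition u where "u t = vel_x (U t)"
definition v where "v t = vel_y (U t)"
definition p where "p t = pressure \<gamma> (U t)"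
definition S where "S t = entropy \<gamma> cv s0 (U t)"
definition h where "h t = (total_energy (U t) + p t) / \<rho> t"
definition L where "L t = u t * cos t + v t * sin t"
definition N where "N t = u t * sin t - v t * cos t"
definition m where "m t = \<rho> t * N t"
definition P where "P t = m t * N t + p t"
definition Gx where "Gx t = m t * u t + p t * sin t"
definition Gy where "Gy t = m t * v t - p t * cos t"

lemma N_eq: "N = normal_vel U"
  unfolding N_def normal_vel_def u_def v_def by auto

lemma bounds: "inverse K \<le> \<rho> t" "\<rho> t \<le> K" "\<rho> t > 0" "\<bar>u t\<bar> \<le> K * K" "\<bar>v t\<bar> \<le> K * K"
    "\<bar>total_energy (U t)\<bar> \<le> K" "(\<gamma> - 1) * (inverse K * inverse K) \<le> p t" "p t \<le> (\<gamma> - 1) * (K * K)"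
proof -
  have U: "inverse K \<le> density (U t)" "density (U t) \<le> K" "inverse K \<le> internal_energy (U t)"
    "internal_energy (U t) \<le> K" "norm (U t) \<le> K"
    using sol unfolding entropy_solution_def phase_space_def by auto
  show r: "inverse K \<le> \<rho> t" "\<rho> t \<le> K" unfolding \<rho>_def by fact+
  have iK: "inverse K > 0" using K by simp
  show rp: "\<rho> t > 0" using r(1) iK by linarith
  have comp: "\<bar>U t $ i\<bar> \<le> K" for i using component_le_norm_cart[of "U t" i] U(5) by linarith
  have inv: "1 / \<rho> t \<le> K" using r(1) rp K by (simp add: field_simps)
  have "\<bar>U t $ i / \<rho> t\<bar> \<le> K * K" for i
  proof -
    have "\<bar>U t $ i / \<rho> t\<bar> = \<bar>U t $ i\<bar> * (1 / \<rho> t)" using rp by simp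
    also have "\<dots> \<le> K * K" using comp[of i] inv rp K by (intro mult_mono) auto
    finally show ?thesis .
  qed
  then show "\<bar>u t\<bar> \<le> K * K" "\<bar>v t\<bar> \<le> K * K"
    unfolding u_def v_def vel_x_def vel_y_def \<rho>_def density_def by auto
  show "\<bar>total_energy (U t)\<bar> \<le> K" unfolding total_energy_def by (rule comp)
  have p: "p t = (\<gamma> - 1) * (\<rho> t * internal_energy (U t))"
    unfolding p_def pressure_def \<rho>_def by simp
  show "(\<gamma> - 1) * (inverse K * inverse K) \<le> p t" "p t \<le> (\<gamma> - 1) * (K * K)"
    unfolding p using \<gamma> iK K r rp U order_trans[OF less_imp_le[OF iK] U(3)]
    by (intro mult_left_mono mult_mono; simp)+
qed

lemma p_pos: "p t > 0"
proof -
  have "0 < (\<gamma> - 1) * (inverse K * inverse K)" using \<gamma> K by simp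
  then show ?thesis using bounds(7)[of t] by linarith
qed

lemma S_eq: "S t = cv * (ln (p t) - \<gamma> * ln (\<rho> t)) + s0"
  unfolding S_def entropy_def p_def[symmetric] \<rho>_def[symmetric]
  using p_pos[of t] bounds(3)[of t] by (simp add: ln_mult ln_powr)

lemma measurable:
  "\<rho> \<in> borel_measurable lebesgue" "u \<in> borel_measurable lebesgue" "v \<in> borel_measurable lebesgue"
  "p \<in> borel_measurable lebesgue" "h \<in> borel_measurable lebesgue" "S \<in> borel_measurable lebesgue"
proof -
  have "(\<lambda>w. w $ i) \<in> borel_measurable borel" for i :: 4 and w :: state
    by (intro borel_measurable_continuous_onI continuous_on_component continuous_on_id)
  then have nth: "(\<lambda>w :: state. w $ i) \<in> borel_measurable borel" for i :: 4 .
  have U: "(\<lambda>t. U t $ i) \<in> borel_measurable lebesgue" for i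
    by (rule measurable_compose[OF _ nth]) (use sol in \<open>simp add: entropy_solution_def\<close>)
  show r: "\<rho> \<in> borel_measurable lebesgue" "u \<in> borel_measurable lebesgue" "v \<in> borel_measurable lebesgue"
    unfolding \<rho>_def[abs_def] u_def[abs_def] v_def[abs_def] vel_x_def vel_y_def density_def
    by (intro U borel_measurable_divide)+
  show p: "p \<in> borel_measurable lebesgue"
    unfolding p_def[abs_def] pressure_def internal_energy_def
      \<rho>_def[symmetric] u_def[symmetric] v_def[symmetric] total_energy_def
    by (intro borel_measurable_times borel_measurable_diff borel_measurable_divide
        borel_measurable_power borel_measurable_add borel_measurable_const r U)
  show "h \<in> borel_measurable lebesgue"
    unfolding h_def[abs_def] total_energy_def
    by (intro borel_measurable_divide borel_measurable_add r p U)
  show "S \<in> borel_measurable lebesgue"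
    unfolding S_eq[abs_def]
    by (intro borel_measurable_times borel_measurable_diff borel_measurable_ln
        borel_measurable_add borel_measurable_const r p)
qed

lemma bounded_measurable_quantities:
  "bounded_measurable \<rho>" "bounded_measurable u" "bounded_measurable v" "bounded_measurable p"
  "bounded_measurable h" "bounded_measurable S"
proof -
  show "bounded_measurable \<rho>"
    unfolding bounded_measurable_def using measurable bounds(2,3) by (auto intro!: exI[of _ K] simp: less_imp_le)
  show "bounded_measurable u" "bounded_measurable v"
    unfolding bounded_measurable_def using measurable bounds(4,5) by blast+
  show "bounded_measurable p"
    unfolding bounded_measurable_def using measurable bounds(8) p_pos
    by (auto intro!: exI[of _ "(\<gamma> - 1) * (K * K)"] simp: less_imp_le abs_of_pos)
  have "\<bar>h t\<bar> \<le> (K + (\<gamma> - 1) * (K * K)) * K" for t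
  proof -
    have "1 / \<rho> t \<le> K" using bounds(1,3)[of t] K by (simp add: field_simps)
    moreover have "\<bar>total_energy (U t) + p t\<bar> \<le> K + (\<gamma> - 1) * (K * K)"
      using bounds(6,8)[of t] p_pos[of t] by linarith
    moreover have "\<bar>h t\<bar> = \<bar>total_energy (U t) + p t\<bar> * (1 / \<rho> t)"
      unfolding h_def using bounds(3)[of t] by simp
    moreover have "0 \<le> K + (\<gamma> - 1) * (K * K)" using K \<gamma> by simp
    ultimately show ?thesis
      using mult_mono[of "\<bar>total_energy (U t) + p t\<bar>" "K + (\<gamma> - 1) * (K * K)" "1 / \<rho> t" K] bounds(3)[of t] by simp
  qed
  then show "bounded_measurable h"
    unfolding bounded_measurable_def using measurable by blast
  have "\<bar>ln (\<rho> t)\<bar> \<le> ln K" for t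
  proof -
    have "ln (inverse K) \<le> ln (\<rho> t)" "ln (\<rho> t) \<le> ln K"
      using bounds(1-3)[of t] K by (auto intro!: ln_le_cancel_iff[THEN iffD2] simp del: ln_le_cancel_iff)
    then show ?thesis using K by (simp add: ln_inverse)
  qed
  then have "bounded_measurable (\<lambda>t. ln (\<rho> t))"
    unfolding bounded_measurable_def using measurable by (auto intro: borel_measurable_ln)
  moreover have "\<bar>ln (p t)\<bar> \<le> \<bar>ln ((\<gamma> - 1) * (inverse K * inverse K))\<bar> + \<bar>ln ((\<gamma> - 1) * (K * K))\<bar>" for t
  proof -
    have pos: "0 < (\<gamma> - 1) * (inverse K * inverse K)" "0 < (\<gamma> - 1) * (K * K)" using \<gamma> K by simp_all
    have "ln ((\<gamma> - 1) * (inverse K * inverse K)) \<le> ln (p t)" "ln (p t) \<le> ln ((\<gamma> - 1) * (K * K))"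
      using bounds(7,8)[of t] p_pos[of t] pos by (auto intro!: ln_le_cancel_iff[THEN iffD2] simp del: ln_le_cancel_iff)
    then show ?thesis by linarith
  qed
  then have "bounded_measurable (\<lambda>t. ln (p t))"
    unfolding bounded_measurable_def using measurable by (blast intro: borel_measurable_ln)
  ultimately show "bounded_measurable S"
    unfolding S_eq[abs_def] by (intro bounded_measurable_intros)
qed

lemmas bounded_measurable_flow = bounded_measurable_intros bounded_measurable_quantities

lemma bounded_measurable_LN: "bounded_measurable L" "bounded_measurable N"
  unfolding L_def[abs_def] N_def[abs_def] by (intro bounded_measurable_flow)+

lemma primitive_onI_bounded_measurable:
  assumes "bounded_measurable f"
    "\<And>x y. x < y \<Longrightarrow> F y - F x = integral {x..y} f"
  shows "primitive_on a b F f"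
  unfolding primitive_on_def
proof (intro conjI allI impI)
  show "\<exists>C. \<forall>x\<in>{a..b}. \<bar>f x\<bar> \<le> C" using assms(1) unfolding bounded_measurable_def by blast
  fix x y assume "a \<le> x" "x \<le> y" "y \<le> b"
  then show "(f has_integral F y - F x) {x..y}"
    using assms(2)[of x y] integrable_integral[OF bounded_measurable_integrable[OF assms(1)], of x y]
    by (cases "x = y") auto
qed

lemma energy_flux: "u t * (total_energy (U t) + p t) = \<rho> t * u t * h t"
    "v t * (total_energy (U t) + p t) = \<rho> t * v t * h t"
  unfolding h_def using bounds(3)[of t] by auto

lemma conservation_laws:
  shows m_prim: "primitive_on a b m (\<lambda>t. \<rho> t * L t)"
    and Gx_prim: "primitive_on a b Gx (\<lambda>t. \<rho> t * L t * u t + p t * cos t)"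
    and Gy_prim: "primitive_on a b Gy (\<lambda>t. \<rho> t * L t * v t + p t * sin t)"
    and mh_prim: "primitive_on a b (\<lambda>t. m t * h t) (\<lambda>t. \<rho> t * L t * h t)"
    and flux_integrable: "(\<lambda>t. cos t *\<^sub>R flux_x \<gamma> (U t) + sin t *\<^sub>R flux_y \<gamma> (U t)) integrable_on {a..b}"
proof -
  define F where "F t = cos t *\<^sub>R flux_x \<gamma> (U t) + sin t *\<^sub>R flux_y \<gamma> (U t)" for t
  define J where "J t = sin t *\<^sub>R flux_x \<gamma> (U t) - cos t *\<^sub>R flux_y \<gamma> (U t)" for t
  have F: "F t $ 1 = \<rho> t * L t" "F t $ 2 = \<rho> t * L t * u t + p t * cos t"
    "F t $ 3 = \<rho> t * L t * v t + p t * sin t" "F t $ 4 = \<rho> t * L t * h t" for t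
    using energy_flux[of t]
    by (simp_all add: F_def L_def u_def v_def p_def \<rho>_def algebra_simps power2_eq_square)
  have J: "J t $ 1 = m t" "J t $ 2 = Gx t" "J t $ 3 = Gy t" "J t $ 4 = m t * h t" for t
    using energy_flux[of t]
    by (simp_all add: J_def m_def Gx_def Gy_def N_def u_def v_def p_def \<rho>_def algebra_simps power2_eq_square)
  have bm: "bounded_measurable (\<lambda>t. F t $ i)" for i
    using exhaust_4[of i] by (auto simp: F intro!: bounded_measurable_flow bounded_measurable_LN)
  have int: "F integrable_on {x..y}" for x y :: real
  proof (rule integrable_componentwise)
    fix b :: state assume "b \<in> Basis"
    then obtain i where "b = axis i 1" by (auto simp: Basis_vec_def)
    then show "(\<lambda>t. F t \<bullet> b) integrable_on {x..y}"
      using bounded_measurable_integrable[OF bm[of i]] by (simp add: inner_axis)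
  qed
  have "J y - J x = integral {x..y} F" if "x < y" for x y
    using sol that unfolding entropy_solution_def F_def[abs_def] J_def by blast
  then have "J y $ i - J x $ i = integral {x..y} (\<lambda>t. F t $ i)" if "x < y" for x y i
    using that int[of x y] by (simp flip: vector_minus_component)
  then have prims: "primitive_on a b (\<lambda>t. J t $ i) (\<lambda>t. F t $ i)" for i
    by (rule primitive_onI_bounded_measurable[OF bm])
  from int show "(\<lambda>t. cos t *\<^sub>R flux_x \<gamma> (U t) + sin t *\<^sub>R flux_y \<gamma> (U t)) integrable_on {a..b}"
    unfolding F_def .
  from prims[of 1] prims[of 2] prims[of 3] prims[of 4]
  show "primitive_on a b m (\<lambda>t. \<rho> t * L t)" "primitive_on a b Gx (\<lambda>t. \<rho> t * L t * u t + p t * cos t)"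
    "primitive_on a b Gy (\<lambda>t. \<rho> t * L t * v t + p t * sin t)"
    "primitive_on a b (\<lambda>t. m t * h t) (\<lambda>t. \<rho> t * L t * h t)"
    unfolding F J by simp_all
qed

lemma entropy_production:
  assumes "x < y"
  shows "m y * S y - m x * S x \<le> integral {x..y} (\<lambda>t. \<rho> t * L t * S t)"
proof -
  have "(sin t * entropy_flux_x \<gamma> cv s0 (U t) - cos t * entropy_flux_y \<gamma> cv s0 (U t)) = m t * S t"
    "(cos t * entropy_flux_x \<gamma> cv s0 (U t) + sin t * entropy_flux_y \<gamma> cv s0 (U t)) = \<rho> t * L t * S t" for t
    by (simp_all add: entropy_flux_x_def entropy_flux_y_def m_def N_def L_def S_def u_def v_def \<rho>_def algebra_simps)
  then show ?thesis using sol assms unfolding entropy_solution_def by simp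
qed

text \<open>The balance of momentum in the basis that rotates with the ray; the rotation contributes the
  products of \<open>Gx\<close> and \<open>Gy\<close> with the derivatives of \<open>sin\<close> and \<open>cos\<close>.\<close>

lemma P_prim: "primitive_on a b P (\<lambda>t. 2 * m t * L t)"
  and mL_prim: "primitive_on a b (\<lambda>t. m t * L t) (\<lambda>t. \<rho> t * (L t)\<^sup>2 - m t * N t)"
proof -
  have sc: "primitive_on a b sin cos" "primitive_on a b cos (\<lambda>t. - sin t)"
    by (rule primitive_on_smooth; auto intro!: derivative_eq_intros continuous_intros)+
  note rules = primitive_on_mult[OF Gx_prim sc(1)] primitive_on_mult[OF Gy_prim sc(2)]
    primitive_on_mult[OF Gx_prim sc(2)] primitive_on_mult[OF Gy_prim sc(1)]
  have one: "z * (sin t)\<^sup>2 + z * (cos t)\<^sup>2 = z" for z t :: real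
    by (simp flip: distrib_left)
  show "primitive_on a b P (\<lambda>t. 2 * m t * L t)"
  proof (rule primitive_on_cong[OF primitive_on_diff[OF rules(1) rules(2)]])
    fix t
    have "Gx t * sin t - Gy t * cos t = m t * N t + (p t * (sin t)\<^sup>2 + p t * (cos t)\<^sup>2)"
      by (simp add: Gx_def Gy_def N_def algebra_simps power2_eq_square)
    then show "Gx t * sin t - Gy t * cos t = P t" unfolding one P_def .
    show "Gx t * cos t + (\<rho> t * L t * u t + p t * cos t) * sin t -
        (Gy t * - sin t + (\<rho> t * L t * v t + p t * sin t) * cos t) = 2 * m t * L t"
    proof -
      have "Gx t * cos t + Gy t * sin t = m t * L t" by (simp add: Gx_def Gy_def L_def algebra_simps)
      moreover have "\<rho> t * L t * u t * sin t - \<rho> t * L t * v t * cos t = m t * L t"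
        by (simp add: m_def N_def algebra_simps)
      ultimately show ?thesis by (simp add: algebra_simps)
    qed
  qed
  show "primitive_on a b (\<lambda>t. m t * L t) (\<lambda>t. \<rho> t * (L t)\<^sup>2 - m t * N t)"
  proof (rule primitive_on_cong[OF primitive_on_add[OF rules(3) rules(4)]])
    fix t
    show "Gx t * cos t + Gy t * sin t = m t * L t" by (simp add: Gx_def Gy_def L_def algebra_simps)
    have "Gx t * - sin t + (\<rho> t * L t * u t + p t * cos t) * cos t +
        (Gy t * cos t + (\<rho> t * L t * v t + p t * sin t) * sin t)
      = - (m t * (u t * sin t - v t * cos t)) + \<rho> t * L t * (u t * cos t + v t * sin t)"
      by (simp add: Gx_def Gy_def algebra_simps)
    also have "\<dots> = \<rho> t * (L t)\<^sup>2 - m t * N t"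
      unfolding L_def[symmetric] N_def[symmetric] by (simp add: power2_eq_square)
    finally show "Gx t * - sin t + (\<rho> t * L t * u t + p t * cos t) * cos t +
        (Gy t * cos t + (\<rho> t * L t * v t + p t * sin t) * sin t) = \<rho> t * (L t)\<^sup>2 - m t * N t" .
  qed
qed

text \<open>Where \<open>m \<noteq> 0\<close>, \<open>L\<close> and \<open>h\<close> are quotients of conserved fluxes by \<open>m\<close>, hence continuous even
  across shocks.\<close>

lemma L_prim:
  assumes "\<And>t. a \<le> t \<Longrightarrow> t \<le> b \<Longrightarrow> N t \<noteq> 0"
  shows "primitive_on a b L (\<lambda>t. - N t)"
proof (rule primitive_on_cong[OF primitive_on_mult[OF mL_prim primitive_on_inverse[OF m_prim]]])
  fix t assume "a \<le> t" "t \<le> b"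
  then have nz: "N t \<noteq> 0" "\<rho> t \<noteq> 0" using assms bounds(3)[of t] by auto
  then show "m t \<noteq> 0" unfolding m_def by simp
  show "m t * L t * (1 / m t) = L t" using nz unfolding m_def by simp
  show "m t * L t * (- (1 / (m t)\<^sup>2) * (\<rho> t * L t)) + (\<rho> t * (L t)\<^sup>2 - m t * N t) * (1 / m t) = - N t"
    using nz unfolding m_def by (simp add: field_simps power2_eq_square)
qed

lemma h_const:
  assumes "\<And>t. a \<le> t \<Longrightarrow> t \<le> b \<Longrightarrow> N t \<noteq> 0" "a \<le> x" "x \<le> b" "a \<le> y" "y \<le> b"
  shows "h x = h y"
proof -
  have "primitive_on a b h (\<lambda>t. 0)"
  proof (rule primitive_on_cong[OF primitive_on_mult[OF mh_prim primitive_on_inverse[OF m_prim]]])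
    fix t assume "a \<le> t" "t \<le> b"
    then have nz: "N t \<noteq> 0" "\<rho> t \<noteq> 0" using assms bounds(3)[of t] by auto
    then show "m t \<noteq> 0" unfolding m_def by simp
    show "m t * h t * (1 / m t) = h t" using nz unfolding m_def by simp
    show "m t * h t * (- (1 / (m t)\<^sup>2) * (\<rho> t * L t)) + \<rho> t * L t * h t * (1 / m t) = 0"
      using nz unfolding m_def by (simp add: field_simps power2_eq_square)
  qed
  then show ?thesis by (rule primitive_on_zero) (use assms in auto)
qed

lemma L2_N2: "(L t)\<^sup>2 + (N t)\<^sup>2 = (u t)\<^sup>2 + (v t)\<^sup>2"
proof -
  have "(x * c + y * s)\<^sup>2 + (x * s - y * c)\<^sup>2 = x\<^sup>2 * (s\<^sup>2 + c\<^sup>2) + y\<^sup>2 * (s\<^sup>2 + c\<^sup>2)"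
    for x y s c :: real by (simp add: power2_eq_square algebra_simps)
  then have "(L t)\<^sup>2 + (N t)\<^sup>2 = (u t)\<^sup>2 * ((sin t)\<^sup>2 + (cos t)\<^sup>2) + (v t)\<^sup>2 * ((sin t)\<^sup>2 + (cos t)\<^sup>2)"
    unfolding L_def N_def .
  then show ?thesis by simp
qed

lemma h_eq: "h t = ((L t)\<^sup>2 + (N t)\<^sup>2) / 2 + \<gamma> / (\<gamma> - 1) * (p t / \<rho> t)"
proof -
  have "total_energy (U t) = \<rho> t * (((u t)\<^sup>2 + (v t)\<^sup>2) / 2) + p t / (\<gamma> - 1)"
    unfolding p_def pressure_def internal_energy_def u_def v_def \<rho>_def[symmetric]
    using bounds(3)[of t] \<gamma> by (simp add: field_simps)
  moreover have "\<gamma> / (\<gamma> - 1) = 1 / (\<gamma> - 1) + 1" using \<gamma> by (simp add: field_simps)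
  ultimately show ?thesis
    unfolding h_def L2_N2 using bounds(3)[of t] \<gamma> by (simp add: add_divide_distrib distrib_right)
qed

text \<open>Near a bounding ray the flux \<open>m\<close> is small while the pressure is bounded below. The second
  conclusion says that the flow is subsonic there.\<close>

lemma small_near_zero_of_m:
  assumes "m c = 0"
  shows "(N \<longlongrightarrow> 0) (at c)" and "\<forall>\<^sub>F t in at c. \<gamma> * P t > (\<gamma> + 1) * (m t * N t)"
proof -
  have "isCont m c"
    using primitive_on_continuous[OF m_prim[of "c - 1" "c + 1"]]
    by (rule continuous_on_interior) (simp add: interior_atLeastAtMost_real)
  then have m0: "(m \<longlongrightarrow> 0) (at c)" using assms by (simp add: isCont_def)
  have N_le: "\<bar>N t\<bar> \<le> K * \<bar>m t\<bar>" for t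
  proof -
    have "1 \<le> K * \<rho> t" using bounds(1)[of t] K by (simp add: field_simps)
    then have "\<bar>N t\<bar> * 1 \<le> \<bar>N t\<bar> * (K * \<rho> t)" by (intro mult_left_mono) auto
    then show ?thesis unfolding m_def abs_mult using bounds(3)[of t] by (simp add: mult.commute mult.left_commute)
  qed
  have Km: "((\<lambda>t. K * \<bar>m t\<bar>) \<longlongrightarrow> 0) (at c)"
    using tendsto_mult_right_zero[OF tendsto_rabs_zero[OF m0]] .
  show N0: "(N \<longlongrightarrow> 0) (at c)"
    by (rule Lim_null_comparison[OF _ Km]) (use N_le in auto)
  define p0 where "p0 = (\<gamma> - 1) * (inverse K * inverse K)"
  have p0: "p0 > 0" "\<And>t. p0 \<le> p t" unfolding p0_def using bounds(7) \<gamma> K by auto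
  have "((\<lambda>t. m t * N t) \<longlongrightarrow> 0) (at c)" using tendsto_mult_zero[OF m0 N0] .
  then have "\<forall>\<^sub>F t in at c. m t * N t < p0" using p0(1) by (rule order_tendstoD(2))
  then show "\<forall>\<^sub>F t in at c. \<gamma> * P t > (\<gamma> + 1) * (m t * N t)"
  proof eventually_elim
    case (elim t)
    have "m t * N t < \<gamma> * p t"
    proof -
      have "p t \<le> \<gamma> * p t" using \<gamma> p_pos[of t] by simp
      then show ?thesis using elim p0(2)[of t] by linarith
    qed
    then show ?case unfolding P_def by (simp add: algebra_simps)
  qed
qed

text \<open>For \<open>N < 0\<close> the fluid crosses the rays in the direction of increasing angles, so the angle itself is the
  parameter of the locale. The constant of Bernoulli's law is read off at the middle of the interval.\<close>

lemma fluid_sector_of_solution: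
  assumes "a < b" and neg: "\<And>t. a < t \<Longrightarrow> t < b \<Longrightarrow> N t < 0" and ends: "N a = 0" "N b = 0"
  shows "fluid_sector \<gamma> (h ((a + b) / 2)) a b L (\<lambda>t. - N t) (\<lambda>t. - m t) P"
proof
  define B where "B t = \<gamma> / (\<gamma> + 1) * (P t / - m t)" for t
  have \<rho>: "\<rho> t > 0" for t by (rule bounds)
  have m_neg: "m t < 0" if "a < t" "t < b" for t
    unfolding m_def using neg[OF that] \<rho>[of t] by (simp add: mult_pos_neg)
  have nz: "N t \<noteq> 0" if "a < x" "y < b" "x \<le> t" "t \<le> y" for x y t
    using neg[of t] that by simp
  have B_eq: "B t * - N t = \<gamma> / (\<gamma> + 1) * ((N t)\<^sup>2 + p t / \<rho> t)" if "a < t" "t < b" for t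
  proof -
    have "P t / - m t * - N t = (N t)\<^sup>2 + p t / \<rho> t"
      unfolding P_def m_def using neg[OF that] \<rho>[of t] by (simp add: field_simps power2_eq_square)
    then show ?thesis unfolding B_def by (simp only: mult.assoc)
  qed
  have bern: "(- N t)\<^sup>2 - 2 * B t * - N t + (\<gamma> - 1) / (\<gamma> + 1) * (2 * h ((a + b) / 2) - (L t)\<^sup>2) = 0"
    if t: "a < t" "t < b" for t
  proof -
    have "h ((a + b) / 2) = h t"
    proof (rule h_const[OF _ min.cobounded2 max.cobounded2 min.cobounded1 max.cobounded1])
      show "N r \<noteq> 0" if "min t ((a + b) / 2) \<le> r" "r \<le> max t ((a + b) / 2)" for r
        by (rule nz[OF _ _ that]) (use t \<open>a < b\<close> in auto)
    qed
    then have H: "2 * h ((a + b) / 2) - (L t)\<^sup>2 = (N t)\<^sup>2 + 2 * \<gamma> / (\<gamma> - 1) * (p t / \<rho> t)"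
      unfolding h_eq by (simp add: add_divide_distrib)
    have "(\<gamma> - 1) / (\<gamma> + 1) * ((N t)\<^sup>2 + 2 * \<gamma> / (\<gamma> - 1) * (p t / \<rho> t))
        = (\<gamma> - 1) / (\<gamma> + 1) * (N t)\<^sup>2 + 2 * (\<gamma> / (\<gamma> + 1)) * (p t / \<rho> t)"
      using \<gamma> by (simp add: distrib_left)
    moreover have "(\<gamma> - 1) / (\<gamma> + 1) = 2 * (\<gamma> / (\<gamma> + 1)) - 1"
      using \<gamma> by (simp add: field_simps)
    ultimately have "(\<gamma> - 1) / (\<gamma> + 1) * (2 * h ((a + b) / 2) - (L t)\<^sup>2)
        = (2 * (\<gamma> / (\<gamma> + 1)) - 1) * (N t)\<^sup>2 + 2 * (\<gamma> / (\<gamma> + 1)) * (p t / \<rho> t)"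
      unfolding H by simp
    moreover have "2 * B t * - N t = 2 * (\<gamma> / (\<gamma> + 1)) * (N t)\<^sup>2 + 2 * (\<gamma> / (\<gamma> + 1)) * (p t / \<rho> t)"
    proof -
      have "2 * B t * - N t = 2 * (B t * - N t)" by simp
      then show ?thesis unfolding B_eq[OF t] by (simp only: distrib_left mult.assoc)
    qed
    ultimately show ?thesis by (simp add: left_diff_distrib)
  qed
  show "1 < \<gamma>" by (rule \<gamma>)
  show "a < b" by fact
  show "0 < - N t" if "a < t" "t < b" for t using neg[OF that] by simp
  show "0 < - m t" if "a < t" "t < b" for t using m_neg[OF that] by simp
  show L: "primitive_on x y L (\<lambda>t. - N t)" if "a < x" "y < b" for x y
    by (rule L_prim) (use nz that in auto)
  show "primitive_on x y (\<lambda>t. - m t) (\<lambda>t. - (- m t * L t / - N t))" if "a < x" "y < b" for x y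
  proof (rule primitive_on_cong[OF primitive_on_cmult[OF m_prim, where c = "- 1"]])
    fix t assume "x \<le> t" "t \<le> y"
    then have "N t \<noteq> 0" using nz that by auto
    then show "- 1 * (\<rho> t * L t) = - (- m t * L t / - N t)" unfolding m_def by simp
  qed simp
  show "primitive_on x y P (\<lambda>t. - (2 * - m t * L t))" for x y
    by (rule primitive_on_cong[OF P_prim]) simp_all
  show "(- N t)\<^sup>2 - 2 * (\<gamma> / (\<gamma> + 1) * (P t / - m t)) * - N t
      + (\<gamma> - 1) / (\<gamma> + 1) * (2 * h ((a + b) / 2) - (L t)\<^sup>2) = 0" if "a < t" "t < b" for t
    using bern[OF that] unfolding B_def .
  show "- m t * - N t < P t" if "a < t" "t < b" for t
    unfolding P_def using p_pos[of t] by simp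
  have sub: "- N t < \<gamma> / (\<gamma> + 1) * (P t / - m t)"
    if t: "a < t" "t < b" and le: "(\<gamma> + 1) * (m t * N t) < \<gamma> * P t" for t
  proof -
    have "- N t * ((\<gamma> + 1) * - m t) < \<gamma> * P t" using le by (simp add: algebra_simps)
    then have "- N t < \<gamma> * P t / ((\<gamma> + 1) * - m t)"
      using m_neg[OF t] \<gamma> by (subst pos_less_divide_eq) (auto intro: mult_pos_neg)
    then show ?thesis by simp
  qed
  have ma: "m a = 0" and mb: "m b = 0" unfolding m_def ends by simp_all
  show "((\<lambda>t. - N t) \<longlongrightarrow> 0) (at_right a)" "((\<lambda>t. - N t) \<longlongrightarrow> 0) (at_left b)"
    using tendsto_minus[OF small_near_zero_of_m(1)[OF ma]] tendsto_minus[OF small_near_zero_of_m(1)[OF mb]]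
    by (auto elim: tendsto_within_subset)
  have "\<forall>\<^sub>F t in at_right a. (\<gamma> + 1) * (m t * N t) < \<gamma> * P t"
    using small_near_zero_of_m(2)[OF ma] by (rule filter_leD[OF at_le[OF subset_UNIV]])
  moreover have "\<forall>\<^sub>F t in at_right a. a < t \<and> t < b"
    unfolding eventually_at_right[OF \<open>a < b\<close>] using \<open>a < b\<close> by auto
  ultimately show "\<forall>\<^sub>F t in at_right a. - N t < \<gamma> / (\<gamma> + 1) * (P t / - m t)"
    by eventually_elim (rule sub; blast)
  have "\<forall>\<^sub>F t in at_left b. (\<gamma> + 1) * (m t * N t) < \<gamma> * P t"
    using small_near_zero_of_m(2)[OF mb] by (rule filter_leD[OF at_le[OF subset_UNIV]])
  moreover have "\<forall>\<^sub>F t in at_left b. a < t \<and> t < b"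
    unfolding eventually_at_left[OF \<open>a < b\<close>] using \<open>a < b\<close> by auto
  ultimately show "\<forall>\<^sub>F t in at_left b. - N t < \<gamma> / (\<gamma> + 1) * (P t / - m t)"
    by eventually_elim (rule sub; blast)
  fix t assume t: "a < t" "t < b" and ne: "- N t \<noteq> \<gamma> / (\<gamma> + 1) * (P t / - m t)"
  obtain C1 where C1: "\<And>t. \<bar>\<rho> t * L t * S t\<bar> \<le> C1"
    using bounded_measurable_mult[OF bounded_measurable_mult[OF bounded_measurable_quantities(1)
          bounded_measurable_LN(1)] bounded_measurable_quantities(6)]
    unfolding bounded_measurable_def by blast
  obtain C2 where C2: "\<And>t. \<bar>\<rho> t * L t\<bar> \<le> C2"
    using bounded_measurable_mult[OF bounded_measurable_quantities(1) bounded_measurable_LN(1)]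
    unfolding bounded_measurable_def by blast
  have C0: "0 \<le> C1" "0 \<le> C2" using C1[of 0] C2[of 0] by linarith+
  have prod: "m y * S y - m x * S x \<le> C1 * (y - x)" if "x < y" for x y
  proof -
    have int: "(\<lambda>t. \<rho> t * L t * S t) integrable_on {x..y}"
      by (intro bounded_measurable_integrable bounded_measurable_mult
          bounded_measurable_quantities bounded_measurable_LN)
    have "\<bar>integral {x..y} (\<lambda>t. \<rho> t * L t * S t)\<bar> \<le> C1 * (y - x)"
      using has_integral_bound_real[OF C0(1) finite.emptyI integrable_integral[OF int]] C1 that by auto
    then show ?thesis using entropy_production[OF that] by linarith
  qed
  have mlip: "\<bar>m y - m x\<bar> \<le> C2 * (y - x)" if "x < y" for x y
    using has_integral_bound_real[OF C0(2) finite.emptyI primitive_onD[OF m_prim[of x y] order_refl _ order_refl]] C2 that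
    by auto
  define C where "C = (C1 + \<bar>s0\<bar> * C2) / cv"
  have cont: "isCont m t" "isCont P t" "isCont L t"
  proof -
    show "isCont m t" "isCont P t"
      using primitive_on_continuous[OF m_prim[of "t - 1" "t + 1"]] primitive_on_continuous[OF P_prim[of "t - 1" "t + 1"]]
      by (auto elim!: continuous_on_interior simp: interior_atLeastAtMost_real)
    have "continuous_on {(a + t) / 2..(t + b) / 2} L"
      by (rule primitive_on_continuous[OF L]) (use t in auto)
    then show "isCont L t"
      by (rule continuous_on_interior) (use t in \<open>simp add: interior_atLeastAtMost_real\<close>)
  qed
  define D where "D s = (B s)\<^sup>2 - (\<gamma> - 1) / (\<gamma> + 1) * (2 * h ((a + b) / 2) - (L s)\<^sup>2)" for s
  show "\<exists>\<epsilon>>0. \<forall>x y. a < x \<longrightarrow> t - \<epsilon> < x \<longrightarrow> x < y \<longrightarrow> y < t + \<epsilon> \<longrightarrow> y < b \<longrightarrow>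
      - N x < \<gamma> / (\<gamma> + 1) * (P x / - m x) \<longrightarrow> - N y \<le> \<gamma> / (\<gamma> + 1) * (P y / - m y)"
  proof (rule no_expansion_shock[where n = "\<lambda>t. - N t" and M = "\<lambda>t. - m t" and P = P and D = D and C = C, OF \<gamma> t ne])
    show "0 < (\<gamma> - 1) * (inverse K * inverse K)" using \<gamma> K by simp
    show "isCont (\<lambda>t. - m t) t" "isCont P t" using cont by (auto intro: continuous_intros)
    have "isCont B t" unfolding B_def using m_neg[OF t] by (intro continuous_intros cont) auto
    then show "isCont D t" unfolding D_def by (intro continuous_intros cont)
    show "0 < - m s \<and> 0 < - N s \<and> (\<gamma> - 1) * (inverse K * inverse K) \<le> P s - - m s * - N s"
      if "a < s" "s < b" for s
      using m_neg[OF that] neg[OF that] bounds(7)[of s] unfolding P_def by simp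
    show "D s = (- N s - \<gamma> / (\<gamma> + 1) * (P s / - m s))\<^sup>2" if "a < s" "s < b" for s
    proof -
      have "(- N s - B s)\<^sup>2 = (- N s)\<^sup>2 - 2 * B s * - N s + (B s)\<^sup>2"
        by (simp add: power2_eq_square algebra_simps)
      then show ?thesis using bern[OF that] unfolding D_def B_def[symmetric] by linarith
    qed
    fix x y assume xy: "a < x" "x < y" "y < b"
    have \<sigma>: "ln (P s - - m s * - N s) - \<gamma> * ln (- m s / - N s) = (S s - s0) / cv" if "a < s" "s < b" for s
    proof -
      have "- m s / - N s = \<rho> s" unfolding m_def using neg[OF that] by simp
      moreover have "P s - - m s * - N s = p s" unfolding P_def by simp
      ultimately show ?thesis unfolding S_eq using cv by simp
    qed
    have "- m x * ((S x - s0) / cv) - - m y * ((S y - s0) / cv)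
        = ((m y * S y - m x * S x) - s0 * (m y - m x)) / cv"
      by (simp add: algebra_simps diff_divide_distrib add_divide_distrib)
    also have "\<dots> \<le> (C1 * (y - x) + \<bar>s0\<bar> * (C2 * (y - x))) / cv"
    proof (rule divide_right_mono)
      have "- (s0 * (m y - m x)) \<le> \<bar>s0\<bar> * (C2 * (y - x))"
      proof -
        have "\<bar>s0 * (m y - m x)\<bar> \<le> \<bar>s0\<bar> * (C2 * (y - x))"
          unfolding abs_mult using mlip[OF xy(2)] by (rule mult_left_mono) simp
        then show ?thesis by linarith
      qed
      then show "m y * S y - m x * S x - s0 * (m y - m x) \<le> C1 * (y - x) + \<bar>s0\<bar> * (C2 * (y - x))"
        using prod[OF xy(2)] by linarith
    qed (use cv in simp)
    also have "\<dots> = C * (y - x)" unfolding C_def by (simp add: algebra_simps)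
    finally show "- m x * (ln (P x - - m x * - N x) - \<gamma> * ln (- m x / - N x))
        - - m y * (ln (P y - - m y * - N y) - \<gamma> * ln (- m y / - N y)) \<le> C * (y - x)"
      using \<sigma>[of x] \<sigma>[of y] xy by simp
  qed
qed

lemma anticlockwise_sector_angle:
  assumes "a < b" "\<And>t. a < t \<Longrightarrow> t < b \<Longrightarrow> N t < 0" "N a = 0" "N b = 0"
  shows "pi - arcsin (1 / \<gamma>) \<le> b - a"
  using fluid_sector.sector_angle[OF fluid_sector_of_solution[OF assms]] by simp

end

section \<open>The number of sectors\<close>

definition reflect_state :: "state \<Rightarrow> state"
  where "reflect_state w = (\<chi> i. if i = 3 then - (w $ i) else w $ i)"

definition reflect_flow :: "(real \<Rightarrow> state) \<Rightarrow> real \<Rightarrow> state"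
  where "reflect_flow U t = reflect_state (U (- t))"

lemma reflect_state_nth [simp]:
  "reflect_state w $ 1 = w $ 1" "reflect_state w $ 2 = w $ 2"
  "reflect_state w $ 3 = - (w $ 3)" "reflect_state w $ 4 = w $ 4"
  unfolding reflect_state_def by simp_all

lemma bounded_linear_reflect_state: "bounded_linear reflect_state"
  unfolding linear_conv_bounded_linear[symmetric]
  by (rule linearI) (auto simp: reflect_state_def vec_eq_iff)

lemma norm_reflect_state: "norm (reflect_state w) = norm w"
  unfolding norm_vec_def by (rule L2_set_cong) (auto simp: reflect_state_def)

lemma reflect_state_simps [simp]:
  "density (reflect_state w) = density w" "vel_x (reflect_state w) = vel_x w"
  "vel_y (reflect_state w) = - vel_y w" "total_energy (reflect_state w) = total_energy w"
  "internal_energy (reflect_state w) = internal_energy w"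
  "pressure \<gamma> (reflect_state w) = pressure \<gamma> w"
  "entropy \<gamma> cv s0 (reflect_state w) = entropy \<gamma> cv s0 w"
  by (simp_all add: density_def vel_x_def vel_y_def total_energy_def internal_energy_def
      pressure_def entropy_def)

lemma flux_reflect_state:
  "flux_x \<gamma> (reflect_state w) = reflect_state (flux_x \<gamma> w)"
  "flux_y \<gamma> (reflect_state w) = - reflect_state (flux_y \<gamma> w)"
  by (simp_all add: vec_eq_iff forall_4)

lemma has_integral_positive_neq_zero:
  fixes f :: "real \<Rightarrow> real"
  assumes "c < d" "\<And>t. t \<in> {c..d} \<Longrightarrow> f t > 0"
  shows "\<not> (f has_integral 0) {c..d}"
proof
  assume f: "(f has_integral 0) {c..d}"
  have "f absolutely_integrable_on {c..d}"
    by (rule nonnegative_absolutely_integrable_1) (use f assms(2) in \<open>auto intro: less_imp_le\<close>)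
  then have int: "integrable (lebesgue_on {c..d}) f"
    by (intro absolutely_integrable_imp_integrable) auto
  have "integral\<^sup>L (lebesgue_on {c..d}) f = 0"
    using lebesgue_integral_eq_integral[OF int] integral_unique[OF f] by simp
  moreover have "AE t in lebesgue_on {c..d}. 0 \<le> f t"
    by (rule AE_I2) (use assms(2) in \<open>simp add: less_imp_le\<close>)
  ultimately have "AE t in lebesgue_on {c..d}. f t = 0"
    using integral_nonneg_eq_0_iff_AE[OF int] by blast
  moreover have "{t \<in> space (lebesgue_on {c..d}). f t \<noteq> 0} = {c..d}"
  proof -
    have "f t \<noteq> 0" if "t \<in> {c..d}" for t using assms(2)[OF that] by simp
    then show ?thesis by auto
  qed
  ultimately have "emeasure (lebesgue_on {c..d}) {c..d} = 0"
    using AE_iff_measurable[of "{c..d}" "lebesgue_on {c..d}" "\<lambda>t. f t = 0"] by simp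
  then show False using assms(1) by (simp add: emeasure_restrict_space)
qed

context nonstagnant_solution
begin

text \<open>Reflection reverses the sense of rotation, which reduces clockwise sectors to anticlockwise ones.\<close>

lemma reflect: "nonstagnant_solution \<gamma> cv s0 K (reflect_flow U)"
proof
  show "\<gamma> > 1" "cv > 0" "K > 1" using \<gamma> cv K by auto
  interpret R: bounded_linear reflect_state by (rule bounded_linear_reflect_state)
  show "no_stagnation_points (reflect_flow U)"
    using nonstagnant unfolding no_stagnation_points_def reflect_flow_def by simp
  show "entropy_solution \<gamma> cv s0 K (reflect_flow U)"
    unfolding entropy_solution_def
  proof (intro conjI allI impI)
    have "(\<lambda>t. U ((- 1) *\<^sub>R t)) \<in> borel_measurable lebesgue"
      by (rule measurable_compose[OF lebesgue_measurable_scaling])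
        (use sol in \<open>simp add: entropy_solution_def\<close>)
    then have "(\<lambda>t. U (- t)) \<in> borel_measurable lebesgue" by simp
    moreover have "reflect_state \<in> borel_measurable borel"
      by (intro borel_measurable_continuous_onI linear_continuous_on bounded_linear_reflect_state)
    ultimately show "reflect_flow U \<in> borel_measurable lebesgue"
      unfolding reflect_flow_def[abs_def] by (rule measurable_compose)
    fix \<theta> :: real
    have per: "U (t + 2 * pi) = U t" for t using sol unfolding entropy_solution_def by blast
    have "U (- (\<theta> + 2 * pi)) = U (- \<theta>)"
      using per[of "- (\<theta> + 2 * pi)"] by simp
    then show "reflect_flow U (\<theta> + 2 * pi) = reflect_flow U \<theta>" unfolding reflect_flow_def by simp
    show "reflect_flow U \<theta> \<in> phase_space K"
      using sol unfolding entropy_solution_def phase_space_def reflect_flow_def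
      by (simp add: norm_reflect_state)
  next
    fix x y :: real assume xy: "x < y"
    define F where "F t = cos t *\<^sub>R flux_x \<gamma> (U t) + sin t *\<^sub>R flux_y \<gamma> (U t)" for t
    define J where "J t = sin t *\<^sub>R flux_x \<gamma> (U t) - cos t *\<^sub>R flux_y \<gamma> (U t)" for t
    have "J (- x) - J (- y) = integral {- y..- x} F"
    proof -
      have "- y < - x \<Longrightarrow> J (- x) - J (- y) = integral {- y..- x} F"
        using sol unfolding entropy_solution_def F_def[abs_def] J_def by blast
      then show ?thesis using xy by simp
    qed
    then have "reflect_state (J (- x)) - reflect_state (J (- y)) = reflect_state (integral {- y..- x} F)"
      by (simp flip: R.diff)
    also have "\<dots> = integral {- y..- x} (\<lambda>t. reflect_state (F t))"
      using integral_linear[OF flux_integrable bounded_linear_reflect_state, of "- y" "- x"]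
      unfolding F_def by (simp add: o_def)
    also have "\<dots> = integral {x..y} (\<lambda>t. reflect_state (F (- t)))"
      using Henstock_Kurzweil_Integration.integral_reflect_real[of y x "\<lambda>t. reflect_state (F (- t))"] by simp
    finally show "sin y *\<^sub>R flux_x \<gamma> (reflect_flow U y) - cos y *\<^sub>R flux_y \<gamma> (reflect_flow U y)
        - (sin x *\<^sub>R flux_x \<gamma> (reflect_flow U x) - cos x *\<^sub>R flux_y \<gamma> (reflect_flow U x))
      = integral {x..y} (\<lambda>t. cos t *\<^sub>R flux_x \<gamma> (reflect_flow U t) + sin t *\<^sub>R flux_y \<gamma> (reflect_flow U t))"
      unfolding J_def F_def reflect_flow_def flux_reflect_state
      by (simp add: R.diff R.add R.scaleR R.neg algebra_simps)
  next
    fix x y :: real assume xy: "x < y"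
    define F where "F t = cos t * entropy_flux_x \<gamma> cv s0 (U t) + sin t * entropy_flux_y \<gamma> cv s0 (U t)" for t
    have "integral {- y..- x} F = integral {x..y} (\<lambda>t. F (- t))"
      using Henstock_Kurzweil_Integration.integral_reflect_real[of y x "\<lambda>t. F (- t)"] by simp
    moreover have "(sin (- x) * entropy_flux_x \<gamma> cv s0 (U (- x)) - cos (- x) * entropy_flux_y \<gamma> cv s0 (U (- x)))
        - (sin (- y) * entropy_flux_x \<gamma> cv s0 (U (- y)) - cos (- y) * entropy_flux_y \<gamma> cv s0 (U (- y)))
      \<le> integral {- y..- x} F"
    proof -
      have "- y < - x" using xy by simp
      then show ?thesis using sol unfolding entropy_solution_def F_def[abs_def] by blast
    qed
    ultimately show "sin y * entropy_flux_x \<gamma> cv s0 (reflect_flow U y) - cos y * entropy_flux_y \<gamma> cv s0 (reflect_flow U y)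
        - (sin x * entropy_flux_x \<gamma> cv s0 (reflect_flow U x) - cos x * entropy_flux_y \<gamma> cv s0 (reflect_flow U x))
      \<le> integral {x..y} (\<lambda>t. cos t * entropy_flux_x \<gamma> cv s0 (reflect_flow U t)
          + sin t * entropy_flux_y \<gamma> cv s0 (reflect_flow U t))"
      unfolding F_def reflect_flow_def entropy_flux_x_def entropy_flux_y_def
      by (simp add: algebra_simps)
  qed
qed

lemma N_zero_iff: "N t = 0 \<longleftrightarrow> m t = 0"
  unfolding m_def using bounds(3)[of t] by simp

lemma m_continuous: "continuous_on {x..y} m"
  by (rule primitive_on_continuous[OF m_prim])

lemma sector_angle:
  assumes "a < b" and nz: "\<And>t. a < t \<Longrightarrow> t < b \<Longrightarrow> N t \<noteq> 0" and ends: "N a = 0" "N b = 0"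
  shows "pi - arcsin (1 / \<gamma>) \<le> b - a"
proof -
  have \<rho>: "\<rho> t > 0" for t by (rule bounds)
  have same: "\<not> (N s < 0 \<and> N t > 0)" "\<not> (N s > 0 \<and> N t < 0)" if st: "a < s" "s \<le> t" "t < b" for s t
  proof -
    show "\<not> (N s < 0 \<and> N t > 0)"
    proof
      assume *: "N s < 0 \<and> N t > 0"
      then have "m s \<le> 0" "0 \<le> m t"
        unfolding m_def using \<rho>[of s] \<rho>[of t] by (auto simp: mult_nonneg_nonpos)
      then obtain r where "s \<le> r" "r \<le> t" "m r = 0"
        using IVT'[of m s 0 t] st(2) m_continuous[of s t] by auto
      then show False using nz[of r] N_zero_iff[of r] st by simp
    qed
    show "\<not> (N s > 0 \<and> N t < 0)"
    proof
      assume *: "N s > 0 \<and> N t < 0"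
      then have "m t \<le> 0" "0 \<le> m s"
        unfolding m_def using \<rho>[of s] \<rho>[of t] by (auto simp: mult_nonneg_nonpos)
      then obtain r where "s \<le> r" "r \<le> t" "m r = 0"
        using IVT2'[of m t 0 s] st(2) m_continuous[of s t] by auto
      then show False using nz[of r] N_zero_iff[of r] st by simp
    qed
  qed
  define c where "c = (a + b) / 2"
  have c: "a < c" "c < b" using \<open>a < b\<close> unfolding c_def by auto
  show ?thesis
  proof (cases "N c < 0")
    case True
    have "N t < 0" if "a < t" "t < b" for t
    proof (cases "t \<le> c")
      case F: True
      show ?thesis using same(2)[OF that(1) F c(2)] nz[OF that] True by linarith
    next
      case False
      then have "c \<le> t" by simp
      from same(1)[OF c(1) this that(2)] show ?thesis using nz[OF that] True by linarith
    qed
    then show ?thesis by (rule anticlockwise_sector_angle[OF \<open>a < b\<close> _ ends])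
  next
    case False
    then have "N c > 0" using nz[of c] c by simp
    then have pos: "N t > 0" if "a < t" "t < b" for t
    proof (cases "t \<le> c")
      case F: True
      show ?thesis using same(1)[OF that(1) F c(2)] nz[OF that] \<open>N c > 0\<close> by linarith
    next
      case False
      then have "c \<le> t" by simp
      from same(2)[OF c(1) this that(2)] show ?thesis using nz[OF that] \<open>N c > 0\<close> by linarith
    qed
    interpret R: nonstagnant_solution \<gamma> cv s0 K "reflect_flow U" by (rule reflect)
    have RN: "R.N t = - N (- t)" for t
      unfolding R.N_eq N_eq unfolding normal_vel_def reflect_flow_def by simp
    have "pi - arcsin (1 / \<gamma>) \<le> - a - - b"
      by (rule R.anticlockwise_sector_angle) (use \<open>a < b\<close> pos ends in \<open>auto simp: RN\<close>)
    then show ?thesis by simp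
  qed
qed

text \<open>Where \<open>N\<close> vanishes, \<open>L\<close> does not; hence the flux \<open>m * L\<close> of radial momentum grows
  strictly along an interval of zeros.\<close>

lemma no_interval_of_zeros:
  assumes "x < y"
  shows "\<exists>t. x < t \<and> t < y \<and> N t \<noteq> 0"
proof (rule ccontr)
  assume "\<not> ?thesis"
  then have zero: "N t = 0" if "x < t" "t < y" for t using that by blast
  define c d where "c = (2 * x + y) / 3" and "d = (x + 2 * y) / 3"
  have cd: "x < c" "c < d" "d < y" using assms unfolding c_def d_def by auto
  have L: "L t \<noteq> 0" if "x < t" "t < y" for t
  proof
    assume "L t = 0"
    then have "(u t)\<^sup>2 + (v t)\<^sup>2 = 0"
      using zero[OF that] L2_N2[of t] by simp
    then show False
      using nonstagnant[unfolded no_stagnation_points_def, rule_format, of t]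
      unfolding u_def v_def by (simp add: sum_power2_eq_zero_iff)
  qed
  have "((\<lambda>t. \<rho> t * (L t)\<^sup>2 - m t * N t) has_integral m d * L d - m c * L c) {c..d}"
    using primitive_onD[OF mL_prim[of c d]] cd by simp
  moreover have "m c = 0" "m d = 0" unfolding m_def using zero[of c] zero[of d] cd by simp_all
  ultimately have "((\<lambda>t. \<rho> t * (L t)\<^sup>2 - m t * N t) has_integral 0) {c..d}" by simp
  then have zero_int: "((\<lambda>t. \<rho> t * (L t)\<^sup>2) has_integral 0) {c..d}"
  proof (rule has_integral_eq[rotated])
    fix t assume "t \<in> {c..d}"
    then have "N t = 0" by (intro zero) (use cd in auto)
    then show "\<rho> t * (L t)\<^sup>2 - m t * N t = \<rho> t * (L t)\<^sup>2" by simp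
  qed
  have pos: "\<rho> t * (L t)\<^sup>2 > 0" if "t \<in> {c..d}" for t
    using L[of t] bounds(3)[of t] cd that by simp
  show False using has_integral_positive_neq_zero[OF cd(2), of "\<lambda>t. \<rho> t * (L t)\<^sup>2"] pos zero_int by blast
qed

text \<open>Between two zeros of \<open>N\<close> lies a component of the set where \<open>N \<noteq> 0\<close>. It is bounded by zeros because
  the zeros of \<open>N\<close> are those of the continuous function \<open>m\<close>.\<close>

lemma zeros_spaced:
  assumes "x < y" "N x = 0" "N y = 0"
  shows "pi - arcsin (1 / \<gamma>) \<le> y - x"
proof -
  obtain z where z: "x < z" "z < y" "N z \<noteq> 0" using no_interval_of_zeros[OF assms(1)] by blast
  have comp: "compact {t \<in> {c..d}. m t = 0}" for c d
  proof -
    have "closed {t \<in> {c..d}. m t = 0}"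
      by (intro continuous_closed_preimage_constant m_continuous) auto
    moreover have "bounded {t \<in> {c..d}. m t = 0}"
      by (rule bounded_subset[OF bounded_closed_interval, of _ c d]) auto
    ultimately show ?thesis by (simp add: compact_eq_bounded_closed)
  qed
  have "x \<in> {t \<in> {x..z}. m t = 0}" using assms z N_zero_iff by auto
  then obtain a where a: "a \<in> {t \<in> {x..z}. m t = 0}" "\<forall>t\<in>{t \<in> {x..z}. m t = 0}. t \<le> a"
    using compact_attains_sup[OF comp, of x z] by blast
  have "y \<in> {t \<in> {z..y}. m t = 0}" using assms z N_zero_iff by auto
  then obtain b where b: "b \<in> {t \<in> {z..y}. m t = 0}" "\<forall>t\<in>{t \<in> {z..y}. m t = 0}. b \<le> t"
    using compact_attains_inf[OF comp, of z y] by blast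
  have ab: "a < z" "z < b" "N a = 0" "N b = 0"
    using a(1) b(1) z(3) N_zero_iff[of a] N_zero_iff[of b] by (auto simp: less_le)
  have "N t \<noteq> 0" if "a < t" "t < b" for t
  proof
    assume "N t = 0"
    then have mt: "m t = 0" using N_zero_iff by blast
    show False
    proof (cases "t \<le> z")
      case True
      moreover have "x \<le> t" using a(1) that by simp
      ultimately show False using a(2) mt that(1) by force
    next
      case False
      moreover have "t \<le> y" using b(1) that by simp
      moreover have "z \<le> t" using False by simp
      ultimately show False using b(2) mt that(2) by force
    qed
  qed
  then have "pi - arcsin (1 / \<gamma>) \<le> b - a" using ab by (intro sector_angle) auto
  then show ?thesis using a(1) b(1) by auto
qed

end

lemma spaced_diameter:
  fixes T :: "real set"
  assumes "finite T" "T \<noteq> {}" "\<And>x y. x \<in> T \<Longrightarrow> y \<in> T \<Longrightarrow> x < y \<Longrightarrow> \<delta> \<le> y - x"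
  shows "real (card T) * \<delta> \<le> Max T - Min T + \<delta>"
  using assms
proof (induction rule: finite_linorder_max_induct)
  case empty
  then show ?case by simp
next
  case (insert b A)
  show ?case
  proof (cases "A = {}")
    case True then show ?thesis by simp
  next
    case False
    have IH: "real (card A) * \<delta> \<le> Max A - Min A + \<delta>" using insert False by auto
    have "Max A \<in> A" using insert False by simp
    then have "\<delta> \<le> b - Max A" using insert by auto
    moreover have "Max (insert b A) = b"
      using insert.hyps by (intro Max_eqI) (auto intro: less_imp_le)
    moreover have "Min (insert b A) = Min A"
    proof (rule Min_eqI)
      show "Min A \<in> insert b A" using insert.hyps False by simp
      show "Min A \<le> y" if "y \<in> insert b A" for y
        using that insert.hyps False Min_in[of A] Min_le[of A y] by fastforce
    qed (use insert.hyps in simp)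
    moreover have "b \<notin> A" using insert by auto
    ultimately show ?thesis using IH insert by (simp add: distrib_right)
  qed
qed

lemma length_sectors: "length (sectors U) = card (sector_angles U)"
  if "finite (sector_angles U)"
proof -
  have "length (sorted_list_of_set (sector_angles U)) = card (sector_angles U)"
    using that by simp
  then show ?thesis
    unfolding sectors_def Let_def by (cases "sorted_list_of_set (sector_angles U)") auto
qed

lemma inverse_ge_minus_one: "1 < \<gamma> \<Longrightarrow> - 1 \<le> 1 / \<gamma>" for \<gamma> :: real
  by (rule order_trans[of _ 0]) auto

text \<open>The angle between the last zero and the first zero of the next period counts as well, so \<open>card T\<close>
  gaps fit into \<open>2 \<pi>\<close>.\<close>

lemma num_sectors_le:
  assumes "\<gamma> > 1" "cv > 0" "nonstagnant_flow \<gamma> cv s0 U"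
    and k: "2 * pi < real (Suc k) * (pi - arcsin (1 / \<gamma>))"
  shows "\<exists>m\<le>k. has_num_sectors U m"
proof -
  obtain K where flow: "K > 1" "entropy_solution \<gamma> cv s0 K U" "no_stagnation_points U"
    using assms unfolding nonstagnant_flow_def by blast
  from flow interpret nonstagnant_solution \<gamma> cv s0 K U using assms by unfold_locales auto
  define \<delta> where "\<delta> = pi - arcsin (1 / \<gamma>)"
  have le: "card T \<le> k" if T: "finite T" "T \<subseteq> sector_angles U" for T
  proof (cases "T = {}")
    case False
    have zero: "N t = 0" "0 \<le> t" "t < 2 * pi" if "t \<in> T" for t
      using that T unfolding sector_angles_def N_eq by auto
    have "Min T \<in> T" "Max T \<in> T" using T False by auto
    have "N (Min T + 2 * pi) = 0"
    proof -
      have "U (t + 2 * pi) = U t" for t using flow(2) unfolding entropy_solution_def by blast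
      then have "N (Min T + 2 * pi) = N (Min T)" unfolding N_eq normal_vel_def by simp
      then show ?thesis using zero(1)[OF \<open>Min T \<in> T\<close>] by simp
    qed
    moreover have "Max T < Min T + 2 * pi" using zero \<open>Min T \<in> T\<close> \<open>Max T \<in> T\<close> by force
    ultimately have "\<delta> \<le> Min T + 2 * pi - Max T"
      unfolding \<delta>_def using zero(1)[OF \<open>Max T \<in> T\<close>] by (intro zeros_spaced) auto
    moreover have "real (card T) * \<delta> \<le> Max T - Min T + \<delta>"
      by (rule spaced_diameter[OF T(1) False]) (use zero zeros_spaced in \<open>auto simp: \<delta>_def\<close>)
    ultimately have "real (card T) * \<delta> < real (Suc k) * \<delta>" using k unfolding \<delta>_def by simp
    moreover have "\<delta> > 0"
    proof -
      have "arcsin (1 / \<gamma>) \<le> pi / 2"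
        using inverse_ge_minus_one[OF assms(1)] assms(1) by (intro arcsin_ubound) auto
      then show ?thesis unfolding \<delta>_def using pi_gt_zero by linarith
    qed
    ultimately show ?thesis by simp
  qed simp
  have "finite (sector_angles U)"
  proof (rule ccontr)
    assume "infinite (sector_angles U)"
    then obtain T where "T \<subseteq> sector_angles U" "finite T" "card T = Suc k"
      using infinite_arbitrarily_large by blast
    then show False using le[of T] by simp
  qed
  then show ?thesis
    unfolding has_num_sectors_def using le[of "sector_angles U"] length_sectors by auto
qed

lemma at_most_three_sectors:
  assumes "\<gamma> > 1" "cv > 0" "nonstagnant_flow \<gamma> cv s0 U"
  shows "\<exists>m\<le>3. has_num_sectors U m"
proof (rule num_sectors_le[OF assms])
  have "arcsin (1 / \<gamma>) < pi / 2"
    using arcsin_less_arcsin[of "1 / \<gamma>" 1] inverse_ge_minus_one[OF assms(1)] assms(1) by simp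
  then show "2 * pi < real (Suc 3) * (pi - arcsin (1 / \<gamma>))" by simp
qed

text \<open>For \<open>\<gamma> = 7 / 5\<close> a sector is larger than \<open>2 \<pi> / 3\<close>, as
  \<open>5 / 7 < sqrt 3 / 2 = sin (\<pi> / 3)\<close>.\<close>

lemma at_most_two_sectors:
  assumes "cv > 0" "nonstagnant_flow (7 / 5) cv s0 U"
  shows "\<exists>m\<le>2. has_num_sectors U m"
proof (rule num_sectors_le[OF _ assms])
  have "(10 / 7)\<^sup>2 < (3 :: real)" by (simp add: power2_eq_square)
  then have "10 / 7 < sqrt 3" by (rule real_less_rsqrt)
  then have "arcsin (5 / 7) < arcsin (sqrt 3 / 2)"
    using real_sqrt_le_mono[of 3 4] by (intro arcsin_less_arcsin) auto
  also have "arcsin (sqrt 3 / 2) = pi / 3"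
    using arcsin_sin[of "pi / 3"] pi_gt_zero by (simp add: sin_60)
  finally show "2 * pi < real (Suc 2) * (pi - arcsin (1 / (7 / 5)))" by simp
qed simp

section \<open>Piecewise constant flows\<close>

definition normal_flux :: "real \<Rightarrow> state \<Rightarrow> real \<Rightarrow> state"
  where "normal_flux \<gamma> w \<theta> = sin \<theta> *\<^sub>R flux_x \<gamma> w - cos \<theta> *\<^sub>R flux_y \<gamma> w"

definition normal_entropy_flux :: "real \<Rightarrow> real \<Rightarrow> real \<Rightarrow> state \<Rightarrow> real \<Rightarrow> real"
  where "normal_entropy_flux \<gamma> cv s0 w \<theta> =
    sin \<theta> * entropy_flux_x \<gamma> cv s0 w - cos \<theta> * entropy_flux_y \<gamma> cv s0 w"

lemma rotating_flux_integral:
  fixes c d :: "'a :: banach"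
  assumes "a \<le> b"
  shows "((\<lambda>t. cos t *\<^sub>R c + sin t *\<^sub>R d) has_integral
    ((sin b *\<^sub>R c - cos b *\<^sub>R d) - (sin a *\<^sub>R c - cos a *\<^sub>R d))) {a..b}"
proof (rule fundamental_theorem_of_calculus[OF assms])
  fix t
  show "((\<lambda>t. sin t *\<^sub>R c - cos t *\<^sub>R d) has_vector_derivative cos t *\<^sub>R c + sin t *\<^sub>R d) (at t within {a..b})"
    by (auto intro!: derivative_eq_intros)
qed

text \<open>A flow that is locally constant on both sides of each ray only has to satisfy the jump
  conditions; the interval estimates are additive, so it suffices to have them on small
  intervals.\<close>

lemma locally_constant_entropy_solution:
  fixes U :: "real \<Rightarrow> state"
  assumes "U \<in> borel_measurable lebesgue" "\<And>\<theta>. U (\<theta> + 2 * pi) = U \<theta>" "\<And>\<theta>. U \<theta> \<in> phase_space K"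
    and loc: "\<And>x. \<exists>d>0. \<exists>w. (\<forall>t. x - d < t \<longrightarrow> t < x \<longrightarrow> U t = w) \<and> (\<forall>t. x \<le> t \<longrightarrow> t < x + d \<longrightarrow> U t = U x) \<and>
      normal_flux \<gamma> w x = normal_flux \<gamma> (U x) x \<and>
      normal_entropy_flux \<gamma> cv s0 (U x) x \<le> normal_entropy_flux \<gamma> cv s0 w x"
  shows "entropy_solution \<gamma> cv s0 K U"
proof -
  define Q where "Q x d w \<longleftrightarrow> (\<forall>t. x - d < t \<longrightarrow> t < x \<longrightarrow> U t = w) \<and>
      (\<forall>t. x \<le> t \<longrightarrow> t < x + d \<longrightarrow> U t = U x) \<and> normal_flux \<gamma> w x = normal_flux \<gamma> (U x) x \<and>
      normal_entropy_flux \<gamma> cv s0 (U x) x \<le> normal_entropy_flux \<gamma> cv s0 w x" for x d w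
  define F where "F t = cos t *\<^sub>R flux_x \<gamma> (U t) + sin t *\<^sub>R flux_y \<gamma> (U t)" for t
  define E where "E t = cos t * entropy_flux_x \<gamma> cv s0 (U t) + sin t * entropy_flux_y \<gamma> cv s0 (U t)" for t
  define J where "J t = normal_flux \<gamma> (U t) t" for t
  define H where "H t = normal_entropy_flux \<gamma> cv s0 (U t) t" for t
  define good where "good x y \<longleftrightarrow> (F has_integral J y - J x) {x..y} \<and>
    (\<exists>I. (E has_integral I) {x..y} \<and> H y - H x \<le> I)" for x y
  have const: "good x y" if "x \<le> y" "\<And>t. x \<le> t \<Longrightarrow> t < y \<Longrightarrow> U t = w"
      "J y = normal_flux \<gamma> w y" "H y \<le> normal_entropy_flux \<gamma> cv s0 w y" for x y w
  proof (cases "x = y")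
    case True
    then show ?thesis unfolding good_def by (auto intro!: exI[of _ 0])
  next
    case False
    then have "U x = w" using that by simp
    have 1: "(F has_integral normal_flux \<gamma> w y - normal_flux \<gamma> w x) {x..y}"
      unfolding normal_flux_def
      by (rule has_integral_spike_finite[OF _ _ rotating_flux_integral[OF that(1)], where S = "{y}"])
        (use that(2) in \<open>auto simp: F_def\<close>)
    have 2: "(E has_integral normal_entropy_flux \<gamma> cv s0 w y - normal_entropy_flux \<gamma> cv s0 w x) {x..y}"
      unfolding normal_entropy_flux_def
      by (rule has_integral_spike_finite[OF _ _ rotating_flux_integral[OF that(1), where 'a = real, unfolded real_scaleR_def],
            where S = "{y}"])
        (use that(2) in \<open>auto simp: E_def\<close>)
    show ?thesis
      unfolding good_def using 1 2 that(3,4) \<open>U x = w\<close> by (auto simp: J_def H_def)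
  qed
  have all: "x \<le> y \<longrightarrow> good x y" if "x \<le> y" for x y
    using that
  proof (induction rule: Bolzano[where P = "\<lambda>x y. x \<le> y \<longrightarrow> good x y"])
    case (trans x y z)
    then have g: "good x y" "good y z" by auto
    then obtain I1 I2 where I: "(E has_integral I1) {x..y}" "H y - H x \<le> I1"
      "(E has_integral I2) {y..z}" "H z - H y \<le> I2" unfolding good_def by blast
    have "(F has_integral (J y - J x) + (J z - J y)) {x..z}"
      using has_integral_combine[OF trans(3,4)] g unfolding good_def by blast
    moreover have "(E has_integral I1 + I2) {x..z}"
      using has_integral_combine[OF trans(3,4) I(1,3)] .
    ultimately show ?case unfolding good_def using I(2,4) by (auto intro!: exI[of _ "I1 + I2"])
  next
    case (local x)
    obtain d w where "d > 0" and Q: "Q x d w" using loc[folded Q_def, of x] by blast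
    have d: "d > 0" "\<And>t. x - d < t \<Longrightarrow> t < x \<Longrightarrow> U t = w"
      "\<And>t. x \<le> t \<Longrightarrow> t < x + d \<Longrightarrow> U t = U x" "normal_flux \<gamma> w x = normal_flux \<gamma> (U x) x"
      "normal_entropy_flux \<gamma> cv s0 (U x) x \<le> normal_entropy_flux \<gamma> cv s0 w x"
      using \<open>d > 0\<close> Q unfolding Q_def by blast+
    have "good u v" if uv: "u \<le> x" "x \<le> v" "v - u < d" for u v
    proof -
      have g1: "good u x"
      proof (rule const[where w = w])
        show "U t = w" if "u \<le> t" "t < x" for t by (rule d(2)) (use uv that in auto)
        show "J x = normal_flux \<gamma> w x" unfolding J_def by (rule d(4)[symmetric])
        show "H x \<le> normal_entropy_flux \<gamma> cv s0 w x" unfolding H_def by (rule d(5))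
      qed (rule uv(1))
      have "U v = U x" using d(3)[of v] uv by simp
      then have g2: "good x v"
        using uv by (intro const[where w = "U x"] d(3)) (simp_all add: J_def H_def)
      obtain I1 I2 where I: "(E has_integral I1) {u..x}" "H x - H u \<le> I1"
        "(E has_integral I2) {x..v}" "H v - H x \<le> I2" using g1 g2 unfolding good_def by blast
      have "(F has_integral (J x - J u) + (J v - J x)) {u..v}"
        using has_integral_combine[OF uv(1,2)] g1 g2 unfolding good_def by blast
      moreover have "(E has_integral I1 + I2) {u..v}"
        using has_integral_combine[OF uv(1,2) I(1,3)] .
      ultimately show ?thesis unfolding good_def using I(2,4) by (auto intro!: exI[of _ "I1 + I2"])
    qed
    then show ?case using d(1) by (intro exI[of _ d]) auto
  qed
  show ?thesis
    unfolding entropy_solution_def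
  proof (intro conjI allI impI)
    fix x y :: real assume "x < y"
    then have g: "good x y" using all[of x y] by simp
    show "sin y *\<^sub>R flux_x \<gamma> (U y) - cos y *\<^sub>R flux_y \<gamma> (U y) - (sin x *\<^sub>R flux_x \<gamma> (U x) - cos x *\<^sub>R flux_y \<gamma> (U x))
        = integral {x..y} (\<lambda>t. cos t *\<^sub>R flux_x \<gamma> (U t) + sin t *\<^sub>R flux_y \<gamma> (U t))"
      using g unfolding good_def J_def normal_flux_def F_def[abs_def] by (auto dest!: integral_unique)
    show "sin y * entropy_flux_x \<gamma> cv s0 (U y) - cos y * entropy_flux_y \<gamma> cv s0 (U y)
        - (sin x * entropy_flux_x \<gamma> cv s0 (U x) - cos x * entropy_flux_y \<gamma> cv s0 (U x))
        \<le> integral {x..y} (\<lambda>t. cos t * entropy_flux_x \<gamma> cv s0 (U t) + sin t * entropy_flux_y \<gamma> cv s0 (U t))"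
      using g unfolding good_def H_def normal_entropy_flux_def E_def[abs_def] by (auto simp: integral_unique)
  next
    show "U \<in> borel_measurable lebesgue" by (rule assms(1))
    show "U (\<theta> + 2 * pi) = U \<theta>" "U \<theta> \<in> phase_space K" for \<theta> by (rule assms)+
  qed
qed

lemma phase_space_mono:
  assumes "w \<in> phase_space K" "0 < K" "K \<le> K'"
  shows "w \<in> phase_space K'"
proof -
  have "inverse K' \<le> inverse K" using assms by (simp add: le_imp_inverse_le)
  then show ?thesis using assms order_trans[of "inverse K'" "inverse K"] unfolding phase_space_def by auto
qed

lemma phase_space_exists:
  assumes "density w > 0" "internal_energy w > 0"
  shows "\<exists>K>1. w \<in> phase_space K"
proof -
  define K where "K = 1 + density w + internal_energy w + norm w + 1 / density w + 1 / internal_energy w"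
  have pos: "1 / density w > 0" "1 / internal_energy w > 0" "norm w \<ge> 0" using assms by auto
  have K: "K > 1" unfolding K_def using pos assms by linarith
  have "1 / density w \<le> K" "1 / internal_energy w \<le> K" "density w \<le> K" "internal_energy w \<le> K" "norm w \<le> K"
    unfolding K_def using pos assms by linarith+
  moreover have "inverse K \<le> density w" "inverse K \<le> internal_energy w"
    using calculation(1,2) assms K by (simp_all add: field_simps)
  ultimately show ?thesis using K unfolding phase_space_def by auto
qed

lemma phase_space_exists_finite:
  assumes "\<And>i. i < (k :: nat) \<Longrightarrow> density (w i) > 0 \<and> internal_energy (w i) > 0"
  shows "\<exists>K>1. \<forall>i<k. w i \<in> phase_space K"
  using assms
proof (induction k)
  case 0
  show ?case by (auto intro: exI[of _ 2])
next
  case (Suc k)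
  then obtain K1 where K1: "K1 > 1" "\<forall>i<k. w i \<in> phase_space K1" by auto
  obtain K2 where K2: "K2 > 1" "w k \<in> phase_space K2" using phase_space_exists Suc.prems[of k] by auto
  have "w i \<in> phase_space (max K1 K2)" if "i < Suc k" for i
    using that K1 K2 phase_space_mono[of "w i" K1 "max K1 K2"] phase_space_mono[of "w k" K2 "max K1 K2"]
    by (cases "i = k") auto
  then show ?case using K1(1) by (intro exI[of _ "max K1 K2"]) auto
qed

text \<open>The floor moves the angle into \<open>[0, 2 \<pi>)\<close>, so that \<open>b\<close> has to subdivide only this interval.\<close>

definition step_flow :: "nat \<Rightarrow> (nat \<Rightarrow> real) \<Rightarrow> (nat \<Rightarrow> state) \<Rightarrow> real \<Rightarrow> state"
  where "step_flow k b w \<theta> =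
    (\<Sum>i<k. indicat_real {b i..<b (Suc i)} (\<theta> - 2 * pi * real_of_int \<lfloor>\<theta> / (2 * pi)\<rfloor>) *\<^sub>R w i)"

locale step_flow_data =
  fixes k :: nat and b :: "nat \<Rightarrow> real" and w :: "nat \<Rightarrow> state"
  assumes k: "0 < k" and b: "b 0 = 0" "b k = 2 * pi" and b_less: "\<And>i. i < k \<Longrightarrow> b i < b (Suc i)"
begin

lemma b_mono: "i \<le> j \<Longrightarrow> j \<le> k \<Longrightarrow> b i \<le> b j"
proof (induction j rule: dec_induct)
  case (step j)
  then have "b i \<le> b j" "b j < b (Suc j)" using b_less[of j] by simp_all
  then show ?case by linarith
qed simp

lemma b_bounds: "i \<le> k \<Longrightarrow> 0 \<le> b i" "i \<le> k \<Longrightarrow> b i \<le> 2 * pi"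
  using b_mono[of 0 i] b_mono[of i k] b by auto

lemma piece: assumes "0 \<le> \<theta>" "\<theta> < 2 * pi" obtains i where "i < k" "b i \<le> \<theta>" "\<theta> < b (Suc i)"
proof -
  have *: "j \<le> k \<Longrightarrow> \<theta> < b j \<Longrightarrow> \<exists>i<k. b i \<le> \<theta> \<and> \<theta> < b (Suc i)" for j
  proof (induction j)
    case 0
    then show ?case using b assms by simp
  next
    case (Suc j)
    show ?case
    proof (cases "\<theta> < b j")
      case True
      then show ?thesis using Suc by simp
    next
      case False
      then show ?thesis using Suc.prems by (intro exI[of _ j]) auto
    qed
  qed
  obtain i where "i < k" "b i \<le> \<theta>" "\<theta> < b (Suc i)" using *[of k] assms b by auto
  then show thesis by (rule that)
qed

lemma periodic: "step_flow k b w (\<theta> + 2 * pi) = step_flow k b w \<theta>"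
proof -
  have "(\<theta> + 2 * pi) / (2 * pi) = \<theta> / (2 * pi) + 1" by (simp add: add_divide_distrib)
  then show ?thesis unfolding step_flow_def by (simp add: algebra_simps)
qed

lemma flow_value: assumes "i < k" "b i \<le> \<theta>" "\<theta> < b (Suc i)" shows "step_flow k b w \<theta> = w i"
proof -
  have "0 \<le> \<theta>" "\<theta> < 2 * pi" using assms b_bounds(1)[of i] b_bounds(2)[of "Suc i"] by auto
  then have "\<lfloor>\<theta> / (2 * pi)\<rfloor> = 0" by (intro floor_unique) (auto simp: field_simps)
  then have "step_flow k b w \<theta> = (\<Sum>j<k. indicat_real {b j..<b (Suc j)} \<theta> *\<^sub>R w j)"
    unfolding step_flow_def by simp
  also have "\<dots> = (\<Sum>j<k. if j = i then w i else 0)"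
  proof (rule sum.cong)
    fix j assume "j \<in> {..<k}"
    then have j: "j < k" by simp
    show "indicat_real {b j..<b (Suc j)} \<theta> *\<^sub>R w j = (if j = i then w i else 0)"
    proof (cases j i rule: linorder_cases)
      case less
      then have "b (Suc j) \<le> b i" using assms(1) by (intro b_mono) auto
      then show ?thesis using assms less by simp
    next
      case equal
      then show ?thesis using assms by simp
    next
      case greater
      then have "b (Suc i) \<le> b j" using j by (intro b_mono) auto
      then show ?thesis using assms greater by simp
    qed
  qed simp
  also have "\<dots> = w i" using assms(1) by simp
  finally show ?thesis .
qed

lemma measurable: "step_flow k b w \<in> borel_measurable lebesgue"
proof -
  have "step_flow k b w \<in> borel_measurable borel"
    unfolding step_flow_def[abs_def] by measurable
  then show ?thesis by (simp add: measurable_completion)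
qed

definition prev :: "nat \<Rightarrow> nat" where "prev i = (if i = 0 then k - 1 else i - 1)"

lemma left_right:
  assumes "0 \<le> x" "x < 2 * pi"
  obtains d i j where "d > 0" "i < k" "j < k" "b i \<le> x" "x < b (Suc i)" "j = i \<or> (x = b i \<and> j = prev i)"
    "\<And>t. x - d < t \<Longrightarrow> t < x \<Longrightarrow> step_flow k b w t = w j"
    "\<And>t. x \<le> t \<Longrightarrow> t < x + d \<Longrightarrow> step_flow k b w t = w i"
proof -
  obtain i where i: "i < k" "b i \<le> x" "x < b (Suc i)" by (rule piece[OF assms])
  have right: "step_flow k b w t = w i" if "x \<le> t" "t < b (Suc i)" for t
    by (rule flow_value) (use i that in auto)
  show thesis
  proof (cases "x = b i")
    case False
    show thesis
    proof (rule that[of "min (x - b i) (b (Suc i) - x)" i i])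
      show "step_flow k b w t = w i" if "x - min (x - b i) (b (Suc i) - x) < t" "t < x" for t
        by (rule flow_value) (use i that in auto)
      show "step_flow k b w t = w i" if "x \<le> t" "t < x + min (x - b i) (b (Suc i) - x)" for t
        by (rule right) (use that in auto)
    qed (use i False in auto)
  next
    case True
    define p where "p = prev i"
    have p: "p < k" unfolding p_def prev_def using i k by auto
    have left: "step_flow k b w t = w p" if "x - (b (Suc p) - b p) < t" "t < x" for t
    proof (cases "i = 0")
      case True
      then have "Suc p = k" "x = 0" unfolding p_def prev_def using k b \<open>x = b i\<close> by auto
      then have "step_flow k b w (t + 2 * pi) = w p"
        using that b(2) p by (intro flow_value) auto
      then show ?thesis by (simp add: periodic)
    next
      case False
      then have "Suc p = i" unfolding p_def prev_def by simp
      then show ?thesis using that p True by (intro flow_value) auto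
    qed
    show thesis
    proof (rule that[of "min (b (Suc p) - b p) (b (Suc i) - x)" i p])
      show "0 < min (b (Suc p) - b p) (b (Suc i) - x)" using i b_less[OF p] by simp
      show "p = i \<or> x = b i \<and> p = prev i" using True p_def by simp
      show "step_flow k b w t = w p" if "x - min (b (Suc p) - b p) (b (Suc i) - x) < t" "t < x" for t
        by (rule left) (use that in auto)
      show "step_flow k b w t = w i" if "x \<le> t" "t < x + min (b (Suc p) - b p) (b (Suc i) - x)" for t
        by (rule right) (use that in auto)
    qed (use i p in auto)
  qed
qed

lemma angle_mod_2pi:
  obtains y and n :: int where "0 \<le> y" "y < 2 * pi" "x = y + of_int n * (2 * pi)"
proof -
  define n where "n = \<lfloor>x / (2 * pi)\<rfloor>"
  have "of_int n \<le> x / (2 * pi)" "x / (2 * pi) < of_int n + 1" unfolding n_def by linarith+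
  then have "of_int n * (2 * pi) \<le> x" "x < (of_int n + 1) * (2 * pi)"
    by (simp_all add: pos_le_divide_eq pos_divide_less_eq)
  then show thesis by (intro that[of "x - of_int n * (2 * pi)" n]) (auto simp: algebra_simps)
qed

lemma nonstagnant_flow_step_flow:
  assumes pos: "\<And>i. i < k \<Longrightarrow> density (w i) > 0 \<and> internal_energy (w i) > 0"
    and moving: "\<And>i. i < k \<Longrightarrow> (vel_x (w i), vel_y (w i)) \<noteq> (0, 0)"
    and flux: "\<And>i. i < k \<Longrightarrow> normal_flux \<gamma> (w (prev i)) (b i) = normal_flux \<gamma> (w i) (b i)"
    and ent: "\<And>i. i < k \<Longrightarrow> normal_entropy_flux \<gamma> cv s0 (w i) (b i) \<le> normal_entropy_flux \<gamma> cv s0 (w (prev i)) (b i)"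
  shows "nonstagnant_flow \<gamma> cv s0 (step_flow k b w)"
proof -
  interpret U: periodic_fun_simple "step_flow k b w" "2 * pi"
    by unfold_locales (rule periodic)
  obtain K where K: "K > 1" "\<And>i. i < k \<Longrightarrow> w i \<in> phase_space K"
    using phase_space_exists_finite[of k w] pos by blast
  have range: "\<exists>i<k. step_flow k b w \<theta> = w i" for \<theta>
  proof -
    obtain y n where y: "0 \<le> y" "y < 2 * pi" "\<theta> = y + of_int n * (2 * pi)" by (rule angle_mod_2pi)
    obtain i where "i < k" "b i \<le> y" "y < b (Suc i)" by (rule piece[OF y(1,2)])
    then show ?thesis using flow_value[of i y] y(3) U.plus_of_int by auto
  qed
  define Q where "Q x d v \<longleftrightarrow> (\<forall>t. x - d < t \<longrightarrow> t < x \<longrightarrow> step_flow k b w t = v) \<and>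
      (\<forall>t. x \<le> t \<longrightarrow> t < x + d \<longrightarrow> step_flow k b w t = step_flow k b w x) \<and>
      normal_flux \<gamma> v x = normal_flux \<gamma> (step_flow k b w x) x \<and>
      normal_entropy_flux \<gamma> cv s0 (step_flow k b w x) x \<le> normal_entropy_flux \<gamma> cv s0 v x" for x d v
  have local: "\<exists>d>0. \<exists>v. Q x d v" for x
  proof -
    obtain y n where y: "0 \<le> y" "y < 2 * pi" "x = y + of_int n * (2 * pi)" by (rule angle_mod_2pi)
    obtain d i j where d: "d > 0" "i < k" "j < k" "b i \<le> y" "y < b (Suc i)" "j = i \<or> (y = b i \<and> j = prev i)"
      "\<And>t. y - d < t \<Longrightarrow> t < y \<Longrightarrow> step_flow k b w t = w j"
      "\<And>t. y \<le> t \<Longrightarrow> t < y + d \<Longrightarrow> step_flow k b w t = w i"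
      by (rule left_right[OF y(1,2)], rule that)
    have shift: "step_flow k b w t = step_flow k b w (t - of_int n * (2 * pi))" for t
      by (rule U.minus_of_int[symmetric])
    have x: "step_flow k b w x = w i" using shift[of x] d(8)[of y] d(1) y(3) by simp
    have trig: "sin x = sin y" "cos x = cos y"
      using sin.plus_of_int[of y n] cos.plus_of_int[of y n] unfolding y(3) by simp_all
    have "normal_flux \<gamma> (w j) x = normal_flux \<gamma> (w i) x"
      "normal_entropy_flux \<gamma> cv s0 (w i) x \<le> normal_entropy_flux \<gamma> cv s0 (w j) x"
      using d(6) flux[OF d(2)] ent[OF d(2)] unfolding normal_flux_def normal_entropy_flux_def trig by auto
    moreover have "step_flow k b w t = w j" if "x - d < t" "t < x" for t
      unfolding shift[of t] by (rule d(7)) (use that y(3) in auto)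
    moreover have "step_flow k b w t = w i" if "x \<le> t" "t < x + d" for t
      unfolding shift[of t] by (rule d(8)) (use that y(3) in auto)
    ultimately have "Q x d (w j)" unfolding Q_def x by blast
    then show ?thesis using d(1) by blast
  qed
  have "entropy_solution \<gamma> cv s0 K (step_flow k b w)"
  proof (rule locally_constant_entropy_solution[OF measurable periodic _ local[unfolded Q_def]])
    show "step_flow k b w \<theta> \<in> phase_space K" for \<theta> using range[of \<theta>] K(2) by auto
  qed
  moreover have "no_stagnation_points (step_flow k b w)"
    unfolding no_stagnation_points_def using range moving by metis
  moreover have "continuous (at_right \<theta>) (step_flow k b w)" for \<theta>
  proof -
    obtain d v where "d > 0" and Q: "Q \<theta> d v" using local[of \<theta>] by blast
    then have d: "d > 0" "\<And>t. \<theta> \<le> t \<Longrightarrow> t < \<theta> + d \<Longrightarrow> step_flow k b w t = step_flow k b w \<theta>"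
      unfolding Q_def by blast+
    have "\<forall>\<^sub>F t in at_right \<theta>. step_flow k b w t = step_flow k b w \<theta>"
      unfolding eventually_at_right_field
    proof (intro exI[of _ "\<theta> + d"] conjI allI impI)
      show "\<theta> < \<theta> + d" using d(1) by simp
      show "step_flow k b w t = step_flow k b w \<theta>" if "\<theta> < t" "t < \<theta> + d" for t
        by (rule d(2)) (use that in simp_all)
    qed
    then show ?thesis unfolding continuous_within by (rule tendsto_eventually)
  qed
  ultimately show ?thesis unfolding nonstagnant_flow_def using K(1) by blast
qed

lemma sector_angles_step_flow:
  "sector_angles (step_flow k b w) =
    (\<Union>i<k. {\<theta>. b i \<le> \<theta> \<and> \<theta> < b (Suc i) \<and> vel_x (w i) * sin \<theta> = vel_y (w i) * cos \<theta>})"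
proof (intro set_eqI iffI)
  fix \<theta> assume "\<theta> \<in> sector_angles (step_flow k b w)"
  then have t: "0 \<le> \<theta>" "\<theta> < 2 * pi" "normal_vel (step_flow k b w) \<theta> = 0"
    unfolding sector_angles_def by auto
  obtain i where i: "i < k" "b i \<le> \<theta>" "\<theta> < b (Suc i)" by (rule piece[OF t(1,2)])
  then show "\<theta> \<in> (\<Union>i<k. {\<theta>. b i \<le> \<theta> \<and> \<theta> < b (Suc i) \<and> vel_x (w i) * sin \<theta> = vel_y (w i) * cos \<theta>})"
    using t(3) flow_value[OF i] unfolding normal_vel_def by auto
next
  fix \<theta> assume "\<theta> \<in> (\<Union>i<k. {\<theta>. b i \<le> \<theta> \<and> \<theta> < b (Suc i) \<and> vel_x (w i) * sin \<theta> = vel_y (w i) * cos \<theta>})"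
  then obtain i where i: "i < k" "b i \<le> \<theta>" "\<theta> < b (Suc i)" "vel_x (w i) * sin \<theta> = vel_y (w i) * cos \<theta>" by auto
  then show "\<theta> \<in> sector_angles (step_flow k b w)"
    using flow_value[OF i(1-3)] b_bounds(1)[of i] b_bounds(2)[of "Suc i"]
    unfolding sector_angles_def normal_vel_def by auto
qed

end

section \<open>Flows with two and with three sectors\<close>

text \<open>Here \<open>r\<close> is the density, \<open>q\<close> the speed, \<open>\<phi>\<close> the direction of the velocity and \<open>p\<close> the pressure.\<close>

definition gas_state :: "real \<Rightarrow> real \<Rightarrow> real \<Rightarrow> real \<Rightarrow> real \<Rightarrow> state"
  where "gas_state \<gamma> r q \<phi> p = vector [r, r * (q * cos \<phi>), r * (q * sin \<phi>), r * (q\<^sup>2 / 2) + p / (\<gamma> - 1)]"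

lemma gas_state_simps:
  assumes "r > 0" "\<gamma> > 1"
  shows "density (gas_state \<gamma> r q \<phi> p) = r" "vel_x (gas_state \<gamma> r q \<phi> p) = q * cos \<phi>"
    "vel_y (gas_state \<gamma> r q \<phi> p) = q * sin \<phi>" "pressure \<gamma> (gas_state \<gamma> r q \<phi> p) = p"
    "internal_energy (gas_state \<gamma> r q \<phi> p) = p / ((\<gamma> - 1) * r)"
    "total_energy (gas_state \<gamma> r q \<phi> p) = r * (q\<^sup>2 / 2) + p / (\<gamma> - 1)"
proof -
  show *: "density (gas_state \<gamma> r q \<phi> p) = r" "vel_x (gas_state \<gamma> r q \<phi> p) = q * cos \<phi>"
    "vel_y (gas_state \<gamma> r q \<phi> p) = q * sin \<phi>"
    "total_energy (gas_state \<gamma> r q \<phi> p) = r * (q\<^sup>2 / 2) + p / (\<gamma> - 1)"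
    using assms by (simp_all add: gas_state_def density_def vel_x_def vel_y_def total_energy_def vector_4_nth)
  have "(q * cos \<phi>)\<^sup>2 + (q * sin \<phi>)\<^sup>2 = q\<^sup>2"
    by (simp add: power_mult_distrib flip: distrib_left)
  then show i: "internal_energy (gas_state \<gamma> r q \<phi> p) = p / ((\<gamma> - 1) * r)"
    unfolding internal_energy_def * using assms by (simp add: add_divide_distrib)
  show "pressure \<gamma> (gas_state \<gamma> r q \<phi> p) = p"
    unfolding pressure_def i * using assms by simp
qed

text \<open>The fluxes through a ray are determined by those of mass, radial momentum, normal momentum
  and energy.\<close>

lemma normal_flux_gas_state:
  fixes r \<gamma> q \<phi> \<theta> p :: real
  assumes "r > 0" "\<gamma> > 1"
  defines "N \<equiv> q * sin (\<theta> - \<phi>)" and "L \<equiv> q * cos (\<theta> - \<phi>)"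
  shows "normal_flux \<gamma> (gas_state \<gamma> r q \<phi> p) \<theta> $ 1 = r * N"
    "normal_flux \<gamma> (gas_state \<gamma> r q \<phi> p) \<theta> $ 2 = r * N * L * cos \<theta> + (r * N * N + p) * sin \<theta>"
    "normal_flux \<gamma> (gas_state \<gamma> r q \<phi> p) \<theta> $ 3 = r * N * L * sin \<theta> - (r * N * N + p) * cos \<theta>"
    "normal_flux \<gamma> (gas_state \<gamma> r q \<phi> p) \<theta> $ 4 = N * (r * (q\<^sup>2 / 2) + \<gamma> / (\<gamma> - 1) * p)"
proof -
  define u v where "u = q * cos \<phi>" and "v = q * sin \<phi>"
  have N: "N = u * sin \<theta> - v * cos \<theta>" unfolding N_def u_def v_def by (simp add: sin_diff algebra_simps)
  have L: "L = u * cos \<theta> + v * sin \<theta>" unfolding L_def u_def v_def by (simp add: cos_diff algebra_simps)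
  have s: "sin \<theta> * sin \<theta> + cos \<theta> * cos \<theta> = 1" using sin_cos_squared_add[of \<theta>] by (simp add: power2_eq_square)
  have "(u * C + v * S) * C + (u * S - v * C) * S = u * (S * S + C * C)"
    "(u * C + v * S) * S - (u * S - v * C) * C = v * (S * S + C * C)" for S C
    by (simp_all add: algebra_simps)
  from this[of "cos \<theta>" "sin \<theta>"] have uv: "L * cos \<theta> + N * sin \<theta> = u" "L * sin \<theta> - N * cos \<theta> = v"
    unfolding s N[symmetric] L[symmetric] by simp_all
  note g = gas_state_simps[OF assms(1,2), of q \<phi> p, folded u_def v_def]
  show "normal_flux \<gamma> (gas_state \<gamma> r q \<phi> p) \<theta> $ 1 = r * N"
    unfolding N normal_flux_def by (simp add: g algebra_simps)
  have "normal_flux \<gamma> (gas_state \<gamma> r q \<phi> p) \<theta> $ 2 = r * N * u + p * sin \<theta>"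
    unfolding N normal_flux_def by (simp add: g algebra_simps power2_eq_square)
  also have "\<dots> = r * N * L * cos \<theta> + (r * N * N + p) * sin \<theta>"
    unfolding uv(1)[symmetric] by (simp add: algebra_simps)
  finally show "normal_flux \<gamma> (gas_state \<gamma> r q \<phi> p) \<theta> $ 2 = r * N * L * cos \<theta> + (r * N * N + p) * sin \<theta>" .
  have "normal_flux \<gamma> (gas_state \<gamma> r q \<phi> p) \<theta> $ 3 = r * N * v - p * cos \<theta>"
    unfolding N normal_flux_def by (simp add: g algebra_simps power2_eq_square)
  also have "\<dots> = r * N * L * sin \<theta> - (r * N * N + p) * cos \<theta>"
    unfolding uv(2)[symmetric] by (simp add: algebra_simps)
  finally show "normal_flux \<gamma> (gas_state \<gamma> r q \<phi> p) \<theta> $ 3 = r * N * L * sin \<theta> - (r * N * N + p) * cos \<theta>" .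
  have "p / (\<gamma> - 1) + p = \<gamma> / (\<gamma> - 1) * p" using assms(2) by (simp add: field_simps)
  then have "r * (q\<^sup>2 / 2) + p / (\<gamma> - 1) + p = r * (q\<^sup>2 / 2) + \<gamma> / (\<gamma> - 1) * p" by simp
  moreover have "normal_flux \<gamma> (gas_state \<gamma> r q \<phi> p) \<theta> $ 4 = N * (r * (q\<^sup>2 / 2) + p / (\<gamma> - 1) + p)"
  proof -
    have "S * (u * e) - C * (v * e) = (u * S - v * C) * e" for S C e by (simp add: algebra_simps)
    moreover have "normal_flux \<gamma> (gas_state \<gamma> r q \<phi> p) \<theta> $ 4
        = sin \<theta> * (u * (r * (q\<^sup>2 / 2) + p / (\<gamma> - 1) + p)) - cos \<theta> * (v * (r * (q\<^sup>2 / 2) + p / (\<gamma> - 1) + p))"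
      unfolding normal_flux_def by (simp add: g)
    ultimately show ?thesis unfolding N by simp
  qed
  ultimately show "normal_flux \<gamma> (gas_state \<gamma> r q \<phi> p) \<theta> $ 4 = N * (r * (q\<^sup>2 / 2) + \<gamma> / (\<gamma> - 1) * p)" by simp
qed

lemma normal_entropy_flux_gas_state:
  assumes "r > 0" "\<gamma> > 1" "p > 0"
  shows "normal_entropy_flux \<gamma> cv s0 (gas_state \<gamma> r q \<phi> p) \<theta>
    = r * (q * sin (\<theta> - \<phi>)) * (cv * (ln p - \<gamma> * ln r) + s0)"
proof -
  have "entropy \<gamma> cv s0 (gas_state \<gamma> r q \<phi> p) = cv * (ln p - \<gamma> * ln r) + s0"
    unfolding entropy_def using assms by (simp add: gas_state_simps ln_mult ln_powr)
  moreover have "S * (r * (q * c) * e) - C * (r * (q * d) * e) = r * (q * (S * c - C * d)) * e" for S C c d e :: real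
    by (simp add: algebra_simps)
  ultimately show ?thesis
    unfolding normal_entropy_flux_def entropy_flux_x_def entropy_flux_y_def sin_diff
    using assms(1,2) by (simp only: gas_state_simps)
qed

lemma contact_jump:
  assumes "r > 0" "r' > 0" "\<gamma> > 1" "p > 0" "sin (\<theta> - \<phi>) = 0" "sin (\<theta> - \<phi>') = 0"
  shows "normal_flux \<gamma> (gas_state \<gamma> r q \<phi> p) \<theta> = normal_flux \<gamma> (gas_state \<gamma> r' q' \<phi>' p) \<theta>"
    and "normal_entropy_flux \<gamma> cv s0 (gas_state \<gamma> r q \<phi> p) \<theta> = normal_entropy_flux \<gamma> cv s0 (gas_state \<gamma> r' q' \<phi>' p) \<theta>"
  using assms by (simp_all add: vec_eq_iff forall_4 normal_flux_gas_state normal_entropy_flux_gas_state)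

text \<open>A shock on a ray with the tangential velocity \<open>1\<close>: the velocity makes the angle \<open>\<alpha>\<close>
  with the ray before and \<open>\<pi> / 2 - \<alpha>\<close> behind the shock, so that the normal velocities are
  \<open>tan \<alpha>\<close> and \<open>cot \<alpha>\<close>, with mean \<open>shock_B\<close> and half difference \<open>shock_V\<close>. Among the shocks
  with the same ratio of pressures this one has the largest deflection. The mass flux is \<open>\<mu>\<close>.\<close>

definition shock_B :: "real \<Rightarrow> real" where "shock_B \<alpha> = (tan \<alpha> + 1 / tan \<alpha>) / 2"
definition shock_V :: "real \<Rightarrow> real" where "shock_V \<alpha> = (tan \<alpha> - 1 / tan \<alpha>) / 2"

definition before_shock :: "real \<Rightarrow> real \<Rightarrow> real \<Rightarrow> real \<Rightarrow> state"
  where "before_shock \<gamma> \<mu> \<alpha> \<phi> =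
    gas_state \<gamma> (\<mu> / tan \<alpha>) (1 / cos \<alpha>) \<phi> (\<mu> * (shock_B \<alpha> / \<gamma> - shock_V \<alpha>))"

definition behind_shock :: "real \<Rightarrow> real \<Rightarrow> real \<Rightarrow> real \<Rightarrow> state"
  where "behind_shock \<gamma> \<mu> \<alpha> \<phi> =
    gas_state \<gamma> (\<mu> * tan \<alpha>) (1 / sin \<alpha>) \<phi> (\<mu> * (shock_B \<alpha> / \<gamma> + shock_V \<alpha>))"

context
  fixes \<gamma> \<mu> \<alpha> :: real
  assumes \<gamma>: "\<gamma> > 1" and \<mu>: "\<mu> > 0" and \<alpha>: "pi / 4 < \<alpha>" "\<alpha> < pi / 2" and V: "\<gamma> * shock_V \<alpha> < shock_B \<alpha>"
begin

lemma shock_trig: "0 < cos \<alpha>" "0 < sin \<alpha>" "1 < tan \<alpha>"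
proof -
  show c: "0 < cos \<alpha>" using \<alpha> pi_gt_zero by (intro cos_gt_zero_pi) auto
  show "0 < sin \<alpha>" using \<alpha> pi_gt_zero by (intro sin_gt_zero) auto
  have "tan (pi / 4) < tan \<alpha>" using \<alpha> pi_gt_zero by (intro tan_monotone) auto
  then show "1 < tan \<alpha>" by (simp add: tan_45)
qed

lemma shock_positive:
  "0 < \<mu> / tan \<alpha>" "0 < \<mu> * tan \<alpha>" "0 < \<mu> * (shock_B \<alpha> / \<gamma> - shock_V \<alpha>)" "0 < \<mu> * (shock_B \<alpha> / \<gamma> + shock_V \<alpha>)"
  "0 < shock_V \<alpha>"
proof -
  have "1 / tan \<alpha> < 1" using shock_trig by simp
  then have "1 / tan \<alpha> < tan \<alpha>" using shock_trig(3) by linarith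
  then show "0 < shock_V \<alpha>" unfolding shock_V_def by simp
  moreover have "shock_V \<alpha> < shock_B \<alpha> / \<gamma>" using V \<gamma> by (simp add: field_simps)
  ultimately show "0 < \<mu> * (shock_B \<alpha> / \<gamma> - shock_V \<alpha>)" "0 < \<mu> * (shock_B \<alpha> / \<gamma> + shock_V \<alpha>)"
    using \<mu> by simp_all
qed (use \<mu> shock_trig in auto)

text \<open>The sense of rotation is \<open>\<sigma>\<close>, with \<open>1\<close> for anticlockwise. It also decides which side of the ray is
  before the shock, and hence the direction of the entropy inequality.\<close>

lemma shock_jump:
  fixes \<sigma> :: real
  assumes \<sigma>: "\<sigma> = 1 \<or> \<sigma> = - 1"
  shows "normal_flux \<gamma> (before_shock \<gamma> \<mu> \<alpha> (s + \<sigma> * \<alpha>)) s = normal_flux \<gamma> (behind_shock \<gamma> \<mu> \<alpha> (s + \<sigma> * (pi / 2 - \<alpha>))) s"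
    and "cv > 0 \<Longrightarrow> \<sigma> * normal_entropy_flux \<gamma> cv s0 (behind_shock \<gamma> \<mu> \<alpha> (s + \<sigma> * (pi / 2 - \<alpha>))) s
      \<le> \<sigma> * normal_entropy_flux \<gamma> cv s0 (before_shock \<gamma> \<mu> \<alpha> (s + \<sigma> * \<alpha>)) s"
proof -
  define T where "T = tan \<alpha>"
  have T: "T > 1" "T > 0" unfolding T_def using shock_trig by auto
  have sn: "1 / cos \<alpha> * sin (s - (s + \<sigma> * \<alpha>)) = - \<sigma> * T" "1 / cos \<alpha> * cos (s - (s + \<sigma> * \<alpha>)) = 1"
    using \<sigma> shock_trig unfolding T_def tan_def by auto
  have cs: "1 / sin \<alpha> * sin (s - (s + \<sigma> * (pi / 2 - \<alpha>))) = - \<sigma> / T"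
    "1 / sin \<alpha> * cos (s - (s + \<sigma> * (pi / 2 - \<alpha>))) = 1"
    using \<sigma> shock_trig unfolding T_def tan_def by (auto simp: sin_diff cos_diff)
  have q: "(1 / cos \<alpha>)\<^sup>2 = 1 + T\<^sup>2" "(1 / sin \<alpha>)\<^sup>2 = 1 + 1 / T\<^sup>2"
  proof -
    have frac: "(1 / y)\<^sup>2 = 1 + (x / y)\<^sup>2" if "x\<^sup>2 + y\<^sup>2 = 1" "y > 0" for x y :: real
    proof -
      have "(x\<^sup>2 + y\<^sup>2) / y\<^sup>2 = (x / y)\<^sup>2 + 1" using that(2) by (simp add: power_divide add_divide_distrib)
      then show ?thesis unfolding that(1) by (simp add: power_divide)
    qed
    show "(1 / cos \<alpha>)\<^sup>2 = 1 + T\<^sup>2"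
      unfolding T_def tan_def by (rule frac) (use shock_trig in auto)
    have "(1 / sin \<alpha>)\<^sup>2 = 1 + (cos \<alpha> / sin \<alpha>)\<^sup>2"
      by (rule frac) (use shock_trig in auto)
    then show "(1 / sin \<alpha>)\<^sup>2 = 1 + 1 / T\<^sup>2"
      unfolding T_def tan_def by (simp add: power_divide)
  qed
  define B V where "B = shock_B \<alpha>" and "V = shock_V \<alpha>"
  have BV: "T = B + V" "1 / T = B - V" unfolding T_def B_def V_def shock_B_def shock_V_def by argo+
  have before: "before_shock \<gamma> \<mu> \<alpha> \<phi> = gas_state \<gamma> (\<mu> / T) (1 / cos \<alpha>) \<phi> (\<mu> * (B / \<gamma> - V))" for \<phi>
    unfolding before_shock_def T_def B_def V_def ..
  have behind: "behind_shock \<gamma> \<mu> \<alpha> \<phi> = gas_state \<gamma> (\<mu> * T) (1 / sin \<alpha>) \<phi> (\<mu> * (B / \<gamma> + V))" for \<phi>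
    unfolding behind_shock_def T_def B_def V_def ..
  have r: "\<mu> / T > 0" "\<mu> * T > 0" using \<mu> T by simp_all
  note f1 = normal_flux_gas_state[OF r(1) \<gamma>, where q = "1 / cos \<alpha>" and \<theta> = s and \<phi> = "s + \<sigma> * \<alpha>", unfolded sn q]
  note f2 = normal_flux_gas_state[OF r(2) \<gamma>, where q = "1 / sin \<alpha>" and \<theta> = s and \<phi> = "s + \<sigma> * (pi / 2 - \<alpha>)", unfolded cs q]
  have ss: "\<sigma> * \<sigma> = 1" using \<sigma> by auto
  have mass: "\<mu> / T * (- \<sigma> * T) = - (\<sigma> * \<mu>)" "\<mu> * T * (- \<sigma> / T) = - (\<sigma> * \<mu>)" using T by simp_all
  have mom: "\<mu> / T * (- \<sigma> * T) * (- \<sigma> * T) + \<mu> * (B / \<gamma> - V) = \<mu> * (T + (B / \<gamma> - V))"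
    "\<mu> * T * (- \<sigma> / T) * (- \<sigma> / T) + \<mu> * (B / \<gamma> + V) = \<mu> * (1 / T + (B / \<gamma> + V))"
  proof -
    have "- (\<sigma> * \<mu>) * (- \<sigma> * x) = (\<sigma> * \<sigma>) * (\<mu> * x)" for x by simp
    from this[of T] this[of "1 / T"]
    show "\<mu> / T * (- \<sigma> * T) * (- \<sigma> * T) + \<mu> * (B / \<gamma> - V) = \<mu> * (T + (B / \<gamma> - V))"
      "\<mu> * T * (- \<sigma> / T) * (- \<sigma> / T) + \<mu> * (B / \<gamma> + V) = \<mu> * (1 / T + (B / \<gamma> + V))"
      unfolding mass ss by (simp_all add: distrib_left)
  qed
  have mom_eq: "T + (B / \<gamma> - V) = 1 / T + (B / \<gamma> + V)" using BV by linarith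
  have energy: "- \<sigma> * T * (\<mu> / T * ((1 + T\<^sup>2) / 2) + \<gamma> / (\<gamma> - 1) * (\<mu> * (B / \<gamma> - V)))
      = - \<sigma> / T * (\<mu> * T * ((1 + 1 / T\<^sup>2) / 2) + \<gamma> / (\<gamma> - 1) * (\<mu> * (B / \<gamma> + V)))"
  proof -
    have c1: "(1 + T\<^sup>2) / 2 + \<gamma> / (\<gamma> - 1) * ((B / \<gamma> - V) * T)
        = 1 / 2 + (B\<^sup>2 - V\<^sup>2) * (\<gamma> + 1) / (2 * (\<gamma> - 1))"
      unfolding BV(1) using \<gamma> by (simp add: field_simps power2_eq_square)
    have c2: "(1 + (1 / T)\<^sup>2) / 2 + \<gamma> / (\<gamma> - 1) * ((B / \<gamma> + V) * (1 / T))
        = 1 / 2 + (B\<^sup>2 - V\<^sup>2) * (\<gamma> + 1) / (2 * (\<gamma> - 1))"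
      unfolding BV(2) using \<gamma> by (simp add: field_simps power2_eq_square)
    have 1: "T * (1 / T * ((1 + T\<^sup>2) / 2) + \<gamma> / (\<gamma> - 1) * (B / \<gamma> - V))
        = 1 / 2 + (B\<^sup>2 - V\<^sup>2) * (\<gamma> + 1) / (2 * (\<gamma> - 1))"
      unfolding c1[symmetric] using T by (simp add: distrib_left)
    have 2: "1 / T * (T * ((1 + 1 / T\<^sup>2) / 2) + \<gamma> / (\<gamma> - 1) * (B / \<gamma> + V))
        = 1 / 2 + (B\<^sup>2 - V\<^sup>2) * (\<gamma> + 1) / (2 * (\<gamma> - 1))"
      unfolding c2[symmetric] using T by (simp add: distrib_left power_divide add_divide_distrib)
    have "- \<sigma> * T * (\<mu> / T * x + y * (\<mu> * z)) = - \<sigma> * \<mu> * (T * (1 / T * x + y * z))"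
      "- \<sigma> / T * (\<mu> * T * x + y * (\<mu> * z)) = - \<sigma> * \<mu> * (1 / T * (T * x + y * z))" for x y z
      using T by (simp_all add: field_simps)
    note e = this
    show ?thesis unfolding e 1 2 by (rule refl)
  qed
  show "normal_flux \<gamma> (before_shock \<gamma> \<mu> \<alpha> (s + \<sigma> * \<alpha>)) s = normal_flux \<gamma> (behind_shock \<gamma> \<mu> \<alpha> (s + \<sigma> * (pi / 2 - \<alpha>))) s"
    unfolding before behind vec_eq_iff forall_4 f1 f2 mom mom_eq energy unfolding mass by simp
  assume cv: "cv > 0"
  have p: "\<mu> * (B / \<gamma> - V) > 0" "\<mu> * (B / \<gamma> + V) > 0" "V > 0"
    using shock_positive unfolding B_def V_def by auto
  then have pB: "B / \<gamma> - V > 0" "B / \<gamma> + V > 0" using \<mu> by (simp_all add: zero_less_mult_iff)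
  have "ln (B / \<gamma> - V) + \<gamma> * ln (B + V) < ln (B / \<gamma> + V) + \<gamma> * ln (B - V)"
    using entropy_increases_across_shock[OF \<gamma> p(3), of B] V unfolding B_def V_def by simp
  moreover have "ln (\<mu> * (B / \<gamma> - V)) - \<gamma> * ln (\<mu> / T) = ln \<mu> - \<gamma> * ln \<mu> + (ln (B / \<gamma> - V) + \<gamma> * ln (B + V))"
  proof -
    have "ln (\<mu> * (B / \<gamma> - V)) = ln \<mu> + ln (B / \<gamma> - V)" "ln (\<mu> / T) = ln \<mu> - ln (B + V)"
      using \<mu> T pB by (simp_all add: ln_mult ln_div BV(1)[symmetric])
    then show ?thesis by (simp add: right_diff_distrib)
  qed
  moreover have "ln (\<mu> * (B / \<gamma> + V)) - \<gamma> * ln (\<mu> * T) = ln \<mu> - \<gamma> * ln \<mu> + (ln (B / \<gamma> + V) + \<gamma> * ln (B - V))"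
  proof -
    have "ln (B - V) = - ln T" unfolding BV(2)[symmetric] using T by (simp add: ln_div)
    moreover have "ln (\<mu> * (B / \<gamma> + V)) = ln \<mu> + ln (B / \<gamma> + V)" "ln (\<mu> * T) = ln \<mu> + ln T"
      using \<mu> T pB by (simp_all add: ln_mult)
    ultimately show ?thesis by (simp add: distrib_left)
  qed
  ultimately have "ln (\<mu> * (B / \<gamma> - V)) - \<gamma> * ln (\<mu> / T) \<le> ln (\<mu> * (B / \<gamma> + V)) - \<gamma> * ln (\<mu> * T)" by linarith
  then have S: "\<mu> * (cv * (ln (\<mu> * (B / \<gamma> - V)) - \<gamma> * ln (\<mu> / T)) + s0)
      \<le> \<mu> * (cv * (ln (\<mu> * (B / \<gamma> + V)) - \<gamma> * ln (\<mu> * T)) + s0)"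
    using cv \<mu> by simp
  have "\<sigma> * normal_entropy_flux \<gamma> cv s0 (before_shock \<gamma> \<mu> \<alpha> (s + \<sigma> * \<alpha>)) s
      = - ((\<sigma> * \<sigma>) * (\<mu> * (cv * (ln (\<mu> * (B / \<gamma> - V)) - \<gamma> * ln (\<mu> / T)) + s0)))"
    unfolding before normal_entropy_flux_gas_state[OF r(1) \<gamma> p(1)] sn mass by simp
  moreover have "\<sigma> * normal_entropy_flux \<gamma> cv s0 (behind_shock \<gamma> \<mu> \<alpha> (s + \<sigma> * (pi / 2 - \<alpha>))) s
      = - ((\<sigma> * \<sigma>) * (\<mu> * (cv * (ln (\<mu> * (B / \<gamma> + V)) - \<gamma> * ln (\<mu> * T)) + s0)))"
    unfolding behind normal_entropy_flux_gas_state[OF r(2) \<gamma> p(2)] cs mass by simp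
  ultimately show "\<sigma> * normal_entropy_flux \<gamma> cv s0 (behind_shock \<gamma> \<mu> \<alpha> (s + \<sigma> * (pi / 2 - \<alpha>))) s
      \<le> \<sigma> * normal_entropy_flux \<gamma> cv s0 (before_shock \<gamma> \<mu> \<alpha> (s + \<sigma> * \<alpha>)) s"
    using S unfolding ss by simp
qed

end

lemma parallel_flow_two_sectors:
  assumes "\<gamma> > 1"
  shows "\<exists>U. nonstagnant_flow \<gamma> cv s0 U \<and> has_num_sectors U 2"
proof -
  define b :: "nat \<Rightarrow> real" where "b i = real i * (2 * pi)" for i
  define w :: "nat \<Rightarrow> state" where "w i = gas_state \<gamma> 1 1 0 1" for i
  interpret step_flow_data 1 b w by unfold_locales (auto simp: b_def)
  have g: "density (w i) = 1" "vel_x (w i) = 1" "vel_y (w i) = 0" "internal_energy (w i) = 1 / (\<gamma> - 1)" for i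
    unfolding w_def using assms by (simp_all add: gas_state_simps)
  have "nonstagnant_flow \<gamma> cv s0 (step_flow 1 b w)"
    by (rule nonstagnant_flow_step_flow) (use assms in \<open>simp_all add: g, simp_all add: w_def\<close>)
  moreover have "sector_angles (step_flow 1 b w) = {0, pi}"
  proof -
    have "sin \<theta> = 0 \<longleftrightarrow> \<theta> = 0 \<or> \<theta> = pi" if "0 \<le> \<theta>" "\<theta> < 2 * pi" for \<theta>
    proof
      assume "sin \<theta> = 0"
      then show "\<theta> = 0 \<or> \<theta> = pi"
        using sin_gt_zero[of \<theta>] sin_lt_zero[of \<theta>] that by (cases "\<theta> < pi"; cases "\<theta> = 0"; cases "\<theta> = pi") auto
    qed auto
    then show ?thesis unfolding sector_angles_step_flow using pi_gt_zero by (auto simp: g b_def)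
  qed
  ultimately show ?thesis
    unfolding has_num_sectors_def using length_sectors[of "step_flow 1 b w"] by (intro exI[of _ "step_flow 1 b w"]) auto
qed

text \<open>Three sectors: two equal shocks with the deflection \<open>d\<close> turn anticlockwise, and one with
  the deflection \<open>\<pi> - 2 d\<close> clockwise. The incoming contact ray of both senses is \<open>0\<close>, the
  outgoing one \<open>2 \<pi> - 2 d\<close>, and \<open>\<pi> - d\<close> lies between the equal shocks. The pressures on
  both sides of the contacts agree if the pressure ratio of the third shock is the square of that
  of the others; with \<open>c = cos d\<close> this amounts to \<open>\<gamma>\<^sup>2 c (1 + c) = 1\<close>.\<close>

lemma three_sector_flow:
  assumes c: "1 / 2 < c" "c \<le> 3 / 5" and "\<gamma> > 1" and \<gamma>c: "\<gamma>\<^sup>2 * (c * (1 + c)) = 1" and "cv > 0"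
  shows "\<exists>U. nonstagnant_flow \<gamma> cv s0 U \<and> has_num_sectors U 3"
proof -
  define d where "d = arccos c"
  have cosd: "cos d = c" unfolding d_def using c by (intro cos_arccos) auto
  have d0: "0 \<le> d" "d \<le> pi" unfolding d_def using c by (auto intro: arccos_lbound arccos_ubound)
  have "d < pi / 3"
  proof (rule ccontr)
    assume "\<not> d < pi / 3"
    then have "cos d \<le> cos (pi / 3)" using d0 by (intro cos_monotone_0_pi_le) auto
    then show False using c cosd by (simp add: cos_60)
  qed
  have "pi / 4 < d"
  proof (rule ccontr)
    assume "\<not> pi / 4 < d"
    then have "cos (pi / 4) \<le> cos d" using d0 by (intro cos_monotone_0_pi_le) auto
    moreover have "(6 / 5 :: real) < sqrt 2" by (rule real_less_rsqrt) (simp add: power2_eq_square)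
    ultimately show False using c cosd by (simp add: cos_45)
  qed
  note d = \<open>pi / 4 < d\<close> \<open>d < pi / 3\<close>
  define \<alpha> where "\<alpha> = pi / 4 + d / 2"
  define \<beta> where "\<beta> = 3 * pi / 4 - d"
  have \<alpha>: "pi / 4 < \<alpha>" "\<alpha> < pi / 2" and \<beta>: "pi / 4 < \<beta>" "\<beta> < pi / 2"
    unfolding \<alpha>_def \<beta>_def using d by auto
  define s where "s = sin d"
  have s: "0 < s" unfolding s_def using d by (intro sin_gt_zero) auto
  have s2: "s\<^sup>2 = 1 - c\<^sup>2" unfolding s_def cosd[symmetric] by (simp add: sin_squared_eq)
  have ratio: "shock_V x = - cos (2 * x) * shock_B x" "shock_B x > 0" if "pi / 4 < x" "x < pi / 2" for x
  proof -
    have t: "0 < cos x" "0 < sin x" using that by (auto intro!: cos_gt_zero_pi sin_gt_zero)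
    then have "tan x > 0" unfolding tan_def by simp
    then show "shock_B x > 0" unfolding shock_B_def by (simp add: add_pos_pos)
    have sc: "(sin x)\<^sup>2 + (cos x)\<^sup>2 = 1" by simp
    have "shock_B x = ((sin x)\<^sup>2 + (cos x)\<^sup>2) / (2 * (sin x * cos x))"
      unfolding shock_B_def tan_def using t by (simp only: power2_eq_square) (simp add: field_simps)
    moreover have "shock_V x = ((sin x)\<^sup>2 - (cos x)\<^sup>2) / (2 * (sin x * cos x))"
      unfolding shock_V_def tan_def using t by (simp only: power2_eq_square) (simp add: field_simps)
    ultimately show "shock_V x = - cos (2 * x) * shock_B x" by (simp add: cos_double)
  qed
  have V\<alpha>: "shock_V \<alpha> = s * shock_B \<alpha>"
  proof -
    have "2 * \<alpha> = pi / 2 + d" unfolding \<alpha>_def by simp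
    then have "cos (2 * \<alpha>) = - s" unfolding s_def by (simp only: cos_add) simp
    then show ?thesis using ratio(1)[OF \<alpha>] by simp
  qed
  have V\<beta>: "shock_V \<beta> = 2 * s * c * shock_B \<beta>"
  proof -
    have "2 * \<beta> = pi + (pi / 2 - 2 * d)" unfolding \<beta>_def by simp
    then have "cos (2 * \<beta>) = - cos (pi / 2 - 2 * d)" by (simp only: cos_add) simp
    also have "cos (pi / 2 - 2 * d) = 2 * s * c" unfolding s_def cosd[symmetric] by (simp add: cos_diff sin_double)
    finally show ?thesis using ratio(1)[OF \<beta>] by simp
  qed
  \<comment> \<open>The pressure ratios of the shocks are \<open>(1 + g) / (1 - g)\<close> and \<open>(1 + 2 g c) / (1 - 2 g c)\<close>.\<close>
  define g where "g = \<gamma> * s"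
  have g2: "c * (1 + g\<^sup>2) = 1"
  proof -
    have "g\<^sup>2 * (c * (1 + c)) = (1 - c\<^sup>2) * (\<gamma>\<^sup>2 * (c * (1 + c)))" unfolding g_def power_mult_distrib s2 by simp
    then have "(1 + c) * (c * g\<^sup>2) = (1 + c) * (1 - c)" unfolding \<gamma>c by (simp add: power2_eq_square algebra_simps)
    then have "c * g\<^sup>2 = 1 - c" using c by simp
    then show ?thesis by (simp add: distrib_left)
  qed
  have g: "0 < g" "g < 1"
  proof -
    show "0 < g" unfolding g_def using s assms by simp
    have "c * (1 + g\<^sup>2) < c * 2" unfolding g2 using c by simp
    then have "g\<^sup>2 < 1\<^sup>2" using c by simp
    then show "g < 1" by (rule power2_less_imp_less) simp
  qed
  have gc: "2 * g * c < 1"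
  proof -
    have "0 < c * (1 - g)\<^sup>2" using c g by simp
    also have "c * (1 - g)\<^sup>2 = c * (1 + g\<^sup>2) - 2 * g * c" by (simp add: power2_eq_square algebra_simps)
    finally show ?thesis unfolding g2 by simp
  qed
  have W\<alpha>: "\<gamma> * shock_V \<alpha> < shock_B \<alpha>" and W\<beta>: "\<gamma> * shock_V \<beta> < shock_B \<beta>"
  proof -
    have "\<gamma> * shock_V \<alpha> = g * shock_B \<alpha>" "\<gamma> * shock_V \<beta> = (2 * g * c) * shock_B \<beta>"
      unfolding V\<alpha> V\<beta> g_def by simp_all
    then show "\<gamma> * shock_V \<alpha> < shock_B \<alpha>" "\<gamma> * shock_V \<beta> < shock_B \<beta>"
      using g gc ratio(2)[OF \<alpha>] ratio(2)[OF \<beta>] by simp_all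
  qed
  define pa pa' pb pb' where "pa = shock_B \<alpha> / \<gamma> - shock_V \<alpha>" and "pa' = shock_B \<alpha> / \<gamma> + shock_V \<alpha>"
    and "pb = shock_B \<beta> / \<gamma> - shock_V \<beta>" and "pb' = shock_B \<beta> / \<gamma> + shock_V \<beta>"
  have p_eq: "pa = shock_B \<alpha> / \<gamma> * (1 - g)" "pa' = shock_B \<alpha> / \<gamma> * (1 + g)"
    "pb = shock_B \<beta> / \<gamma> * (1 - 2 * g * c)" "pb' = shock_B \<beta> / \<gamma> * (1 + 2 * g * c)"
    unfolding pa_def pa'_def pb_def pb'_def V\<alpha> V\<beta> g_def using assms(3) by (simp_all add: field_simps)
  have p: "pa > 0" "pa' > 0" "pb > 0" "pb' > 0"
    unfolding p_eq using ratio(2)[OF \<alpha>] ratio(2)[OF \<beta>] assms(3) g gc c by (auto intro!: divide_pos_pos mult_pos_pos add_pos_pos)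
  have match: "pa' * pa' * pb = pa * pa * pb'"
  proof -
    have "c * (1 + g)\<^sup>2 = 1 + 2 * g * c" "c * (1 - g)\<^sup>2 = 1 - 2 * g * c"
      using g2 by (simp_all add: power2_eq_square algebra_simps)
    then have "(1 + g)\<^sup>2 * (c * (1 - g)\<^sup>2) = (1 + g)\<^sup>2 * (1 - 2 * g * c)"
      "(1 - g)\<^sup>2 * (c * (1 + g)\<^sup>2) = (1 - g)\<^sup>2 * (1 + 2 * g * c)" by simp_all
    moreover have "(1 + g)\<^sup>2 * (c * (1 - g)\<^sup>2) = (1 - g)\<^sup>2 * (c * (1 + g)\<^sup>2)" by simp
    ultimately have key: "(1 + g)\<^sup>2 * (1 - 2 * g * c) = (1 - g)\<^sup>2 * (1 + 2 * g * c)" by linarith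
    have "pa' * pa' * pb = (shock_B \<alpha> / \<gamma>)\<^sup>2 * (shock_B \<beta> / \<gamma>) * ((1 + g)\<^sup>2 * (1 - 2 * g * c))"
      "pa * pa * pb' = (shock_B \<alpha> / \<gamma>)\<^sup>2 * (shock_B \<beta> / \<gamma>) * ((1 - g)\<^sup>2 * (1 + 2 * g * c))"
      unfolding p_eq by (simp_all add: power2_eq_square)
    then show ?thesis unfolding key by simp
  qed
  \<comment> \<open>The mass fluxes scale the pressures so that these agree at the contacts.\<close>
  define \<mu>2 \<mu>3 where "\<mu>2 = pa' / pa" and "\<mu>3 = pa / pb"
  have \<mu>: "\<mu>2 > 0" "\<mu>3 > 0" unfolding \<mu>2_def \<mu>3_def using p by simp_all
  have pressures: "\<mu>3 * pb = 1 * pa" "\<mu>2 * pa = 1 * pa'" "\<mu>2 * pa' = \<mu>3 * pb'"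
    unfolding \<mu>2_def \<mu>3_def using p match by (simp_all add: field_simps)
  \<comment> \<open>The contact rays are \<open>0\<close>, \<open>e\<close> and \<open>f\<close>. The shock rays make the angle \<open>\<alpha>\<close> or \<open>\<beta>\<close> with a velocity
    that points from the incoming contact ray to the origin.\<close>
  define e f where "e = pi - d" and "f = 2 * pi - 2 * d"
  define s1 s2 s3 where "s1 = pi - \<alpha>" and "s2 = e + pi - \<alpha>" and "s3 = pi + \<beta>"
  define b where "b i = [0, s1, e, s2, f, s3, 2 * pi] ! i" for i
  define w where "w i = [before_shock \<gamma> 1 \<alpha> pi, behind_shock \<gamma> 1 \<alpha> e, before_shock \<gamma> \<mu>2 \<alpha> (e + pi),
    behind_shock \<gamma> \<mu>2 \<alpha> f, behind_shock \<gamma> \<mu>3 \<beta> f, before_shock \<gamma> \<mu>3 \<beta> pi] ! i" for i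
  have order: "0 < s1" "s1 < e" "e < s2" "s2 < f" "f < s3" "s3 < 2 * pi"
    unfolding s1_def s2_def s3_def e_def f_def \<alpha>_def \<beta>_def using d by simp_all
  have less6: "i < 6 \<longleftrightarrow> i = 0 \<or> i = 1 \<or> i = 2 \<or> i = 3 \<or> i = 4 \<or> i = 5" for i :: nat by auto
  have bs: "b 0 = 0" "b 1 = s1" "b 2 = e" "b 3 = s2" "b 4 = f" "b 5 = s3" "b 6 = 2 * pi"
    unfolding b_def by (simp_all add: eval_nat_numeral)
  have ws: "w 0 = before_shock \<gamma> 1 \<alpha> pi" "w 1 = behind_shock \<gamma> 1 \<alpha> e" "w 2 = before_shock \<gamma> \<mu>2 \<alpha> (e + pi)"
    "w 3 = behind_shock \<gamma> \<mu>2 \<alpha> f" "w 4 = behind_shock \<gamma> \<mu>3 \<beta> f" "w 5 = before_shock \<gamma> \<mu>3 \<beta> pi"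
    unfolding w_def by (simp_all add: eval_nat_numeral)
  interpret step_flow_data 6 b w
  proof
    show "b i < b (Suc i)" if "i < 6" for i
      using that order bs unfolding less6 by (auto simp: eval_nat_numeral)
  qed (simp_all add: bs)
  have pv: "prev 0 = 5" "prev 1 = 0" "prev 2 = 1" "prev 3 = 2" "prev 4 = 3" "prev 5 = 4"
    unfolding prev_def by simp_all
  have P1: "0 < (1 :: real)" by simp
  note sp = shock_positive[OF assms(3) P1 \<alpha> W\<alpha>] shock_positive[OF assms(3) \<mu>(1) \<alpha> W\<alpha>] shock_positive[OF assms(3) \<mu>(2) \<beta> W\<beta>]
  note st = shock_trig[OF assms(3) P1 \<alpha> W\<alpha>] shock_trig[OF assms(3) P1 \<beta> W\<beta>]
  note sd = before_shock_def behind_shock_def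
  have dens: "density (w i) > 0 \<and> internal_energy (w i) > 0" if "i < 6" for i
  proof -
    have gp: "density (gas_state \<gamma> r q \<phi> p) > 0 \<and> internal_energy (gas_state \<gamma> r q \<phi> p) > 0"
      if "r > 0" "p > 0" for r q \<phi> p
      using that assms(3) by (simp add: gas_state_simps)
    note gps = gp[OF sp(1,3)] gp[OF sp(2,4)] gp[OF sp(6,8)] gp[OF sp(7,9)] gp[OF sp(11,13)] gp[OF sp(12,14)]
    show ?thesis using that unfolding less6 by (elim disjE; simp only: ws sd gps)
  qed
  have vel: "vel_x (w 0) = 1 / cos \<alpha> * cos pi" "vel_y (w 0) = 1 / cos \<alpha> * sin pi"
    "vel_x (w 1) = 1 / sin \<alpha> * cos e" "vel_y (w 1) = 1 / sin \<alpha> * sin e"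
    "vel_x (w 2) = 1 / cos \<alpha> * cos (e + pi)" "vel_y (w 2) = 1 / cos \<alpha> * sin (e + pi)"
    "vel_x (w 3) = 1 / sin \<alpha> * cos f" "vel_y (w 3) = 1 / sin \<alpha> * sin f"
    "vel_x (w 4) = 1 / sin \<beta> * cos f" "vel_y (w 4) = 1 / sin \<beta> * sin f"
    "vel_x (w 5) = 1 / cos \<beta> * cos pi" "vel_y (w 5) = 1 / cos \<beta> * sin pi"
    unfolding ws sd by (simp_all only: gas_state_simps[OF sp(1) assms(3)] gas_state_simps[OF sp(2) assms(3)]
        gas_state_simps[OF sp(6) assms(3)] gas_state_simps[OF sp(7) assms(3)]
        gas_state_simps[OF sp(11) assms(3)] gas_state_simps[OF sp(12) assms(3)])
  define ph where "ph i = [pi, e, e + pi, f, f, pi] ! i" for i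
  have phs: "ph 0 = pi" "ph 1 = e" "ph 2 = e + pi" "ph 3 = f" "ph 4 = f" "ph 5 = pi"
    unfolding ph_def by (simp_all add: eval_nat_numeral)
  have vel': "\<exists>q>0. vel_x (w i) = q * cos (ph i) \<and> vel_y (w i) = q * sin (ph i)" if "i < 6" for i
  proof -
    have "1 / cos \<alpha> > 0" "1 / sin \<alpha> > 0" "1 / cos \<beta> > 0" "1 / sin \<beta> > 0" using st by simp_all
    then show ?thesis using that unfolding less6 by (elim disjE; simp only: vel phs; blast)
  qed
  have sh1: "normal_flux \<gamma> (w 0) s1 = normal_flux \<gamma> (w 1) s1"
    "normal_entropy_flux \<gamma> cv s0 (w 1) s1 \<le> normal_entropy_flux \<gamma> cv s0 (w 0) s1"
  proof -
    have a: "s1 + 1 * \<alpha> = pi" "s1 + 1 * (pi / 2 - \<alpha>) = e" unfolding s1_def e_def \<alpha>_def by simp_all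
    note j = shock_jump[OF assms(3) P1 \<alpha> W\<alpha>, where \<sigma> = 1 and s = s1, unfolded a]
    show "normal_flux \<gamma> (w 0) s1 = normal_flux \<gamma> (w 1) s1"
      "normal_entropy_flux \<gamma> cv s0 (w 1) s1 \<le> normal_entropy_flux \<gamma> cv s0 (w 0) s1"
      using j(1) j(2)[OF _ assms(5), of s0] unfolding ws by simp_all
  qed
  have sh2: "normal_flux \<gamma> (w 2) s2 = normal_flux \<gamma> (w 3) s2"
    "normal_entropy_flux \<gamma> cv s0 (w 3) s2 \<le> normal_entropy_flux \<gamma> cv s0 (w 2) s2"
  proof -
    have a: "s2 + 1 * \<alpha> = e + pi" "s2 + 1 * (pi / 2 - \<alpha>) = f" unfolding s2_def e_def f_def \<alpha>_def by simp_all
    note j = shock_jump[OF assms(3) \<mu>(1) \<alpha> W\<alpha>, where \<sigma> = 1 and s = s2, unfolded a]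
    show "normal_flux \<gamma> (w 2) s2 = normal_flux \<gamma> (w 3) s2"
      "normal_entropy_flux \<gamma> cv s0 (w 3) s2 \<le> normal_entropy_flux \<gamma> cv s0 (w 2) s2"
      using j(1) j(2)[OF _ assms(5), of s0] unfolding ws by simp_all
  qed
  have sh3: "normal_flux \<gamma> (w 4) s3 = normal_flux \<gamma> (w 5) s3"
    "normal_entropy_flux \<gamma> cv s0 (w 5) s3 \<le> normal_entropy_flux \<gamma> cv s0 (w 4) s3"
  proof -
    have a: "s3 + - 1 * \<beta> = pi" "s3 + - 1 * (pi / 2 - \<beta>) = f" unfolding s3_def f_def \<beta>_def by simp_all
    note j = shock_jump[OF assms(3) \<mu>(2) \<beta> W\<beta>, where \<sigma> = "- 1" and s = s3, unfolded a]
    show "normal_flux \<gamma> (w 4) s3 = normal_flux \<gamma> (w 5) s3"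
      "normal_entropy_flux \<gamma> cv s0 (w 5) s3 \<le> normal_entropy_flux \<gamma> cv s0 (w 4) s3"
      using j(1) j(2)[OF _ assms(5), of s0] unfolding ws by simp_all
  qed
  have pr: "\<mu>3 * pb = 1 * pa" "\<mu>2 * pa = 1 * pa'" "\<mu>2 * pa' = \<mu>3 * pb'" by fact+
  have "sin (0 - pi) = 0" "sin (e - e) = 0" "sin (e - (e + pi)) = 0" "sin (f - f) = 0" by simp_all
  note z = this
  note ps = sp[folded pa_def pa'_def pb_def pb'_def]
  note wd = ws[unfolded sd, folded pa_def pa'_def pb_def pb'_def, unfolded pr]
  note c0 = contact_jump[OF ps(11) ps(1) assms(3) ps(3) z(1) z(1)]
  note c1 = contact_jump[OF ps(2) ps(6) assms(3) ps(4) z(2) z(3)]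
  note c2 = contact_jump[OF ps(7) ps(12) assms(3) ps(14) z(4) z(4)]
  have co: "normal_flux \<gamma> (w 5) 0 = normal_flux \<gamma> (w 0) 0"
    "normal_entropy_flux \<gamma> cv s0 (w 5) 0 = normal_entropy_flux \<gamma> cv s0 (w 0) 0"
    "normal_flux \<gamma> (w 1) e = normal_flux \<gamma> (w 2) e"
    "normal_entropy_flux \<gamma> cv s0 (w 1) e = normal_entropy_flux \<gamma> cv s0 (w 2) e"
    "normal_flux \<gamma> (w 3) f = normal_flux \<gamma> (w 4) f"
    "normal_entropy_flux \<gamma> cv s0 (w 3) f = normal_entropy_flux \<gamma> cv s0 (w 4) f"
    unfolding wd by (rule c0 c1 c2)+
  have flow: "nonstagnant_flow \<gamma> cv s0 (step_flow 6 b w)"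
  proof (rule nonstagnant_flow_step_flow[OF dens])
    show "(vel_x (w i), vel_y (w i)) \<noteq> (0, 0)" if i6: "i < 6" for i
    proof -
      obtain q where "q > 0" "vel_x (w i) = q * cos (ph i)" "vel_y (w i) = q * sin (ph i)"
        using vel'[OF i6] by blast
      then show ?thesis using sin_zero_abs_cos_one[of "ph i"] by auto
    qed
    show "normal_flux \<gamma> (w (prev i)) (b i) = normal_flux \<gamma> (w i) (b i)" if "i < 6" for i
      using that unfolding less6 by (elim disjE; simp only: pv bs co sh1 sh2 sh3)
    show "normal_entropy_flux \<gamma> cv s0 (w i) (b i) \<le> normal_entropy_flux \<gamma> cv s0 (w (prev i)) (b i)" if "i < 6" for i
      using that unfolding less6 by (elim disjE; simp only: pv bs co sh1 sh2 sh3 order_refl)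
  qed
  have par: "vel_x (w i) * sin \<theta> = vel_y (w i) * cos \<theta> \<longleftrightarrow> sin (\<theta> - ph i) = 0" if i6: "i < 6" for i \<theta>
  proof -
    obtain q where "q > 0" "vel_x (w i) = q * cos (ph i)" "vel_y (w i) = q * sin (ph i)"
      using vel'[OF i6] by blast
    then have "vel_x (w i) * sin \<theta> - vel_y (w i) * cos \<theta> = q * sin (\<theta> - ph i)"
      by (simp add: sin_diff algebra_simps)
    then show ?thesis using \<open>q > 0\<close> by (metis eq_iff_diff_eq_0 less_irrefl mult_eq_0_iff)
  qed
  have neg: "sin x \<noteq> 0" if "- pi < x" "x < 0" for x using sin_gt_zero[of "- x"] that by simp
  have pos: "sin x \<noteq> 0" if "0 < x" "x < pi" for x using sin_gt_zero[of x] that by simp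
  have angles: "\<theta> \<in> sector_angles (step_flow 6 b w) \<longleftrightarrow> \<theta> = 0 \<or> \<theta> = e \<or> \<theta> = f" for \<theta>
  proof -
    have bS: "b (Suc 0) = s1" "b (Suc 1) = e" "b (Suc 2) = s2" "b (Suc 3) = f" "b (Suc 4) = s3" "b (Suc 5) = 2 * pi"
      using bs by (simp_all add: eval_nat_numeral)
    have ex6: "(\<exists>i<6. Q i) \<longleftrightarrow> Q 0 \<or> Q 1 \<or> Q 2 \<or> Q 3 \<or> Q 4 \<or> Q 5" for Q :: "nat \<Rightarrow> bool"
      unfolding less6 by blast
    have "\<theta> \<in> sector_angles (step_flow 6 b w) \<longleftrightarrow> (\<exists>i<6. b i \<le> \<theta> \<and> \<theta> < b (Suc i) \<and> sin (\<theta> - ph i) = 0)"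
      unfolding sector_angles_step_flow using par by auto
    also have "\<dots> \<longleftrightarrow> (0 \<le> \<theta> \<and> \<theta> < s1 \<and> sin (\<theta> - pi) = 0) \<or> (s1 \<le> \<theta> \<and> \<theta> < e \<and> sin (\<theta> - e) = 0) \<or>
        (e \<le> \<theta> \<and> \<theta> < s2 \<and> sin (\<theta> - (e + pi)) = 0) \<or> (s2 \<le> \<theta> \<and> \<theta> < f \<and> sin (\<theta> - f) = 0) \<or>
        (f \<le> \<theta> \<and> \<theta> < s3 \<and> sin (\<theta> - f) = 0) \<or> (s3 \<le> \<theta> \<and> \<theta> < 2 * pi \<and> sin (\<theta> - pi) = 0)"
      unfolding ex6 by (simp only: bs bS phs)
    also have "\<dots> \<longleftrightarrow> \<theta> = 0 \<or> \<theta> = e \<or> \<theta> = f"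
    proof -
      have a1: "0 \<le> \<theta> \<and> \<theta> < s1 \<and> sin (\<theta> - pi) = 0 \<longleftrightarrow> \<theta> = 0"
        using neg[of "\<theta> - pi"] order \<alpha> unfolding s1_def by (cases "\<theta> = 0") auto
      have a2: "\<not> (s1 \<le> \<theta> \<and> \<theta> < e \<and> sin (\<theta> - e) = 0)"
        using neg[of "\<theta> - e"] order d unfolding s1_def e_def \<alpha>_def by auto
      have a3: "e \<le> \<theta> \<and> \<theta> < s2 \<and> sin (\<theta> - (e + pi)) = 0 \<longleftrightarrow> \<theta> = e"
        using neg[of "\<theta> - (e + pi)"] z(3) order \<alpha> unfolding s2_def by (cases "\<theta> = e") auto
      have a4: "\<not> (s2 \<le> \<theta> \<and> \<theta> < f \<and> sin (\<theta> - f) = 0)"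
        using neg[of "\<theta> - f"] d unfolding s2_def e_def f_def \<alpha>_def by auto
      have a5: "f \<le> \<theta> \<and> \<theta> < s3 \<and> sin (\<theta> - f) = 0 \<longleftrightarrow> \<theta> = f"
        using pos[of "\<theta> - f"] order d unfolding s3_def f_def \<beta>_def by (cases "\<theta> = 2 * pi - 2 * d") auto
      have a6: "\<not> (s3 \<le> \<theta> \<and> \<theta> < 2 * pi \<and> sin (\<theta> - pi) = 0)"
        using pos[of "\<theta> - pi"] \<beta> unfolding s3_def by auto
      show ?thesis by (simp only: a1 a2 a3 a4 a5 a6 simp_thms)
    qed
    finally show ?thesis .
  qed
  then have A: "sector_angles (step_flow 6 b w) = {0, e, f}" by blast
  have "card {0, e, f} = 3" using order by simp
  then have "has_num_sectors (step_flow 6 b w) 3"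
    unfolding has_num_sectors_def using length_sectors[of "step_flow 6 b w"] A by simp
  then show ?thesis using flow by blast
qed

theorem theorem9:
  fixes cv s0 :: real
  assumes "cv > 0"
  shows "((\<forall>U. nonstagnant_flow (7 / 5) cv s0 U \<longrightarrow> (\<exists>m\<le>2. has_num_sectors U m)) \<and>
          (\<exists>U. nonstagnant_flow (7 / 5) cv s0 U \<and> has_num_sectors U 2)) \<and>
         (\<exists>\<gamma>1 \<gamma>2. \<gamma>1 \<noteq> \<gamma>2 \<and>
            (\<forall>\<gamma>\<in>{\<gamma>1, \<gamma>2}. \<gamma> > 1 \<and> \<gamma> \<noteq> 7 / 5 \<and>
               (\<exists>U. nonstagnant_flow \<gamma> cv s0 U \<and> has_num_sectors U 3))) \<and>
         (\<forall>\<gamma>>1. \<forall>U. nonstagnant_flow \<gamma> cv s0 U \<longrightarrow> (\<exists>m\<le>3. has_num_sectors U m))"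
proof (intro conjI)
  show "\<forall>U. nonstagnant_flow (7 / 5) cv s0 U \<longrightarrow> (\<exists>m\<le>2. has_num_sectors U m)"
    using at_most_two_sectors[OF assms] by blast
  show "\<exists>U. nonstagnant_flow (7 / 5) cv s0 U \<and> has_num_sectors U 2"
    by (rule parallel_flow_two_sectors) simp
  show "\<forall>\<gamma>>1. \<forall>U. nonstagnant_flow \<gamma> cv s0 U \<longrightarrow> (\<exists>m\<le>3. has_num_sectors U m)"
    using at_most_three_sectors[OF _ assms] by blast
  \<comment> \<open>The solutions \<open>\<gamma>\<close> of \<open>\<gamma>\<^sup>2 c (1 + c) = 1\<close> for \<open>c = 3 / 5\<close> and \<open>c = 11 / 20\<close>.\<close>
  define \<gamma>1 \<gamma>2 where "\<gamma>1 = sqrt (25 / 24)" and "\<gamma>2 = sqrt (400 / 341)"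
  have sq: "\<gamma>1\<^sup>2 = 25 / 24" "\<gamma>2\<^sup>2 = 400 / 341" unfolding \<gamma>1_def \<gamma>2_def by simp_all
  have gt: "\<gamma>1 > 1" "\<gamma>2 > 1" unfolding \<gamma>1_def \<gamma>2_def by simp_all
  have "\<gamma>1\<^sup>2 \<noteq> \<gamma>2\<^sup>2" "\<gamma>1\<^sup>2 \<noteq> (7 / 5)\<^sup>2" "\<gamma>2\<^sup>2 \<noteq> (7 / 5)\<^sup>2"
    unfolding sq by (simp_all add: power2_eq_square)
  then have "\<gamma>1 \<noteq> \<gamma>2" "\<gamma>1 \<noteq> 7 / 5" "\<gamma>2 \<noteq> 7 / 5" by blast+
  moreover have "\<exists>U. nonstagnant_flow \<gamma>1 cv s0 U \<and> has_num_sectors U 3"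
    by (rule three_sector_flow[of "3 / 5"]) (use gt sq assms in auto)
  moreover have "\<exists>U. nonstagnant_flow \<gamma>2 cv s0 U \<and> has_num_sectors U 3"
    by (rule three_sector_flow[of "11 / 20"]) (use gt sq assms in auto)
  ultimately show "\<exists>\<gamma>1 \<gamma>2. \<gamma>1 \<noteq> \<gamma>2 \<and>
            (\<forall>\<gamma>\<in>{\<gamma>1, \<gamma>2}. \<gamma> > 1 \<and> \<gamma> \<noteq> 7 / 5 \<and>
               (\<exists>U. nonstagnant_flow \<gamma> cv s0 U \<and> has_num_sectors U 3))"
    using gt by (intro exI[of _ \<gamma>1] exI[of _ \<gamma>2]) simp
qed

end
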